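(* Let $s\in\mathbb{R}$ and $\delta>0$. Let $u_\delta\in L^1_{loc}((0,+\infty);H^s(\mathbb{R}^d;\mathbb{R}^d))$ be a distributional solution to the linear peridynamics model with initial data $(u_0,v_0)=(0,0)$. Then $u_\delta\equiv0$.
   Context: Fix $d\ge1$, $\kappa\in(0,\infty)$, $\alpha\in(0,1)$, and $\chi\in L^\infty(\mathbb{R})$ with $\operatorname{supp}\chi\subset[-1,1]$, $0\le\chi\le1$, $\chi\equiv1$ on $[-\tfrac12,\tfrac12]$. For $\delta>0$ let $\chi_\delta(y)=\chi(|y|/\delta)$, $y\in\mathbb{R}^d$. For a smooth, sufficiently decaying $u:\mathbb{R}^d\to\mathbb{R}^d$, $$K_\delta[u](x)=-\frac{\kappa}{\delta^{2(1-\alpha)}}\lim_{\varepsilon\to0}\int_{\{|y|>\varepsilon\}}\chi_\delta(y)\frac{u(x)-u(x-y)}{|y|^{d+2\alpha}}\,dy .$$ Fourier transform: $\hat u(\xi)=(2\pi)^{-d/2}\int u(x)e^{-ix\cdot\xi}dx$. For $s\in\mathbb{R}$, $H^s(\mathbb{R}^d;\mathbb{R}^d)=\{u\in\mathscr S':(1+|\xi|^2)^{s/2}\hat u\in L^2\}$. A function $u\in L^1_{loc}((0,\infty);H^s)$ is regarded as a distribution on $\mathbb{R}\times\mathbb{R}^d$ via $\langle u,\varphi\rangle=\int_0^\infty\langle u(t,\cdot),\varphi(t,\cdot)\rangle dt$ (with $H^{s}$–$H^{-s}$ duality). Distributional solution: given $u_0,v_0\in\mathcal D'(\mathbb{R}^d;\mathbb{R}^d)$,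 a distribution $u$ on $\mathbb{R}\times\mathbb{R}^d$ with $\operatorname{supp}u\subset[0,\infty)\times\mathbb{R}^d$ is a distributional solution of $\partial_{tt}u-K_\delta[u]=0$, $u(0)=u_0$, $\partial_tu(0)=v_0$ if $\langle u,\partial_{tt}\varphi-K_\delta[\varphi]\rangle=-\langle u_0,\partial_t\varphi(0,\cdot)\rangle+\langle v_0,\varphi(0,\cdot)\rangle$ for all $\varphi\in C^\infty_c(\mathbb{R}\times\mathbb{R}^d;\mathbb{R}^d)$, with $K_\delta$ acting in $x$ for each fixed $t$. *)

theory Defs
  imports "HOL-Analysis.Analysis"
begin

definition dd :: "('a::real_normed_vector \<Rightarrow> 'b::real_normed_vector) \<Rightarrow> 'a \<Rightarrow> 'a \<Rightarrow> 'b" where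
  "dd f v x = frechet_derivative f (at x) v"

fun iter_dd :: "('a::real_normed_vector \<Rightarrow> 'b::real_normed_vector) \<Rightarrow> 'a list \<Rightarrow> 'a \<Rightarrow> 'b" where
  "iter_dd f [] = f"
| "iter_dd f (v # vs) = (\<lambda>x. dd (iter_dd f vs) v x)"

definition smooth :: "('a::real_normed_vector \<Rightarrow> 'b::real_normed_vector) \<Rightarrow> bool" where
  "smooth f \<longleftrightarrow> (\<forall>vs x. iter_dd f vs differentiable (at x))"

definition test_fun :: "('a::real_normed_vector \<Rightarrow> 'b::real_normed_vector) \<Rightarrow> bool" where
  "test_fun f \<longleftrightarrow> smooth f \<and> compact (closure {p. f p \<noteq> 0})"

definition dtt :: "(real \<times> 'a::real_normed_vector \<Rightarrow> 'b::real_normed_vector) \<Rightarrow> real \<Rightarrow> 'a \<Rightarrow> 'b" where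
  "dtt f t x = iter_dd f [(1, 0), (1, 0)] (t, x)"

definition peri_op :: "real \<Rightarrow> real \<Rightarrow> real \<Rightarrow> (real \<Rightarrow> real)
    \<Rightarrow> (real^'n \<Rightarrow> real^'n) \<Rightarrow> real^'n \<Rightarrow> real^'n" where
  "peri_op \<kappa> \<alpha> \<delta> cutoff f x =
     - (\<kappa> / \<delta> powr (2 * (1 - \<alpha>))) *\<^sub>R
       Lim (at_right 0)
         (\<lambda>\<epsilon>. LINT y : {y. \<epsilon> < norm y} | lborel.
                (cutoff (norm y / \<delta>) / norm y powr (real CARD('n) + 2 * \<alpha>)) *\<^sub>R (f x - f (x - y)))"

definition ft :: "(real^'n \<Rightarrow> real^'n) \<Rightarrow> real^'n \<Rightarrow> complex^'n" where
  "ft f \<xi> = (\<chi> j. complex_of_real ((2 * pi) powr (- real CARD('n) / 2)) *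
              (LINT x | lborel. complex_of_real (f x $ j) * cis (- (x \<bullet> \<xi>))))"

definition vconj :: "complex^'n \<Rightarrow> complex^'n" where
  "vconj z = (\<chi> j. cnj (z $ j))"

text \<open>Squared H^s norm of the element whose Fourier transform is g.\<close>
definition hs_sq :: "real \<Rightarrow> (real^'n \<Rightarrow> complex^'n) \<Rightarrow> ennreal" where
  "hs_sq s g = (\<integral>\<^sup>+ \<xi>. ennreal ((1 + (norm \<xi>)\<^sup>2) powr s * (norm (g \<xi>))\<^sup>2) \<partial>lborel)"

definition hs_norm :: "real \<Rightarrow> (real^'n \<Rightarrow> complex^'n) \<Rightarrow> ennreal" where
  "hs_norm s g = (if hs_sq s g = \<infinity> then \<infinity> else ennreal (sqrt (enn2real (hs_sq s g))))"

text \<open>H^s -- H^{-s} duality pairing of u (given by its Fourier transform U) with a real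
  function whose Fourier transform is g: the extension of the integral of u . phi,
  i.e. the integral of U(xi) . g(-xi).\<close>
definition hs_pair :: "(real^'n \<Rightarrow> complex^'n) \<Rightarrow> (real^'n \<Rightarrow> complex^'n) \<Rightarrow> complex" where
  "hs_pair U g = (LINT \<xi> | lborel. (\<Sum>j\<in>UNIV. U \<xi> $ j * g (- \<xi>) $ j))"

text \<open>u in L^1_loc((0,infinity); H^s(R^d;R^d)), with u(t) represented by its Fourier
  transform U t.\<close>
definition L1loc_Hs :: "real \<Rightarrow> (real \<Rightarrow> real^'n \<Rightarrow> complex^'n) \<Rightarrow> bool" where
  "L1loc_Hs s U \<longleftrightarrow>
     (\<lambda>p. U (fst p) (snd p)) \<in> borel_measurable borel \<and>
     (AE t in lborel. 0 < t \<longrightarrow> (AE \<xi> in lborel. U t (- \<xi>) = vconj (U t \<xi>))) \<and>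
     (\<forall>a b. 0 < a \<longrightarrow> a \<le> b \<longrightarrow> (\<integral>\<^sup>+ t\<in>{a..b}. hs_norm s (U t) \<partial>lborel) < \<infinity>)"

definition dist_solution_zero_data ::
  "real \<Rightarrow> real \<Rightarrow> real \<Rightarrow> (real \<Rightarrow> real) \<Rightarrow> (real \<Rightarrow> real^'n \<Rightarrow> complex^'n) \<Rightarrow> bool" where
  "dist_solution_zero_data \<kappa> \<alpha> \<delta> cutoff U \<longleftrightarrow>
     (\<forall>\<phi> :: (real \<times> (real^'n)) \<Rightarrow> real^'n. test_fun \<phi> \<longrightarrow>
        (let P = (\<lambda>t. hs_pair (U t)
                    (ft (\<lambda>x. dtt \<phi> t x - peri_op \<kappa> \<alpha> \<delta> cutoff (\<lambda>y. \<phi> (t, y)) x)))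
         in set_integrable lborel {0<..} P \<and> (LINT t : {0<..} | lborel. P t) = 0))"

end

theory Submission
  imports Defs "HOL-Computational_Algebra.Polynomial"
begin

text \<open>Proof idea. On the Fourier side \<open>K\<^sub>\<delta>\<close> is multiplication by \<open>- m(\<xi>)\<close> with \<open>0 \<le> m(\<xi>) \<le> C (1 + |\<xi>|\<^sup>2)\<close>.
  Testing with \<open>\<theta>(t) \<psi>(x - x\<^sub>0) e\<^sub>j\<close> for all translations \<open>x\<^sub>0\<close> and using that an integrable function
  with vanishing Fourier transform is zero, each component \<open>f = U(\<cdot>, \<xi>)\<close> solves \<open>f'' + m(\<xi>) f = 0\<close>
  weakly on \<open>(0,\<infinity>)\<close> for almost every \<open>\<xi>\<close>. Integrability up to \<open>t = 0\<close> is not assumed, so the initial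
  data are not yet visible at fixed \<open>\<xi>\<close>; however, solutions of this equation satisfy
  \<open>f(t - 1) = 2 cos(\<surd>m) f(t) - f(t + 1)\<close>, and since \<open>|cos| \<le> 1\<close> this gives \<open>U \<in> L\<^sup>1((0,1); H\<^sup>s)\<close>. Then test
  functions \<open>\<theta>\<close> that do not vanish near \<open>t = 0\<close> may be used at fixed \<open>\<xi>\<close>, and solving the adjoint problem
  backwards in time yields \<open>f = 0\<close>.\<close>

section \<open>Elementary smooth functions\<close>

text \<open>An equation that holds for almost every \<xi> carries a null set depending on the time
  profile, while the profiles that solve the adjoint equation depend on \<xi> through m(\<xi>).
  Hence only countably many profiles, plateaus times monomials, are tested in (t,x). The null sets
  are united, and at each remaining \<xi> Weierstrass approximation in C^2 recovers every profile
  needed there. Spatial factors have compact support, so their transforms may have zeros and cannot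
  be divided out everywhere; bumps of radius 1/(n+1) are used, whose transforms have no zero for
  |\<xi>| \<le> n+1. Rapid decay of these transforms pays for H^s with any real s and for the factor
  1 + m. The three-term relation has constants that do not depend on m, so it can be integrated over
  \<xi> against the same weights, and it compares f near 0 with f on (1,3) only, where integrability
  is assumed.\<close>

definition flat :: "nat \<Rightarrow> real \<Rightarrow> real" where
  "flat k r = (if 0 < r then exp (- inverse r) * inverse r ^ k else 0)"

lemma flat_tendsto_0: "(flat k \<longlongrightarrow> 0) (at_right 0)"
proof -
  have "((\<lambda>r. inverse r ^ k / exp (inverse r)) \<longlongrightarrow> (0::real)) (at_right 0)"
    by (rule filterlim_compose[OF tendsto_power_div_exp_0 filterlim_inverse_at_top_right])
  moreover have "\<forall>\<^sub>F r in at_right 0. inverse r ^ k / exp (inverse r) = flat k r"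
    by (auto simp: eventually_at_right_less flat_def exp_minus field_simps eventually_at_filter)
  ultimately show ?thesis
    by (rule Lim_transform_eventually)
qed

lemma flat_has_real_derivative:
  "(flat k has_real_derivative flat (k + 2) r - real k * flat (k + 1) r) (at r)"
proof (cases r "0::real" rule: linorder_cases)
  case less
  have "((\<lambda>_. 0) has_real_derivative 0) (at r)"
    by simp
  then have "(flat k has_real_derivative 0) (at r)"
    by (rule has_field_derivative_transform_within_open[where S="{..<0}"])
      (use less in \<open>auto simp: flat_def\<close>)
  with less show ?thesis
    by (simp add: flat_def)
next
  case equal
  \<comment> \<open>For h > 0 the quotient \<open>flat k h / h\<close> equals
    \<open>flat (k + 1) h\<close>, so the limit at 0 for the exponent k + 1 gives the right
    derivative.\<close>
  have *: "((\<lambda>h. (flat k (0 + h) - flat k 0) / h) \<longlongrightarrow> 0) (at_right 0)"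
    by (rule Lim_transform_eventually[OF flat_tendsto_0[of "k + 1"]])
      (auto simp: flat_def eventually_at_filter field_simps)
  have "((\<lambda>h. (flat k (0 + h) - flat k 0) / h) \<longlongrightarrow> 0) (at_left 0)"
    by (rule Lim_transform_eventually[OF tendsto_const])
      (auto simp: flat_def eventually_at_filter)
  with * have "((\<lambda>h. (flat k (0 + h) - flat k 0) / h) \<longlongrightarrow> 0) (at 0)"
    by (simp add: filterlim_split_at)
  with equal show ?thesis
    unfolding DERIV_def by (simp add: flat_def)
next
  case greater
  have "((\<lambda>r. exp (- inverse r) * inverse r ^ k) has_real_derivative
      flat (k + 2) r - real k * flat (k + 1) r) (at r)"
    using greater
    by (auto intro!: derivative_eq_intros simp: flat_def field_simps power2_eq_square
        simp flip: power_Suc) (cases k; simp)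
  then show ?thesis
    by (rule has_field_derivative_transform_within_open[where S="{0<..}"])
      (use greater in \<open>auto simp: flat_def\<close>)
qed

text \<open>This class is closed under directional derivatives (the derivatives of \<open>flat k\<close> are again
  combinations of functions \<open>flat k\<close>), so smoothness of its members follows without iterated Leibniz and
  chain rules.\<close>

inductive elem :: "('a::real_normed_vector \<Rightarrow> real) \<Rightarrow> bool" where
  elem_const: "elem (\<lambda>_. c)"
| elem_linear: "bounded_linear l \<Longrightarrow> elem l"
| elem_add: "elem f \<Longrightarrow> elem g \<Longrightarrow> elem (\<lambda>x. f x + g x)"
| elem_mult: "elem f \<Longrightarrow> elem g \<Longrightarrow> elem (\<lambda>x. f x * g x)"
| elem_inverse: "elem f \<Longrightarrow> (\<And>x. f x \<noteq> 0) \<Longrightarrow> elem (\<lambda>x. inverse (f x))"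
| elem_flat: "elem f \<Longrightarrow> elem (\<lambda>x. flat k (f x))"

lemma elem_minus: "elem f \<Longrightarrow> elem (\<lambda>x. - f x)"
  using elem_mult[OF elem_const[of "-1"]] by simp

lemma elem_diff: "elem f \<Longrightarrow> elem g \<Longrightarrow> elem (\<lambda>x. f x - g x)"
  using elem_add[OF _ elem_minus] by simp

lemma elem_power: "elem f \<Longrightarrow> elem (\<lambda>x. f x ^ k)"
  by (induction k) (auto intro: elem_const elem_mult)

lemma elem_sum: "finite I \<Longrightarrow> (\<And>i. i \<in> I \<Longrightarrow> elem (f i)) \<Longrightarrow> elem (\<lambda>x. \<Sum>i\<in>I. f i x)"
  by (induction rule: finite_induct) (auto intro: elem_const elem_add)

text \<open>This one substitution rule covers translations, rescaled steps, and functions of a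
  single factor of a product space.\<close>

lemma elem_affine: "elem f \<Longrightarrow> bounded_linear L \<Longrightarrow> elem (\<lambda>x. f (L x + c))"
proof (induction rule: elem.induct)
  case (elem_linear l)
  have "elem (\<lambda>x. l (L x))"
    by (rule elem.elem_linear[OF bounded_linear_compose[OF elem_linear]])
  then have "elem (\<lambda>x. l (L x) + l c)"
    by (rule elem.elem_add[OF _ elem.elem_const])
  with elem_linear show ?case
    by (simp add: linear_simps)
next
  case (elem_inverse f)
  then show ?case by (intro elem.elem_inverse) auto
next
  case (elem_const k)
  show ?case by (rule elem.elem_const)
next
  case (elem_add f g)
  then show ?case by (intro elem.elem_add) auto
next
  case (elem_mult f g)
  then show ?case by (intro elem.elem_mult) auto
next
  case (elem_flat f k)
  then show ?case by (intro elem.elem_flat) auto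
qed

lemma elem_translate: "elem (\<lambda>x. f (x - c))" if "elem f"
  using elem_affine[OF that bounded_linear_ident, of "- c"] by simp

text \<open>Differentiability and membership of the derivatives are proved together, because the
  derivative of each constructor is built by the same constructors from the parts and their
  derivatives. Fixing the direction v and varying the point is what allows iteration.\<close>

lemma elem_derivative:
  assumes "elem f"
  shows "\<exists>f'. (\<forall>x. (f has_derivative (\<lambda>v. f' v x)) (at x)) \<and> (\<forall>v. elem (f' v))"
  using assms
proof induction
  case (elem_const c)
  show ?case by (rule exI[of _ "\<lambda>_ _. 0"]) (simp add: elem.elem_const)
next
  case (elem_linear l)
  show ?case
    by (rule exI[of _ "\<lambda>v _. l v"])
      (auto intro: elem.elem_const bounded_linear_imp_has_derivative elem_linear)
next
  case (elem_add f g)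
  then obtain f' g' where "\<And>x. (f has_derivative (\<lambda>v. f' v x)) (at x)" "\<And>v. elem (f' v)"
    "\<And>x. (g has_derivative (\<lambda>v. g' v x)) (at x)" "\<And>v. elem (g' v)"
    by blast
  then show ?case
    by (intro exI[of _ "\<lambda>v x. f' v x + g' v x"])
      (intro conjI allI elem.elem_add has_derivative_add)
next
  case (elem_mult f g)
  then obtain f' g' where "\<And>x. (f has_derivative (\<lambda>v. f' v x)) (at x)" "\<And>v. elem (f' v)"
    "\<And>x. (g has_derivative (\<lambda>v. g' v x)) (at x)" "\<And>v. elem (g' v)"
    by blast
  with elem_mult.hyps show ?case
    by (intro exI[of _ "\<lambda>v x. f x * g' v x + f' v x * g x"])
      (intro conjI allI elem.elem_add elem.elem_mult has_derivative_mult)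
next
  case (elem_inverse f)
  then obtain f' where f': "\<And>x. (f has_derivative (\<lambda>v. f' v x)) (at x)" "\<And>v. elem (f' v)"
    by blast
  have "((\<lambda>x. inverse (f x)) has_derivative (\<lambda>v. - (inverse (f x) * f' v x * inverse (f x)))) (at x)" for x
    by (rule Deriv.has_derivative_inverse[OF elem_inverse.hyps(2) f'(1)])
  moreover have "elem (\<lambda>x. - (inverse (f x) * f' v x * inverse (f x)))" for v
    using elem_inverse.hyps f' by (intro elem_minus elem.elem_mult elem.elem_inverse)
  ultimately show ?case
    by (intro exI[of _ "\<lambda>v x. - (inverse (f x) * f' v x * inverse (f x))"]) blast
next
  case (elem_flat f k)
  then obtain f' where f': "\<And>x. (f has_derivative (\<lambda>v. f' v x)) (at x)" "\<And>v. elem (f' v)"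
    by blast
  have "((\<lambda>x. flat k (f x)) has_derivative
      (\<lambda>v. (flat (k + 2) (f x) + (- real k) * flat (k + 1) (f x)) * f' v x)) (at x)" for x
    using has_derivative_compose[OF f'(1)[of x] flat_has_real_derivative[of k "f x",
        unfolded has_field_derivative_def]]
    by (simp add: mult.commute)
  moreover have "elem (\<lambda>x. (flat (k + 2) (f x) + (- real k) * flat (k + 1) (f x)) * f' v x)" for v
    using elem_flat.hyps f'
    by (intro elem.elem_mult elem.elem_add elem.elem_flat elem.elem_const)
  ultimately show ?case
    by (intro exI[of _ "\<lambda>v x. (flat (k + 2) (f x) + (- real k) * flat (k + 1) (f x)) * f' v x"]) blast
qed

lemma elem_has_derivative_dd: "elem f \<Longrightarrow> (f has_derivative (\<lambda>v. dd f v x)) (at x)"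
  unfolding dd_def using elem_derivative[of f] frechet_derivative_at by metis

lemma elem_dd: "elem f \<Longrightarrow> elem (dd f v)"
proof -
  assume "elem f"
  then obtain f' where f': "\<And>x. (f has_derivative (\<lambda>v. f' v x)) (at x)" "\<And>v. elem (f' v)"
    using elem_derivative by blast
  have "dd f v = f' v"
    unfolding dd_def using frechet_derivative_at[OF f'(1)] by (auto simp: fun_eq_iff)
  with f'(2) show ?thesis by simp
qed

lemma elem_iter_dd: "elem f \<Longrightarrow> elem (iter_dd f vs)"
  by (induction vs) (auto intro: elem_dd)

text \<open>Test functions are vector valued, but only multiples of one fixed vector occur, so
  directional derivatives reduce to those of the scalar profile.\<close>

lemma elem_iter_dd_scaleR:
  assumes "elem f"
  shows "iter_dd (\<lambda>x. f x *\<^sub>R e) vs = (\<lambda>x. iter_dd f vs x *\<^sub>R e)"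
proof (induction vs)
  case (Cons v vs)
  have "((\<lambda>x. iter_dd f vs x *\<^sub>R e) has_derivative (\<lambda>v. dd (iter_dd f vs) v x *\<^sub>R e)) (at x)" for x
    by (intro has_derivative_scaleR_left elem_has_derivative_dd elem_iter_dd assms)
  from fun_cong[OF frechet_derivative_at[OF this], of v, symmetric] show ?case
    by (simp add: Cons.IH dd_def[of "\<lambda>x. iter_dd f vs x *\<^sub>R e"])
qed auto

lemma elem_smooth_scaleR: "elem f \<Longrightarrow> smooth (\<lambda>x. f x *\<^sub>R e)"
  unfolding smooth_def
  by (auto simp: elem_iter_dd_scaleR
      intro: differentiableI[OF has_derivative_scaleR_left[OF elem_has_derivative_dd[OF elem_iter_dd]]])

lemma elem_continuous: "elem f \<Longrightarrow> continuous_on S f"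
  by (intro continuous_at_imp_continuous_on ballI has_derivative_continuous[OF elem_has_derivative_dd])

lemma elem_measurable: "elem (f :: 'a::euclidean_space \<Rightarrow> real) \<Longrightarrow> f \<in> borel_measurable borel"
  by (intro borel_measurable_continuous_onI elem_continuous)

lemma elem_has_real_derivative: "elem f \<Longrightarrow> (f has_real_derivative deriv f t) (at t)"
  by (metis DERIV_deriv_iff_real_differentiable differentiableI elem_has_derivative_dd)

lemma elem_deriv: "elem (f :: real \<Rightarrow> real) \<Longrightarrow> elem (deriv f)"
proof -
  assume f: "elem f"
  have "deriv f t = dd f 1 t" for t
  proof -
    have "(\<lambda>v. dd f v t) = (*) (deriv f t)"
      using has_derivative_unique[OF elem_has_derivative_dd[OF f]
          elem_has_real_derivative[OF f, unfolded has_field_derivative_def]] .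
    then show ?thesis by (metis mult.right_neutral)
  qed
  with elem_dd[OF f, of 1] show ?thesis
    by (metis ext)
qed

lemma dtt_product:
  fixes \<psi> :: "'a::real_normed_vector \<Rightarrow> real"
  assumes \<theta>: "elem \<theta>" and \<psi>: "elem \<psi>"
  shows "dtt (\<lambda>p. (\<theta> (fst p) * \<psi> (snd p)) *\<^sub>R e) t x = (deriv (deriv \<theta>) t * \<psi> x) *\<^sub>R e"
proof -
  \<comment> \<open>The profile is an arbitrary \<eta> because the formula is used twice, for
    \<theta> and then for \<open>deriv \<theta>\<close>.\<close>
  have *: "((\<lambda>p. \<eta> (fst p) * \<psi> (snd p)) has_derivative
      (\<lambda>v. \<eta> (fst p) * dd \<psi> (snd v) (snd p) + deriv \<eta> (fst p) * fst v * \<psi> (snd p))) (at p)"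
    if "elem \<eta>" for \<eta> and p :: "real \<times> 'a"
    by (rule has_derivative_mult
        [OF has_derivative_compose[OF bounded_linear_imp_has_derivative[OF bounded_linear_fst]
            elem_has_real_derivative[OF that, unfolded has_field_derivative_def]]
          has_derivative_compose[OF bounded_linear_imp_has_derivative[OF bounded_linear_snd]
            elem_has_derivative_dd[OF \<psi>]]])
  have **: "dd (\<lambda>p. \<eta> (fst p) * \<psi> (snd p)) (1, 0) = (\<lambda>p. deriv \<eta> (fst p) * \<psi> (snd p))"
    if "elem \<eta>" for \<eta>
  proof
    fix p :: "real \<times> 'a"
    \<comment> \<open>In the direction (1, 0) the spatial increment is 0, so the term with the
      derivative of \<psi> drops out.\<close>
    have "dd \<psi> 0 (snd p) = 0"
      using linear_0[OF has_derivative_linear[OF elem_has_derivative_dd[OF \<psi>]]] .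
    with fun_cong[OF frechet_derivative_at[OF *[OF that, of p]], of "(1, 0)", symmetric]
    show "dd (\<lambda>p. \<eta> (fst p) * \<psi> (snd p)) (1, 0) p = deriv \<eta> (fst p) * \<psi> (snd p)"
      unfolding dd_def[of "\<lambda>p. \<eta> (fst p) * \<psi> (snd p)"] by simp
  qed
  have prod: "elem (\<lambda>p :: real \<times> 'a. \<theta> (fst p) * \<psi> (snd p))"
    using elem_affine[OF \<theta> bounded_linear_fst, of 0] elem_affine[OF \<psi> bounded_linear_snd, of 0]
    by (intro elem_mult) auto
  then show ?thesis
    unfolding dtt_def elem_iter_dd_scaleR[OF prod]
    by (simp add: ** \<theta> elem_deriv)
qed

section \<open>Bumps, smooth steps and plateaus\<close>

definition bump :: "real \<Rightarrow> 'a::euclidean_space \<Rightarrow> real" where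
  "bump r x = flat 0 (r\<^sup>2 - (norm x)\<^sup>2)"

text \<open>The squared norm is a polynomial in the coordinates, whereas the norm itself is not
  smooth at 0.\<close>

lemma elem_bump: "elem (bump r)"
proof -
  have "elem (\<lambda>x::'a. flat 0 (r\<^sup>2 - (\<Sum>b\<in>Basis. (x \<bullet> b)\<^sup>2)))"
    by (intro elem_flat elem_diff elem_const elem_sum elem_power elem_linear bounded_linear_inner_left) auto
  moreover have "(\<Sum>b\<in>Basis. (x \<bullet> b)\<^sup>2) = (norm x)\<^sup>2" for x :: 'a
    by (subst power2_norm_eq_inner, subst euclidean_inner) (simp add: power2_eq_square)
  ultimately show ?thesis
    by (simp add: bump_def[abs_def])
qed

lemma bump_pos: "0 < bump r x \<longleftrightarrow> norm x < r" if "0 < r"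
proof -
  have "(norm x)\<^sup>2 < r\<^sup>2 \<longleftrightarrow> norm x < r"
    using that power_strict_mono[of "norm x" r 2] power2_less_imp_less[of "norm x" r] by auto
  then show ?thesis
    by (simp add: bump_def flat_def)
qed

lemma bump_nonneg: "0 \<le> bump r x"
  by (simp add: bump_def flat_def)

text \<open>Smooth transition from 0 on t \<le> 0 to 1 on t \<ge> 1. The denominator never vanishes
  because t and 1 - t cannot both be nonpositive.\<close>

definition sstep :: "real \<Rightarrow> real" where
  "sstep t = flat 0 t * inverse (flat 0 t + flat 0 (1 - t))"

lemma elem_sstep: "elem sstep"
proof -
  have "flat 0 t + flat 0 (1 - t) \<noteq> 0" for t
    by (auto simp: flat_def add_pos_pos add_nonneg_pos less_imp_neq[symmetric])
  then show ?thesis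
    unfolding sstep_def[abs_def]
    by (intro elem_mult elem_inverse elem_add elem_flat elem_diff elem_const
        elem_linear[OF bounded_linear_ident])
qed

text \<open>For a < b and c < d this cutoff vanishes outside (a, d) and equals 1 on [b, c]. The two
  transition intervals are separate parameters because the left one has to shrink towards t = 0 in
  one application.\<close>

definition plateau :: "real \<Rightarrow> real \<Rightarrow> real \<Rightarrow> real \<Rightarrow> real \<Rightarrow> real" where
  "plateau a b c d t = sstep ((t - a) / (b - a)) * sstep ((d - t) / (d - c))"

lemma elem_plateau: "elem (plateau a b c d)"
proof -
  have "elem (\<lambda>t. sstep (inverse (b - a) * t + (- a * inverse (b - a))))"
    "elem (\<lambda>t. sstep (- inverse (d - c) * t + d * inverse (d - c)))"
    by (intro elem_affine[OF elem_sstep] bounded_linear_mult_right)+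
  moreover have "plateau a b c d = (\<lambda>t. sstep (inverse (b - a) * t + (- a * inverse (b - a)))
      * sstep (- inverse (d - c) * t + d * inverse (d - c)))"
    by (auto simp: fun_eq_iff plateau_def divide_inverse left_diff_distrib mult.commute)
  ultimately show ?thesis
    by (simp only: elem_mult)
qed

lemma plateau_eq_0:
  assumes "a < b" "c < d" "t \<le> a \<or> d \<le> t"
  shows "plateau a b c d t = 0"
proof -
  have "(t - a) / (b - a) \<le> 0 \<or> (d - t) / (d - c) \<le> 0"
    using assms by (auto simp: divide_le_0_iff)
  then show ?thesis
    by (auto simp: plateau_def sstep_def flat_def)
qed

lemma plateau_eq_1:
  assumes "a < b" "c < d" "b \<le> t" "t \<le> c"
  shows "plateau a b c d t = 1"
proof -
  have "1 \<le> (t - a) / (b - a)" "1 \<le> (d - t) / (d - c)"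
    using assms by auto
  then show ?thesis
    by (simp add: plateau_def sstep_def flat_def)
qed

section \<open>Uniqueness for the Fourier transform\<close>

lemma pair_integrableI:
  fixes f :: "'a::euclidean_space \<times> 'b::euclidean_space \<Rightarrow> 'c::{banach, second_countable_topology}"
  assumes [measurable]: "f \<in> borel_measurable (lborel \<Otimes>\<^sub>M lborel)"
    and "(\<integral>\<^sup>+x. \<integral>\<^sup>+y. norm (f (x, y)) \<partial>lborel \<partial>lborel) < \<infinity>"
  shows "integrable (lborel \<Otimes>\<^sub>M lborel) f"
  using assms(2) by (intro integrableI_bounded) (simp_all add: lborel.nn_integral_fst[symmetric])

lemma pair_integrable_mult_bound:
  fixes f :: "'a::euclidean_space \<times> 'b::euclidean_space \<Rightarrow> 'c::{banach, second_countable_topology}"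
  assumes [measurable]: "f \<in> borel_measurable (lborel \<Otimes>\<^sub>M lborel)"
    and g: "integrable lborel g" and h: "integrable lborel h"
    and le: "\<And>x y. norm (f (x, y)) \<le> g x * h y"
  shows "integrable (lborel \<Otimes>\<^sub>M lborel) f"
proof (rule pair_integrableI)
  have [measurable]: "g \<in> borel_measurable lborel" "h \<in> borel_measurable lborel"
    using g h by auto
  have "(\<integral>\<^sup>+x. \<integral>\<^sup>+y. norm (f (x, y)) \<partial>lborel \<partial>lborel)
      \<le> (\<integral>\<^sup>+x. \<integral>\<^sup>+y. ennreal (norm (g x)) * ennreal (norm (h y)) \<partial>lborel \<partial>lborel)"
    using le by (intro nn_integral_mono)
      (auto simp: ennreal_mult[symmetric] abs_mult[symmetric] intro!: ennreal_leI order.trans[OF le])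
  also have "\<dots> = (\<integral>\<^sup>+x. norm (g x) \<partial>lborel) * (\<integral>\<^sup>+y. norm (h y) \<partial>lborel)"
    by (simp add: nn_integral_cmult nn_integral_multc)
  also have "\<dots> < \<infinity>"
    using g h by (simp add: integrable_iff_bounded ennreal_mult_less_top)
  finally show "(\<integral>\<^sup>+x. \<integral>\<^sup>+y. norm (f (x, y)) \<partial>lborel \<partial>lborel) < \<infinity>" .
qed fact

lemma has_bochner_integral_affine:
  fixes f :: "'a::euclidean_space \<Rightarrow> 'b::{banach, second_countable_topology}"
  assumes c: "c \<noteq> 0" and f: "has_bochner_integral lborel f I"
  shows "has_bochner_integral lborel (\<lambda>x. f (t + c *\<^sub>R x)) (I /\<^sub>R \<bar>c\<bar> ^ DIM('a))"
proof -
  have [measurable]: "f \<in> borel_measurable borel"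
    using f by (auto simp: has_bochner_integral_iff)
  have "has_bochner_integral (density (distr lborel borel (\<lambda>x. t + c *\<^sub>R x)) (\<lambda>_. \<bar>c\<bar> ^ DIM('a))) f I"
    using f by (simp flip: lborel_affine[OF c])
  then have "has_bochner_integral lborel (\<lambda>x. \<bar>c\<bar> ^ DIM('a) *\<^sub>R f (t + c *\<^sub>R x)) I"
    using c by (simp add: has_bochner_integral_iff integrable_density integral_density
        integrable_distr_eq integral_distr)
  from has_bochner_integral_scaleR_right[OF this, of "inverse (\<bar>c\<bar> ^ DIM('a))"] c
  show ?thesis by simp
qed

lemma integral_affine:
  fixes f :: "'a::euclidean_space \<Rightarrow> 'b::{banach, second_countable_topology}"
  assumes "c \<noteq> 0" "integrable lborel f"
  shows "integrable lborel (\<lambda>x. f (t + c *\<^sub>R x))"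
    and "(LINT x|lborel. f (t + c *\<^sub>R x)) = (LINT x|lborel. f x) /\<^sub>R \<bar>c\<bar> ^ DIM('a)"
  using has_bochner_integral_affine[OF assms(1) has_bochner_integral_integrable[OF assms(2)]]
  by (auto simp: has_bochner_integral_iff)

lemma integral_translate:
  fixes f :: "'a::euclidean_space \<Rightarrow> 'b::{banach, second_countable_topology}"
  assumes "integrable lborel f"
  shows "integrable lborel (\<lambda>x. f (x + t))" "(LINT x|lborel. f (x + t)) = (LINT x|lborel. f x)"
  using integral_affine[OF _ assms, of 1 t] by (simp_all add: add.commute)

text \<open>The functions max(0, 1 - n dist(x, C)) decrease to the indicator of a nonempty closed
  set C, so W has zero integral over C. Closed sets are stable under intersection and generate the
  Borel sets; Dynkin's argument extends the vanishing to all of them.\<close>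

lemma AE_eq_0_if_continuous_integrals_0:
  fixes W :: "'a::euclidean_space \<Rightarrow> complex"
  assumes W: "integrable lborel W"
    and 0: "\<And>g. continuous_on UNIV g \<Longrightarrow> (\<And>x. 0 \<le> g x \<and> g x \<le> 1) \<Longrightarrow>
      (LINT x|lborel. g x *\<^sub>R W x) = 0"
  shows "AE x in lborel. W x = 0"
proof (rule sigma_finite_measure.density_zero[OF sigma_finite_lborel W])
  have [measurable]: "W \<in> borel_measurable borel"
    using W by auto
  have closed0: "(LINT x:C|lborel. W x) = 0" if "closed C" for C :: "'a set"
  proof (cases "C = {}")
    case False
    define g where "g n x = max 0 (1 - real n * infdist x C)" for n x
    have g: "continuous_on UNIV (g n)" "\<And>x. 0 \<le> g n x \<and> g n x \<le> 1" for n
      unfolding g_def by (auto intro!: continuous_intros simp: infdist_nonneg)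
    then have [measurable]: "g n \<in> borel_measurable borel" for n
      by (intro borel_measurable_continuous_onI)
    have [measurable]: "C \<in> sets borel"
      using that by auto
    have "(\<lambda>n. LINT x|lborel. g n x *\<^sub>R W x) \<longlonglongrightarrow> (LINT x|lborel. indicat_real C x *\<^sub>R W x)"
    proof (rule integral_dominated_convergence)
      show "integrable lborel (\<lambda>x. norm (W x))"
        using W by simp
      show "AE x in lborel. (\<lambda>n. g n x *\<^sub>R W x) \<longlonglongrightarrow> indicat_real C x *\<^sub>R W x"
      proof (intro AE_I2 tendsto_scaleR tendsto_const)
        fix x :: 'a
        show "(\<lambda>n. g n x) \<longlonglongrightarrow> indicat_real C x"
        proof (cases "x \<in> C")
          case False
          with that \<open>C \<noteq> {}\<close> have pos: "0 < infdist x C"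
            using in_closed_iff_infdist_zero infdist_nonneg
            by (metis antisym_conv1)
          obtain N :: nat where N: "1 / infdist x C < N"
            using reals_Archimedean2 by blast
          have "g n x = 0" if "N \<le> n" for n
          proof -
            have "1 < real N * infdist x C"
              using N pos by (simp add: field_simps)
            also have "\<dots> \<le> real n * infdist x C"
              using that pos by (intro mult_right_mono) auto
            finally show ?thesis by (simp add: g_def)
          qed
          then have "(\<lambda>n. g n x) \<longlonglongrightarrow> 0"
            by (intro tendsto_eventually) (auto simp: eventually_sequentially)
          with False show ?thesis
            by simp
        qed (simp add: g_def)
      qed
      show "AE x in lborel. norm (g n x *\<^sub>R W x) \<le> norm (W x)" for n
        using g(2) by (auto intro!: AE_I2 mult_left_le_one_le)
    qed auto
    moreover have "(LINT x|lborel. g n x *\<^sub>R W x) = 0" for n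
      using 0[OF g] .
    ultimately show ?thesis
      by (simp add: set_lebesgue_integral_def LIMSEQ_const_iff)
  qed (simp add: set_lebesgue_integral_def)
  fix A :: "'a set" assume "A \<in> sets lborel"
  then have A: "A \<in> sigma_sets UNIV (Collect closed)"
    by (simp add: borel_eq_closed)
  have sets: "sigma_sets UNIV (Collect closed) = sets (lborel :: 'a measure)"
    by (simp add: borel_eq_closed)
  have int: "set_integrable lborel A W" if "A \<in> sets lborel" for A
    unfolding set_integrable_def using that W by (intro integrable_mult_indicator)
  have "Int_stable (Collect closed :: 'a set set)" "Collect closed \<subseteq> Pow (UNIV :: 'a set)"
    by (auto simp: Int_stable_def)
  from this A show "(LINT x:A|lborel. W x) = 0"
  proof (induction rule: sigma_sets_induct_disjoint)
    case (compl A)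
    then have A: "A \<in> sets lborel"
      by (simp only: sets)
    have "(LINT x:UNIV|lborel. W x) = (LINT x:A \<union> (UNIV - A)|lborel. W x)"
      by (rule arg_cong[where f="\<lambda>S. LINT x:S|lborel. W x"]) auto
    also have "\<dots> = (LINT x:A|lborel. W x) + (LINT x:UNIV - A|lborel. W x)"
      using A by (intro set_integral_Un int) auto
    finally show ?case
      using compl closed0[of UNIV] by simp
  next
    case (union A)
    then have A: "A i \<in> sets lborel" for i
      unfolding sets by blast
    then have "(LINT x:(\<Union>i. A i)|lborel. W x) = (\<Sum>i. (LINT x:(A i)|lborel. W x))"
      using union(1) by (intro lebesgue_integral_countable_add int) (auto simp: disjoint_family_on_def)
    with union show ?case by simp
  qed (auto intro: closed0)
qed

text \<open>The phase is \<open>cis (x \<bullet> \<xi>)\<close>, so up to normalisation this is \<open>ft\<close> at \<open>- \<xi>\<close>, the argument that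
  occurs in \<open>hs_pair\<close>.\<close>

definition fint :: "('a::euclidean_space \<Rightarrow> real) \<Rightarrow> 'a \<Rightarrow> complex" where
  "fint f \<xi> = (LINT x|lborel. complex_of_real (f x) * cis (x \<bullet> \<xi>))"

lemma norm_fint_le:
  fixes f :: "'a::euclidean_space \<Rightarrow> real"
  shows "norm (fint f \<xi>) \<le> (LINT x|lborel. \<bar>f x\<bar>)"
  unfolding fint_def using integral_norm_bound[of lborel "\<lambda>x. complex_of_real (f x) * cis (x \<bullet> \<xi>)"]
  by (simp add: norm_mult)

lemma borel_measurable_cis [measurable]:
  "f \<in> borel_measurable M \<Longrightarrow> (\<lambda>x. cis (f x)) \<in> borel_measurable M"
  unfolding cis_conv_exp by measurable

lemma borel_measurable_fint:
  assumes [measurable]: "f \<in> borel_measurable borel"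
  shows "fint f \<in> borel_measurable borel"
  unfolding fint_def[abs_def] by measurable

lemma integrable_cis:
  assumes "integrable lborel W"
  shows "integrable lborel (\<lambda>\<xi>. W \<xi> * cis (x \<bullet> \<xi>))"
proof (rule Bochner_Integration.integrable_bound[OF assms])
  show "(\<lambda>\<xi>. W \<xi> * cis (x \<bullet> \<xi>)) \<in> borel_measurable lborel"
    using assms by (auto intro!: borel_measurable_times borel_measurable_cis)
qed (simp add: norm_mult)

text \<open>The factor \<open>fint \<psi> (c *\<^sub>R (\<xi> - \<eta>))\<close> is a superposition
  of phases in \<xi>. After an exchange of integrals the new transform at x averages the old one
  over the points x + c y, where it is 0. Integrability is part of the conclusion so that the lemma
  can be applied to its own result.\<close>

lemma vanishing_fourier_mult:
  fixes W :: "'a::euclidean_space \<Rightarrow> complex"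
  assumes W: "integrable lborel W" and \<psi>: "integrable lborel \<psi>"
    and 0: "\<And>x. (LINT \<xi>|lborel. W \<xi> * cis (x \<bullet> \<xi>)) = 0"
  shows "integrable lborel (\<lambda>\<xi>. W \<xi> * fint \<psi> (c *\<^sub>R (\<xi> - \<eta>)))"
    and "(LINT \<xi>|lborel. (W \<xi> * fint \<psi> (c *\<^sub>R (\<xi> - \<eta>))) * cis (x \<bullet> \<xi>)) = 0"
proof -
  have [measurable]: "W \<in> borel_measurable borel" "\<psi> \<in> borel_measurable borel"
    "fint \<psi> \<in> borel_measurable borel"
    using W \<psi> by (auto intro: borel_measurable_fint)
  show "integrable lborel (\<lambda>\<xi>. W \<xi> * fint \<psi> (c *\<^sub>R (\<xi> - \<eta>)))"
  proof (rule Bochner_Integration.integrable_bound)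
    show "integrable lborel (\<lambda>\<xi>. (LINT x|lborel. \<bar>\<psi> x\<bar>) *\<^sub>R norm (W \<xi>))"
      using W by simp
    show "AE \<xi> in lborel. norm (W \<xi> * fint \<psi> (c *\<^sub>R (\<xi> - \<eta>)))
        \<le> norm ((LINT x|lborel. \<bar>\<psi> x\<bar>) *\<^sub>R norm (W \<xi>))"
      by (intro AE_I2) (simp add: norm_mult mult.commute mult_left_mono norm_fint_le)
  qed simp
  let ?F = "\<lambda>y \<xi>. W \<xi> * (complex_of_real (\<psi> y) * cis (y \<bullet> (c *\<^sub>R (\<xi> - \<eta>)))) * cis (x \<bullet> \<xi>)"
  have "integrable (lborel \<Otimes>\<^sub>M lborel) (\<lambda>(y, \<xi>). ?F y \<xi>)"
    by (rule pair_integrable_mult_bound[OF _ integrable_norm[OF \<psi>] integrable_norm[OF W]])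
      (auto simp: norm_mult)
  from lborel_pair.Fubini_integral[OF this]
  have "(LINT \<xi>|lborel. LINT y|lborel. ?F y \<xi>) = (LINT y|lborel. LINT \<xi>|lborel. ?F y \<xi>)" .
  also have "(\<lambda>\<xi>. LINT y|lborel. ?F y \<xi>) = (\<lambda>\<xi>. (W \<xi> * fint \<psi> (c *\<^sub>R (\<xi> - \<eta>))) * cis (x \<bullet> \<xi>))"
    by (simp add: fint_def)
  also have "(\<lambda>y. LINT \<xi>|lborel. ?F y \<xi>) = (\<lambda>_. 0)"
  proof
    fix y
    have "?F y \<xi> = (complex_of_real (\<psi> y) * cis (- c * (y \<bullet> \<eta>))) * (W \<xi> * cis ((x + c *\<^sub>R y) \<bullet> \<xi>))" for \<xi>
      by (simp add: inner_diff_right inner_add_left right_diff_distrib mult.assoc mult.left_commute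
          cis_mult add.commute add.left_commute)
    then show "(LINT \<xi>|lborel. ?F y \<xi>) = 0"
      by (simp only: integral_mult_right_zero 0 mult_zero_right)
  qed
  finally show "(LINT \<xi>|lborel. (W \<xi> * fint \<psi> (c *\<^sub>R (\<xi> - \<eta>))) * cis (x \<bullet> \<xi>)) = 0"
    by simp
qed

lemma fint_uminus: "fint \<psi> (- \<xi>) = cnj (fint \<psi> \<xi>)"
  unfolding fint_def Bochner_Integration.integral_cnj[symmetric]
  by (simp add: cis_cnj del: Bochner_Integration.integral_cnj)

text \<open>The squared Fourier transform \<open>\<gamma>\<close> of \<open>\<psi>\<close> serves as an approximate identity, so that
  neither Fourier inversion nor Gaussians are needed.\<close>

lemma fourier_unique:
  fixes W :: "'a::euclidean_space \<Rightarrow> complex" and \<psi> :: "'a \<Rightarrow> real"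
  assumes W: "integrable lborel W" and \<psi>: "integrable lborel \<psi>"
    and 0: "\<And>x. (LINT \<xi>|lborel. W \<xi> * cis (x \<bullet> \<xi>)) = 0"
    and \<gamma>: "integrable lborel (\<lambda>\<xi>. (norm (fint \<psi> \<xi>))\<^sup>2)"
    and pos: "(LINT \<xi>|lborel. (norm (fint \<psi> \<xi>))\<^sup>2) \<noteq> 0"
  shows "AE \<xi> in lborel. W \<xi> = 0"
proof (rule AE_eq_0_if_continuous_integrals_0[OF W])
  fix g :: "'a \<Rightarrow> real" assume "continuous_on UNIV g" and g: "\<And>x. 0 \<le> g x \<and> g x \<le> 1"
  define \<gamma> :: "'a \<Rightarrow> real" where "\<gamma> \<xi> = (norm (fint \<psi> \<xi>))\<^sup>2" for \<xi>
  have [measurable]: "W \<in> borel_measurable borel" "\<psi> \<in> borel_measurable borel" "g \<in> borel_measurable borel"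
    "\<gamma> \<in> borel_measurable borel"
    using W \<psi> \<open>continuous_on UNIV g\<close> \<gamma> unfolding \<gamma>_def[abs_def]
    by (auto intro: borel_measurable_continuous_onI)
  have int\<gamma>: "integrable lborel \<gamma>"
    using \<gamma> by (simp add: \<gamma>_def[abs_def])
  have \<gamma>_nonneg: "0 \<le> \<gamma> \<xi>" for \<xi>
    by (simp add: \<gamma>_def)
  have conv0: "(LINT \<xi>|lborel. W \<xi> * complex_of_real (\<gamma> (c *\<^sub>R (\<xi> - \<eta>)))) = 0" for c \<eta>
  proof -
    \<comment> \<open>The second application uses -c. Since \<open>fint \<psi>\<close> at the
      reflected point is the complex conjugate, the two factors multiply to \<gamma>; evaluation at
      x = 0 removes the phase.\<close>
    note 1 = vanishing_fourier_mult[OF W \<psi> 0, of c \<eta>]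
    note 2 = vanishing_fourier_mult(2)[OF 1(1) \<psi> 1(2), of "- c" \<eta> 0]
    then show ?thesis
      by (simp add: \<gamma>_def mult.assoc fint_uminus complex_norm_square[symmetric])
  qed
  \<comment> \<open>Substitution z = c (\<xi> - \<eta>).\<close>
  have scaled: "(LINT \<eta>|lborel. g \<eta> * \<gamma> (c *\<^sub>R (\<xi> - \<eta>)))
      = (LINT z|lborel. g (\<xi> - z /\<^sub>R c) * \<gamma> z) / c ^ DIM('a)" if "0 < c" for c \<xi>
  proof -
    have "integrable lborel (\<lambda>z. g (\<xi> - z /\<^sub>R c) * \<gamma> z)"
      using int\<gamma>
    proof (rule Bochner_Integration.integrable_bound)
      show "AE z in lborel. norm (g (\<xi> - z /\<^sub>R c) * \<gamma> z) \<le> norm (\<gamma> z)"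
        using g by (auto intro!: AE_I2 mult_left_le_one_le simp: abs_mult)
    qed simp
    from integral_affine(2)[OF _ this, of "- c" "c *\<^sub>R \<xi>"] that show ?thesis
      by (simp add: scaleR_diff_right scaleR_add_right divide_inverse algebra_simps)
  qed
  \<comment> \<open>Integrating \<open>conv0\<close> against g(\<eta>) and exchanging the integrals
    moves the smoothing from W to g; the factor c^d from the substitution cancels.\<close>
  have "(LINT \<xi>|lborel. W \<xi> * complex_of_real (LINT z|lborel. g (\<xi> - z /\<^sub>R c) * \<gamma> z)) = 0"
    if c: "0 < c" for c
  proof -
    let ?F = "\<lambda>\<xi> \<eta>. complex_of_real (g \<eta> * \<gamma> (c *\<^sub>R (\<xi> - \<eta>))) * W \<xi>"
    have "integrable (lborel \<Otimes>\<^sub>M lborel) (\<lambda>(\<xi>, \<eta>). ?F \<xi> \<eta>)"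
    proof (rule pair_integrableI)
      have I: "integrable lborel (\<lambda>\<eta>. \<gamma> (c *\<^sub>R (\<xi> - \<eta>)))"
        "(LINT \<eta>|lborel. \<gamma> (c *\<^sub>R (\<xi> - \<eta>))) = (LINT z|lborel. \<gamma> z) / c ^ DIM('a)" for \<xi>
        using integral_affine[OF _ int\<gamma>, of "- c" "c *\<^sub>R \<xi>"] c
        by (simp_all add: scaleR_diff_right divide_inverse mult.commute)
      have "(\<integral>\<^sup>+\<xi>. \<integral>\<^sup>+\<eta>. norm (case (\<xi>, \<eta>) of (\<xi>, \<eta>) \<Rightarrow> ?F \<xi> \<eta>) \<partial>lborel \<partial>lborel)
        \<le> (\<integral>\<^sup>+\<xi>. \<integral>\<^sup>+\<eta>. ennreal (\<gamma> (c *\<^sub>R (\<xi> - \<eta>))) * ennreal (norm (W \<xi>)) \<partial>lborel \<partial>lborel)"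
        using g by (intro nn_integral_mono) (auto simp: ennreal_mult'[symmetric] norm_mult abs_mult \<gamma>_nonneg
            intro!: ennreal_leI mult_right_mono mult_left_le_one_le)
      also have "\<dots> = (\<integral>\<^sup>+\<xi>. ennreal ((LINT z|lborel. \<gamma> z) / c ^ DIM('a)) * ennreal (norm (W \<xi>)) \<partial>lborel)"
        using I by (simp add: nn_integral_multc nn_integral_eq_integral \<gamma>_nonneg)
      also have "\<dots> = ennreal ((LINT z|lborel. \<gamma> z) / c ^ DIM('a)) * (\<integral>\<^sup>+\<xi>. ennreal (norm (W \<xi>)) \<partial>lborel)"
        by (simp add: nn_integral_cmult)
      also have "\<dots> < \<infinity>"
        using W by (simp add: integrable_iff_bounded ennreal_mult_less_top)
      finally show "(\<integral>\<^sup>+\<xi>. \<integral>\<^sup>+\<eta>. norm (case (\<xi>, \<eta>) of (\<xi>, \<eta>) \<Rightarrow> ?F \<xi> \<eta>) \<partial>lborel \<partial>lborel) < \<infinity>" .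
    qed measurable
    from lborel_pair.Fubini_integral[OF this]
    have "(LINT \<xi>|lborel. LINT \<eta>|lborel. ?F \<xi> \<eta>) = (LINT \<eta>|lborel. LINT \<xi>|lborel. ?F \<xi> \<eta>)" ..
    also have "(\<lambda>\<eta>. LINT \<xi>|lborel. ?F \<xi> \<eta>) = (\<lambda>\<eta>. complex_of_real (g \<eta>)
        * (LINT \<xi>|lborel. W \<xi> * complex_of_real (\<gamma> (c *\<^sub>R (\<xi> - \<eta>)))))"
      by (simp flip: integral_mult_right_zero add: mult_ac)
    also have "(\<lambda>\<xi>. LINT \<eta>|lborel. ?F \<xi> \<eta>) = (\<lambda>\<xi>. complex_of_real (inverse (c ^ DIM('a)))
        * (W \<xi> * complex_of_real (LINT z|lborel. g (\<xi> - z /\<^sub>R c) * \<gamma> z)))"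
      by (simp only: integral_mult_left_zero integral_complex_of_real scaled[OF c])
         (simp add: divide_inverse mult_ac)
    finally show ?thesis
      using c by (simp add: conv0)
  qed
  then have zero: "(LINT \<xi>|lborel. W \<xi> * complex_of_real (LINT z|lborel. g (\<xi> - z /\<^sub>R real (Suc n)) * \<gamma> z)) = 0" for n
    by simp
  have bound: "\<bar>g (\<xi> - z /\<^sub>R c) * \<gamma> z\<bar> \<le> \<gamma> z" for \<xi> z c
    using g by (auto simp: abs_mult \<gamma>_nonneg intro!: mult_left_le_one_le)
  \<comment> \<open>As c = n + 1 grows, g(\<xi> - z/c) tends to g(\<xi>) by continuity, so the
    average of g becomes g(\<xi>) times the mass of \<gamma>, which is nonzero.\<close>
  have lim_g: "(\<lambda>n. g (\<xi> - z /\<^sub>R real (Suc n))) \<longlonglongrightarrow> g \<xi>" for \<xi> z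
  proof -
    have "(\<lambda>n. \<xi> - inverse (real (Suc n)) *\<^sub>R z) \<longlonglongrightarrow> \<xi> - 0 *\<^sub>R z"
      by (intro tendsto_intros LIMSEQ_inverse_real_of_nat)
    then show ?thesis
      using \<open>continuous_on UNIV g\<close>
      by (intro continuous_on_tendsto_compose[of UNIV g]) auto
  qed
  have lim: "(\<lambda>n. LINT z|lborel. g (\<xi> - z /\<^sub>R real (Suc n)) * \<gamma> z) \<longlonglongrightarrow> (LINT z|lborel. g \<xi> * \<gamma> z)" for \<xi>
    by (rule integral_dominated_convergence[OF _ _ int\<gamma>])
      (auto intro!: AE_I2 tendsto_mult lim_g bound simp del: of_nat_Suc)
  have "(\<lambda>n. LINT \<xi>|lborel. W \<xi> * complex_of_real (LINT z|lborel. g (\<xi> - z /\<^sub>R real (Suc n)) * \<gamma> z))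
    \<longlonglongrightarrow> (LINT \<xi>|lborel. W \<xi> * complex_of_real (LINT z|lborel. g \<xi> * \<gamma> z))"
  proof (rule integral_dominated_convergence)
    show "integrable lborel (\<lambda>\<xi>. norm (W \<xi>) * (LINT z|lborel. \<gamma> z))"
      using W by simp
    show "AE \<xi> in lborel. norm (W \<xi> * complex_of_real (LINT z|lborel. g (\<xi> - z /\<^sub>R real (Suc n)) * \<gamma> z))
        \<le> norm (W \<xi>) * (LINT z|lborel. \<gamma> z)" for n
    proof (intro AE_I2)
      fix \<xi>
      have "\<bar>LINT z|lborel. g (\<xi> - z /\<^sub>R real (Suc n)) * \<gamma> z\<bar> \<le> (LINT z|lborel. \<gamma> z)"
        using bound int\<gamma> by (intro integral_abs_bound_integral Bochner_Integration.integrable_bound[OF int\<gamma>])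
          (auto intro!: AE_I2 order.trans[OF bound])
      then show "norm (W \<xi> * complex_of_real (LINT z|lborel. g (\<xi> - z /\<^sub>R real (Suc n)) * \<gamma> z))
        \<le> norm (W \<xi>) * (LINT z|lborel. \<gamma> z)"
        by (simp add: norm_mult mult_left_mono)
    qed
    show "AE \<xi> in lborel. (\<lambda>n. W \<xi> * complex_of_real (LINT z|lborel. g (\<xi> - z /\<^sub>R real (Suc n)) * \<gamma> z))
      \<longlonglongrightarrow> W \<xi> * complex_of_real (LINT z|lborel. g \<xi> * \<gamma> z)"
      by (intro AE_I2 tendsto_mult tendsto_const tendsto_of_real lim)
  qed measurable
  then have "(LINT \<xi>|lborel. W \<xi> * complex_of_real (LINT z|lborel. g \<xi> * \<gamma> z)) = 0"
    unfolding zero by (simp add: LIMSEQ_const_iff)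
  moreover have "(\<lambda>\<xi>. W \<xi> * complex_of_real (LINT z|lborel. g \<xi> * \<gamma> z))
    = (\<lambda>\<xi>. complex_of_real (LINT z|lborel. \<gamma> z) * (g \<xi> *\<^sub>R W \<xi>))"
    by (auto simp: fun_eq_iff scaleR_conv_of_real)
  ultimately have "complex_of_real (LINT z|lborel. \<gamma> z) * (LINT \<xi>|lborel. g \<xi> *\<^sub>R W \<xi>) = 0"
    by (simp only: integral_mult_right_zero)
  then show "(LINT \<xi>|lborel. g \<xi> *\<^sub>R W \<xi>) = 0"
    using pos by (auto simp: \<gamma>_def[abs_def])
qed

section \<open>Fourier transforms of compactly supported smooth functions\<close>

text \<open>The strict inequality makes the region open, so the derivatives vanish on the same
  region and one radius R serves for every order.\<close>

lemma dd_vanishes_outside: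
  assumes "\<And>x. R < norm x \<Longrightarrow> f x = 0" "R < norm x"
  shows "dd f v x = 0"
proof -
  have "(f has_derivative (\<lambda>_. 0)) (at x)"
  proof (rule has_derivative_transform_within_open)
    show "((\<lambda>_. 0) has_derivative (\<lambda>_. 0)) (at x)"
      by simp
    show "open {x. R < norm x}"
      by (intro open_Collect_less continuous_intros)
  qed (use assms in auto)
  from frechet_derivative_at[OF this] show ?thesis
    by (auto simp: dd_def fun_eq_iff)
qed

lemma elem_bounded:
  fixes f :: "'a::euclidean_space \<Rightarrow> real"
  assumes f: "elem f" and R: "\<And>x. R < norm x \<Longrightarrow> f x = 0"
  shows "\<exists>B\<ge>0. \<forall>x. \<bar>f x\<bar> \<le> B"
proof -
  have "compact (f ` cball 0 R)"
    by (intro compact_continuous_image elem_continuous f compact_cball)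
  then obtain B where B: "\<And>y. y \<in> f ` cball 0 R \<Longrightarrow> \<bar>y\<bar> \<le> B"
    using compact_imp_bounded[OF \<open>compact (f ` cball 0 R)\<close>] unfolding bounded_iff real_norm_def by blast
  have "\<bar>f x\<bar> \<le> max B 0" for x
  proof (cases "norm x \<le> R")
    case True
    then show ?thesis using B[of "f x"] by auto
  qed (simp add: R)
  then show ?thesis
    by (intro exI[of _ "max B 0"]) auto
qed

lemma integrable_indicator_cball: "integrable lborel (\<lambda>x. c * indicat_real (cball a r) x)"
  by (intro integrable_mult_right integrable_real_indicator emeasure_lborel_cball_finite) auto

lemma elem_integrable:
  fixes f :: "'a::euclidean_space \<Rightarrow> real"
  assumes f: "elem f" and R: "\<And>x. R < norm x \<Longrightarrow> f x = 0"
  shows "integrable lborel f"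
proof -
  obtain B where B: "0 \<le> B" "\<And>x. \<bar>f x\<bar> \<le> B"
    using elem_bounded[OF assms] by blast
  show ?thesis
  proof (rule Bochner_Integration.integrable_bound[OF integrable_indicator_cball[of B 0 R]])
    show "AE x in lborel. norm (f x) \<le> norm (B * indicat_real (cball 0 R) x)"
      using B R by (intro AE_I2) (auto simp: indicator_def not_le)
  qed (use elem_measurable[OF f] in simp)
qed

lemma elem_mvt:
  fixes f :: "'a::euclidean_space \<Rightarrow> real"
  assumes f: "elem f"
  obtains t where "0 < t" "t < 1" "f (x + y) - f x = dd f y (x + t *\<^sub>R y)"
proof -
  have "((\<lambda>t. f (x + t *\<^sub>R y)) has_derivative (\<lambda>h. dd f (h *\<^sub>R y) (x + t *\<^sub>R y))) (at t)" for t
    by (rule has_derivative_compose[OF _ elem_has_derivative_dd[OF f]]) (auto intro!: derivative_eq_intros)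
  moreover have "(\<lambda>h. dd f (h *\<^sub>R y) z) = (*) (dd f y z)" for z
    using linear_cmul[OF has_derivative_linear[OF elem_has_derivative_dd[OF f, of z]], of _ y]
    by (simp add: fun_eq_iff)
  ultimately have D: "((\<lambda>t. f (x + t *\<^sub>R y)) has_real_derivative dd f y (x + t *\<^sub>R y)) (at t)" for t
    by (simp add: has_field_derivative_def)
  obtain t where "0 < t" "t < 1" "f (x + 1 *\<^sub>R y) - f (x + 0 *\<^sub>R y) = (1 - 0) * dd f y (x + t *\<^sub>R y)"
    using MVT2[of 0 1, OF _ D] by auto
  with that show ?thesis by simp
qed

text \<open>Linearity in the direction reduces bounds for all directions to bounds for the finitely
  many functions \<open>dd f b\<close>.\<close>

lemma dd_basis_sum:
  fixes f :: "'a::euclidean_space \<Rightarrow> real"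
  assumes "elem f"
  shows "dd f v x = (\<Sum>b\<in>Basis. (v \<bullet> b) * dd f b x)"
proof -
  have lin: "linear (\<lambda>v. dd f v x)"
    using has_derivative_linear[OF elem_has_derivative_dd[OF assms]] .
  have "dd f v x = dd f (\<Sum>b\<in>Basis. (v \<bullet> b) *\<^sub>R b) x"
    by (simp add: euclidean_representation)
  also have "\<dots> = (\<Sum>b\<in>Basis. (v \<bullet> b) * dd f b x)"
    using lin by (simp add: linear_sum[OF lin] linear_cmul[OF lin])
  finally show ?thesis .
qed

lemma elem_lipschitz:
  fixes f :: "'a::euclidean_space \<Rightarrow> real"
  assumes f: "elem f" and R: "\<And>x. R < norm x \<Longrightarrow> f x = 0"
  shows "\<exists>L\<ge>0. \<forall>x y. \<bar>f (x + y) - f x\<bar> \<le> L * norm y"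
proof -
  have "\<exists>B\<ge>0. \<forall>x. \<bar>dd f b x\<bar> \<le> B" for b
    by (rule elem_bounded[OF elem_dd[OF f], of R]) (rule dd_vanishes_outside[OF R])
  then obtain B where B: "\<And>b. 0 \<le> B b" "\<And>b x. \<bar>dd f b x\<bar> \<le> B b"
    by metis
  have "\<bar>f (x + y) - f x\<bar> \<le> (\<Sum>b\<in>Basis. B b) * norm y" for x y
  proof -
    obtain t where "f (x + y) - f x = dd f y (x + t *\<^sub>R y)"
      using elem_mvt[OF f] by blast
    then have "\<bar>f (x + y) - f x\<bar> \<le> (\<Sum>b\<in>Basis. \<bar>(y \<bullet> b) * dd f b (x + t *\<^sub>R y)\<bar>)"
      by (simp add: dd_basis_sum[OF f, of y])
    also have "\<dots> \<le> (\<Sum>b\<in>Basis. norm y * B b)"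
      by (intro sum_mono) (auto simp: abs_mult Basis_le_norm B intro!: mult_mono)
    finally show ?thesis
      by (simp add: sum_distrib_left mult.commute)
  qed
  with B(1) show ?thesis
    by (intro exI[of _ "\<Sum>b\<in>Basis. B b"]) (auto intro: sum_nonneg)
qed

text \<open>Two applications of the mean value theorem leave a difference of first derivatives at
  two points on the line through x in direction y. The first derivatives are Lipschitz, which
  supplies the second factor |y|. This quadratic bound is what compensates the singularity of the
  kernel.\<close>

lemma elem_second_difference:
  fixes f :: "'a::euclidean_space \<Rightarrow> real"
  assumes f: "elem f" and R: "\<And>x. R < norm x \<Longrightarrow> f x = 0"
  shows "\<exists>C\<ge>0. \<forall>x y. \<bar>2 * f x - f (x - y) - f (x + y)\<bar> \<le> C * (norm y)\<^sup>2"
proof -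
  have "\<exists>L\<ge>0. \<forall>x y. \<bar>dd f b (x + y) - dd f b x\<bar> \<le> L * norm y" for b
    by (rule elem_lipschitz[OF elem_dd[OF f], of R]) (rule dd_vanishes_outside[OF R])
  then obtain L where L: "\<And>b. 0 \<le> L b" "\<And>b x y. \<bar>dd f b (x + y) - dd f b x\<bar> \<le> L b * norm y"
    by metis
  have "\<bar>2 * f x - f (x - y) - f (x + y)\<bar> \<le> (2 * (\<Sum>b\<in>Basis. L b)) * (norm y)\<^sup>2" for x y
  proof -
    obtain t where t: "0 < t" "t < 1" "f (x + y) - f x = dd f y (x + t *\<^sub>R y)"
      using elem_mvt[OF f] by blast
    obtain u where u: "0 < u" "u < 1" "f (x - y + y) - f (x - y) = dd f y (x - y + u *\<^sub>R y)"
      using elem_mvt[OF f] by blast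
    have "2 * f x - f (x - y) - f (x + y) = dd f y (x - y + u *\<^sub>R y) - dd f y (x + t *\<^sub>R y)"
      using t u by simp
    also have "\<dots> = (\<Sum>b\<in>Basis. (y \<bullet> b) * (dd f b (x - y + u *\<^sub>R y) - dd f b (x + t *\<^sub>R y)))"
      by (simp add: dd_basis_sum[OF f, of y] sum_subtractf right_diff_distrib)
    finally have "\<bar>2 * f x - f (x - y) - f (x + y)\<bar>
        \<le> (\<Sum>b\<in>Basis. \<bar>(y \<bullet> b) * (dd f b (x - y + u *\<^sub>R y) - dd f b (x + t *\<^sub>R y))\<bar>)"
      by (simp only: sum_abs)
    also have "\<dots> \<le> (\<Sum>b\<in>Basis. norm y * (L b * (2 * norm y)))"
    proof (intro sum_mono)
      fix b :: 'a assume b: "b \<in> Basis"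
      \<comment> \<open>The two points differ by (u - t - 1) y with t and u in (0, 1), so their
        distance is at most 2 |y|.\<close>
      have "x - y + u *\<^sub>R y = (x + t *\<^sub>R y) + (u - t - 1) *\<^sub>R y"
        by (simp add: scaleR_diff_left)
      then have "\<bar>dd f b (x - y + u *\<^sub>R y) - dd f b (x + t *\<^sub>R y)\<bar> \<le> L b * norm ((u - t - 1) *\<^sub>R y)"
        by (simp only: L(2))
      also have "\<dots> \<le> L b * (2 * norm y)"
        using t u L(1) by (intro mult_left_mono) (auto intro!: mult_right_mono)
      finally show "\<bar>(y \<bullet> b) * (dd f b (x - y + u *\<^sub>R y) - dd f b (x + t *\<^sub>R y))\<bar> \<le> norm y * (L b * (2 * norm y))"
        using b by (auto simp: abs_mult Basis_le_norm intro!: mult_mono)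
    qed
    finally show ?thesis
      by (simp add: sum_distrib_right sum_distrib_left power2_eq_square mult_ac)
  qed
  with L(1) show ?thesis
    by (intro exI[of _ "2 * (\<Sum>b\<in>Basis. L b)"]) (auto intro: sum_nonneg)
qed

lemma integrable_of_real_cis:
  fixes f :: "'a::euclidean_space \<Rightarrow> real"
  assumes "integrable lborel f"
  shows "integrable lborel (\<lambda>x. complex_of_real (f x) * cis (x \<bullet> \<xi>))"
  using integrable_cis[of "\<lambda>x. complex_of_real (f x)" \<xi>] assms by (simp add: inner_commute)

lemma fint_translate:
  fixes f :: "'a::euclidean_space \<Rightarrow> real"
  assumes "integrable lborel f"
  shows "fint (\<lambda>x. f (x + c)) \<xi> = cis (- (c \<bullet> \<xi>)) * fint f \<xi>"
proof -
  have "fint (\<lambda>x. f (x + c)) \<xi>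
      = (LINT x|lborel. cis (- (c \<bullet> \<xi>)) * (complex_of_real (f (x + c)) * cis ((x + c) \<bullet> \<xi>)))"
  proof -
    have "complex_of_real (f (x + c)) * cis (x \<bullet> \<xi>)
        = cis (- (c \<bullet> \<xi>)) * (complex_of_real (f (x + c)) * cis ((x + c) \<bullet> \<xi>))" for x
      by (simp add: mult.left_commute[of "cis _"] cis_mult inner_add_left)
    then show ?thesis
      unfolding fint_def by presburger
  qed
  also have "\<dots> = cis (- (c \<bullet> \<xi>)) * fint f \<xi>"
    unfolding fint_def integral_mult_right_zero
    by (subst integral_translate(2)[OF integrable_of_real_cis[OF assms]]) simp
  finally show ?thesis .
qed

text \<open>This is the derivative of exp(i a z) at 0, read along z = 1/(n + 1).\<close>

lemma cis_difference_quotient: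
  "(\<lambda>n. of_nat (Suc n) * (cis (a * inverse (real (Suc n))) - 1)) \<longlonglongrightarrow> \<i> * of_real a"
proof -
  have "((\<lambda>z. exp (\<i> * of_real a * z)) has_field_derivative \<i> * of_real a) (at 0)"
    by (auto intro!: derivative_eq_intros)
  then have D: "(\<lambda>h. (exp (\<i> * of_real a * h) - 1) / h) \<midarrow>0\<rightarrow> \<i> * of_real a"
    by (simp add: DERIV_def)
  have "(\<lambda>n. complex_of_real (inverse (real (Suc n)))) \<longlonglongrightarrow> of_real 0"
    by (intro tendsto_of_real LIMSEQ_inverse_real_of_nat)
  then have "filterlim (\<lambda>n. complex_of_real (inverse (real (Suc n)))) (at 0) sequentially"
    by (auto simp: filterlim_at simp del: of_nat_Suc)
  from filterlim_compose[OF D this] show ?thesis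
    by (simp add: cis_conv_exp divide_inverse mult_ac del: of_nat_Suc)
qed

text \<open>The derivative is a limit of difference quotients, whose transforms are explicit by
  translation and which converge under a common integrable bound. The minus sign comes from the
  positive phase in \<open>fint\<close>.\<close>

lemma fint_dd:
  fixes f :: "'a::euclidean_space \<Rightarrow> real"
  assumes f: "elem f" and R: "\<And>x. R < norm x \<Longrightarrow> f x = 0"
  shows "fint (dd f v) \<xi> = - \<i> * (v \<bullet> \<xi>) * fint f \<xi>"
proof -
  note int = elem_integrable[OF assms]
  obtain L where L: "0 \<le> L" "\<And>x y. \<bar>f (x + y) - f x\<bar> \<le> L * norm y"
    using elem_lipschitz[OF assms] by blast
  have [measurable]: "f \<in> borel_measurable borel" "dd f v \<in> borel_measurable borel"
    using f by (auto intro: elem_measurable elem_dd)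
  define q where "q n x = real (Suc n) * (f (x + inverse (real (Suc n)) *\<^sub>R v) - f x)" for n x
  have "(\<lambda>n. fint (q n) \<xi>) \<longlonglongrightarrow> fint (dd f v) \<xi>"
    unfolding fint_def
  proof (rule integral_dominated_convergence)
    \<comment> \<open>The shift v/(n + 1) is no longer than v, so every quotient lives in the ball
      of radius R + |v|, and there the Lipschitz bound makes it at most L |v|.\<close>
    show "integrable lborel (\<lambda>x. L * norm v * indicat_real (cball 0 (R + norm v)) x)"
      by (rule integrable_indicator_cball)
    show "AE x in lborel. norm (complex_of_real (q n x) * cis (x \<bullet> \<xi>))
      \<le> L * norm v * indicat_real (cball 0 (R + norm v)) x" for n
    proof (intro AE_I2)
      fix x :: 'a
      have small: "norm (inverse (real (Suc n)) *\<^sub>R v) \<le> norm v"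
        by (simp add: field_simps)
      show "norm (complex_of_real (q n x) * cis (x \<bullet> \<xi>)) \<le> L * norm v * indicat_real (cball 0 (R + norm v)) x"
      proof (cases "norm x \<le> R + norm v")
        case True
        have "\<bar>q n x\<bar> \<le> real (Suc n) * (L * norm (inverse (real (Suc n)) *\<^sub>R v))"
          unfolding q_def abs_mult by (intro mult_mono L) auto
        also have "\<dots> = L * norm v"
          by (simp add: field_simps del: of_nat_Suc)
        finally show ?thesis
          using True by (simp add: norm_mult)
      next
        case False
        moreover from this have "R < norm x" "R < norm (x + inverse (real (Suc n)) *\<^sub>R v)"
          using small norm_triangle_ineq4[of "x + inverse (real (Suc n)) *\<^sub>R v" "inverse (real (Suc n)) *\<^sub>R v"]
          norm_ge_zero[of v] by (auto simp del: norm_scaleR norm_ge_zero)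
        ultimately show ?thesis by (simp add: q_def R)
      qed
    qed
    show "AE x in lborel. (\<lambda>n. complex_of_real (q n x) * cis (x \<bullet> \<xi>)) \<longlonglongrightarrow> complex_of_real (dd f v x) * cis (x \<bullet> \<xi>)"
    proof (intro AE_I2 tendsto_mult tendsto_of_real tendsto_const)
      fix x :: 'a
      have "((\<lambda>t. f (x + t *\<^sub>R v)) has_derivative (\<lambda>h. dd f (h *\<^sub>R v) x)) (at 0)"
        using has_derivative_compose[of "\<lambda>t. x + t *\<^sub>R v" "\<lambda>h. h *\<^sub>R v" 0 UNIV f "\<lambda>v. dd f v x",
            OF has_derivative_eq_rhs[OF has_derivative_add[OF has_derivative_const
                has_derivative_scaleR_left[OF has_derivative_ident]]]]
          elem_has_derivative_dd[OF f, of x]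
        by simp
      moreover have "(\<lambda>h. dd f (h *\<^sub>R v) x) = (*) (dd f v x)"
        using linear_cmul[OF has_derivative_linear[OF elem_has_derivative_dd[OF f, of x]], of _ v]
        by (simp add: fun_eq_iff)
      ultimately have "((\<lambda>t. f (x + t *\<^sub>R v)) has_real_derivative dd f v x) (at 0)"
        by (simp add: has_field_derivative_def)
      then have D: "(\<lambda>h. (f (x + h *\<^sub>R v) - f x) / h) \<midarrow>0\<rightarrow> dd f v x"
        by (simp add: DERIV_def)
      have "filterlim (\<lambda>n. inverse (real (Suc n))) (at 0) sequentially"
        using LIMSEQ_inverse_real_of_nat by (auto simp: filterlim_at simp del: of_nat_Suc)
      from filterlim_compose[OF D this] show "(\<lambda>n. q n x) \<longlonglongrightarrow> dd f v x"
        by (simp add: q_def divide_inverse mult.commute del: of_nat_Suc)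
    qed
  qed (auto simp: q_def)
  moreover have "fint (q n) \<xi> = of_nat (Suc n) * (cis (- (v \<bullet> \<xi>) * inverse (real (Suc n))) - 1) * fint f \<xi>" for n
  proof -
    let ?h = "inverse (real (Suc n))"
    have "fint (q n) \<xi> = of_nat (Suc n) * (fint (\<lambda>x. f (x + ?h *\<^sub>R v)) \<xi> - fint f \<xi>)"
      unfolding fint_def q_def
      by (subst Bochner_Integration.integral_diff[symmetric])
        (auto intro!: integrable_of_real_cis integral_translate int
          simp: left_diff_distrib mult.assoc simp del: of_nat_Suc simp flip: integral_mult_right_zero)
    also have "fint (\<lambda>x. f (x + ?h *\<^sub>R v)) \<xi> = cis (- (v \<bullet> \<xi>) * ?h) * fint f \<xi>"
    proof -
      have "(?h *\<^sub>R v) \<bullet> \<xi> = (v \<bullet> \<xi>) * ?h"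
        by (simp only: inner_scaleR_left mult.commute)
      then show ?thesis
        by (simp only: fint_translate[OF int] mult_minus_left)
    qed
    finally show ?thesis
      by (simp add: left_diff_distrib right_diff_distrib mult.assoc del: of_nat_Suc)
  qed
  then have "(\<lambda>n. fint (q n) \<xi>) \<longlonglongrightarrow> \<i> * of_real (- (v \<bullet> \<xi>)) * fint f \<xi>"
    by (simp only:) (intro tendsto_mult cis_difference_quotient tendsto_const)
  ultimately show ?thesis
    using LIMSEQ_unique by fastforce
qed

text \<open>A second derivative in the direction b multiplies the transform by -(\<xi>.b)^2, and the
  squares add up to |\<xi>|^2. One more factor 1 + |\<xi>|^2 therefore costs the induction
  hypothesis for f and for its pure second derivatives, which is why f is generalized.\<close>

lemma fint_decay:
  fixes f :: "'a::euclidean_space \<Rightarrow> real"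
  assumes "elem f" and "\<And>x. R < norm x \<Longrightarrow> f x = 0"
  shows "\<exists>C\<ge>0. \<forall>\<xi>. (1 + (norm \<xi>)\<^sup>2) ^ N * norm (fint f \<xi>) \<le> C"
  using assms
proof (induction N arbitrary: f)
  case 0
  show ?case
    using norm_fint_le[of f] by (intro exI[of _ "LINT x|lborel. \<bar>f x\<bar>"]) auto
next
  case (Suc N)
  have "\<exists>C\<ge>0. \<forall>\<xi>. (1 + (norm \<xi>)\<^sup>2) ^ N * norm (fint (dd (dd f b) b) \<xi>) \<le> C" for b
    using Suc.prems by (intro Suc.IH elem_dd) (auto intro!: dd_vanishes_outside[where R=R])
  then obtain C where C: "\<And>b. 0 \<le> C b"
    "\<And>b \<xi>. (1 + (norm \<xi>)\<^sup>2) ^ N * norm (fint (dd (dd f b) b) \<xi>) \<le> C b"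
    by metis
  obtain C0 where C0: "0 \<le> C0" "\<And>\<xi>. (1 + (norm \<xi>)\<^sup>2) ^ N * norm (fint f \<xi>) \<le> C0"
    using Suc.IH[OF Suc.prems] by blast
  have norm2: "norm (fint (dd (dd f b) b) \<xi>) = (\<xi> \<bullet> b)\<^sup>2 * norm (fint f \<xi>)" for b \<xi>
  proof -
    have "fint (dd (dd f b) b) \<xi> = - \<i> * (b \<bullet> \<xi>) * (- \<i> * (b \<bullet> \<xi>) * fint f \<xi>)"
      using Suc.prems
      by (subst fint_dd[of _ R], auto intro!: elem_dd dd_vanishes_outside[where R=R])
         (subst fint_dd[of _ R], auto)
    then show ?thesis
      by (simp add: norm_mult power2_eq_square inner_commute abs_mult[symmetric])
  qed
  have "(1 + (norm \<xi>)\<^sup>2) ^ Suc N * norm (fint f \<xi>) \<le> C0 + (\<Sum>b\<in>Basis. C b)" for \<xi> :: 'a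
  proof -
    have "(norm \<xi>)\<^sup>2 = (\<Sum>b\<in>Basis. (\<xi> \<bullet> b)\<^sup>2)"
      by (subst power2_norm_eq_inner, subst euclidean_inner) (simp add: power2_eq_square)
    then have "(1 + (norm \<xi>)\<^sup>2) ^ Suc N * norm (fint f \<xi>) = (1 + (norm \<xi>)\<^sup>2) ^ N * norm (fint f \<xi>)
      + (\<Sum>b\<in>Basis. (1 + (norm \<xi>)\<^sup>2) ^ N * norm (fint (dd (dd f b) b) \<xi>))"
      unfolding norm2 by (simp add: sum_distrib_left sum_distrib_right algebra_simps)
    also have "\<dots> \<le> C0 + (\<Sum>b\<in>Basis. C b)"
      by (intro add_mono C0 sum_mono C)
    finally show ?thesis .
  qed
  moreover have "0 \<le> C0 + (\<Sum>b\<in>Basis. C b)"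
    using C0 C by (intro add_nonneg_nonneg sum_nonneg)
  ultimately show ?case by blast
qed

section \<open>Integrability of weights at infinity and of powers at the origin\<close>

lemma nn_integral_inverse_square_finite: "(\<integral>\<^sup>+x. ennreal (inverse (1 + x\<^sup>2)) \<partial>lborel) < \<infinity>"
proof -
  have half: "(\<integral>\<^sup>+x. ennreal (inverse (1 + x\<^sup>2)) * indicator {0..} x \<partial>lborel) = pi / 2 - arctan 0"
    by (intro nn_integral_FTC_atLeast) (auto intro!: derivative_eq_intros tendsto_arctan_at_top)
  then have half': "(\<integral>\<^sup>+x. ennreal (inverse (1 + x\<^sup>2)) * indicator {..0} x \<partial>lborel) = pi / 2 - arctan 0"
    by (subst nn_integral_real_affine[where c="-1" and t=0]) (auto simp: indicator_def)
  have "(\<integral>\<^sup>+x. ennreal (inverse (1 + x\<^sup>2)) \<partial>lborel) \<le> (\<integral>\<^sup>+x. ennreal (inverse (1 + x\<^sup>2)) * indicator {0..} x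
      + ennreal (inverse (1 + x\<^sup>2)) * indicator {..0} x \<partial>lborel)"
    by (intro nn_integral_mono) (auto simp: indicator_def)
  also have "\<dots> < \<infinity>"
    unfolding nn_integral_add half half' using half half' by (subst nn_integral_add) auto
  finally show ?thesis .
qed

text \<open>Each of the d factors 1 + |x|^2 is at least 1 + (x.b)^2 for one coordinate direction b,
  so a product of integrable functions of one variable dominates. This is the origin of the
  exponent.\<close>

lemma nn_integral_weight_finite:
  "(\<integral>\<^sup>+x. ennreal (inverse ((1 + (norm (x :: 'a::euclidean_space))\<^sup>2) ^ DIM('a))) \<partial>lborel) < \<infinity>"
proof -
  have "(\<integral>\<^sup>+x. ennreal (inverse ((1 + (norm (x :: 'a))\<^sup>2) ^ DIM('a))) \<partial>lborel)
    \<le> (\<integral>\<^sup>+x. (\<Prod>b\<in>Basis. ennreal (inverse (1 + ((x :: 'a) \<bullet> b)\<^sup>2))) \<partial>lborel)"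
  proof (intro nn_integral_mono)
    fix x :: 'a
    have "(\<Prod>b\<in>(Basis::'a set). inverse (1 + (norm x)\<^sup>2)) \<le> (\<Prod>b\<in>Basis. inverse (1 + (x \<bullet> b)\<^sup>2))"
    proof (intro prod_mono conjI)
      fix b :: 'a assume "b \<in> Basis"
      then have "(x \<bullet> b)\<^sup>2 \<le> (norm x)\<^sup>2"
        using Basis_le_norm abs_le_square_iff by fastforce
      then show "inverse (1 + (norm x)\<^sup>2) \<le> inverse (1 + (x \<bullet> b)\<^sup>2)"
        by (intro le_imp_inverse_le) (auto simp: add_pos_nonneg)
    qed simp
    then show "ennreal (inverse ((1 + (norm x)\<^sup>2) ^ DIM('a))) \<le> (\<Prod>b\<in>Basis. ennreal (inverse (1 + (x \<bullet> b)\<^sup>2)))"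
      by (simp add: prod_ennreal power_inverse ennreal_leI)
  qed
  also have "\<dots> = (\<Prod>b\<in>(Basis::'a set). (\<integral>\<^sup>+x. ennreal (inverse (1 + x\<^sup>2)) \<partial>lborel))"
    by (rule nn_integral_lborel_prod) auto
  also have "\<dots> < \<infinity>"
    using nn_integral_inverse_square_finite by (simp add: power_less_top_ennreal)
  finally show ?thesis .
qed

text \<open>The ball is cut into dyadic shells. On the shell between \<delta>/2^(k+1) and
  \<delta>/2^k the integrand times the volume is of order 2^(-p k), so the series is geometric and
  converges because p > 0.\<close>

lemma nn_integral_norm_powr_finite:
  fixes p \<delta> :: real
  assumes p: "0 < p" and \<delta>: "0 < \<delta>"
  shows "(\<integral>\<^sup>+y. ennreal (norm (y :: 'a::euclidean_space) powr (p - DIM('a))) * indicator {y. norm y \<le> \<delta>} y \<partial>lborel) < \<infinity>"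
proof -
  define d where "d = DIM('a)"
  define r where "r k = \<delta> / 2 ^ k" for k :: nat
  have r: "0 < r k" for k
    using \<delta> by (simp add: r_def)
  \<comment> \<open>On the shell |y|^p is largest at the outer radius and |y|^(-d) at the inner one.
    The shell lies in the open ball of radius 2 r(k) = 4 r(k+1), and this enlargement only costs the
    constant 4^d.\<close>
  define A where "A k = r k powr p * r (Suc k) powr (- real d)" for k
  have "(\<integral>\<^sup>+y. ennreal (norm (y :: 'a) powr (p - DIM('a))) * indicator {y. norm y \<le> \<delta>} y \<partial>lborel)
    \<le> (\<integral>\<^sup>+y. (\<Sum>k. ennreal (A k) * indicator (ball (0 :: 'a) (2 * r k)) y) \<partial>lborel)"
  proof (intro nn_integral_mono)
    fix y :: 'a
    show "ennreal (norm y powr (p - DIM('a))) * indicator {y. norm y \<le> \<delta>} y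
      \<le> (\<Sum>k. ennreal (A k) * indicator (ball 0 (2 * r k)) y)"
    \<comment> \<open>At y = 0 the left side is 0, because \<open>0 powr _\<close> is 0 for every
      exponent.\<close>
    proof (cases "y \<noteq> 0 \<and> norm y \<le> \<delta>")
      case True
      \<comment> \<open>The index of the shell containing y; minimality yields the outer
        bound.\<close>
      define k where "k = (LEAST k. r (Suc k) < norm y)"
      have "\<exists>k. r (Suc k) < norm y"
      proof -
        obtain n where "(1 / 2) ^ n < norm y / \<delta>"
          using real_arch_pow_inv[of "norm y / \<delta>" "1 / 2"] True \<delta> by auto
        then have "r n < norm y"
          using \<delta> by (simp add: r_def field_simps power_divide)
        moreover have "r (Suc n) \<le> r n"
          using \<delta> by (simp add: r_def field_simps)
        ultimately show ?thesis by (intro exI[of _ n]) simp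
      qed
      then have 1: "r (Suc k) < norm y"
        unfolding k_def by (rule LeastI_ex)
      have 2: "norm y \<le> r k"
      proof (cases k)
        case 0
        with True show ?thesis by (simp add: r_def)
      next
        case (Suc j)
        then have "\<not> r (Suc j) < norm y"
          using not_less_Least[of j "\<lambda>k. r (Suc k) < norm y"] by (simp add: k_def)
        with Suc show ?thesis by simp
      qed
      have "norm y powr (p - DIM('a)) = norm y powr p * norm y powr (- real d)"
        by (simp add: powr_add[symmetric] d_def)
      also have "\<dots> \<le> A k"
        unfolding A_def using 1 2 r p
        by (intro mult_mono powr_mono2 powr_mono2') (auto intro: less_imp_le)
      finally have "ennreal (norm y powr (p - DIM('a))) * indicator {y. norm y \<le> \<delta>} y
          \<le> ennreal (A k) * indicator (ball 0 (2 * r k)) y"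
        using True 2 r[of k] by (auto simp: indicator_def intro!: ennreal_leI)
      also have "\<dots> \<le> (\<Sum>k. ennreal (A k) * indicator (ball 0 (2 * r k)) y)"
        using sum_le_suminf[of "\<lambda>k. ennreal (A k) * indicator (ball 0 (2 * r k)) y" "{k}"]
        by (simp del: mult_indicator_subset sum_mult_indicator)
      finally show ?thesis .
    qed (auto simp: indicator_def)
  qed
  also have "\<dots> = (\<Sum>k. ennreal (A k) * emeasure lborel (ball (0::'a) (2 * r k)))"
  proof (subst nn_integral_suminf)
    have ball: "ball (0::'a) x \<in> sets lborel" for x
      by simp
    then show "(\<lambda>y. ennreal (A k) * indicator (ball (0::'a) (2 * r k)) y) \<in> borel_measurable lborel" for k
      by (intro borel_measurable_times_ennreal borel_measurable_const borel_measurable_indicator)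
    show "(\<Sum>k. \<integral>\<^sup>+y. ennreal (A k) * indicator (ball (0::'a) (2 * r k)) y \<partial>lborel)
        = (\<Sum>k. ennreal (A k) * emeasure lborel (ball (0::'a) (2 * r k)))"
      using ball by (intro suminf_cong nn_integral_cmult_indicator)
  qed
  also have "\<dots> = (\<Sum>k. ennreal (\<delta> powr p * 4 ^ d * unit_ball_vol d * (2 powr (- p)) ^ k))"
  proof (intro suminf_cong)
    fix k
    have eq: "A k * (2 * r k) ^ d = \<delta> powr p * 4 ^ d * (2 powr (- p)) ^ k"
    proof -
      have "r k powr p = \<delta> powr p * (2 powr (- p)) ^ k"
      proof -
        have "(2 ^ k) powr p = (2 powr p) ^ k"
          by (simp add: powr_powr mult.commute flip: powr_realpow)
        then show ?thesis
          using \<delta> by (simp add: r_def powr_divide powr_minus power_inverse) (simp add: divide_inverse)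
      qed
      moreover have "r (Suc k) powr (- real d) * (2 * r k) ^ d = 4 ^ d"
      proof -
        have "2 * r k = 4 * r (Suc k)"
          by (simp add: r_def)
        then show ?thesis
          using r[of "Suc k"] by (simp add: powr_minus powr_realpow power_mult_distrib)
      qed
      ultimately show ?thesis
        by (simp add: A_def mult_ac)
    qed
    have "ennreal (A k) * emeasure lborel (ball (0::'a) (2 * r k)) = ennreal (unit_ball_vol d * (A k * (2 * r k) ^ d))"
      using r[of k] by (subst emeasure_ball) (auto simp: d_def A_def ennreal_mult[symmetric] mult_ac)
    then show "ennreal (A k) * emeasure lborel (ball (0::'a) (2 * r k))
      = ennreal (\<delta> powr p * 4 ^ d * unit_ball_vol d * (2 powr (- p)) ^ k)"
      unfolding eq by (simp only: mult_ac)
  qed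
  also have "\<dots> < \<infinity>"
  proof -
    have "summable (\<lambda>k. (2 powr (- p)) ^ k)"
      using p by (intro summable_geometric) (auto simp: powr_less_one)
    then show ?thesis
      by (subst suminf_ennreal2) (auto intro!: summable_mult)
  qed
  finally show ?thesis .
qed

section \<open>The symbol of the peridynamic operator\<close>

text \<open>At y = 0 the value is 0, since the denominator is 0 and division by 0 gives 0. So the
  origin contributes nothing to the pointwise limits below.\<close>

definition kern :: "real \<Rightarrow> real \<Rightarrow> (real \<Rightarrow> real) \<Rightarrow> real^'n \<Rightarrow> real" where
  "kern \<alpha> \<delta> cutoff y = cutoff (norm y / \<delta>) / norm y powr (real CARD('n) + 2 * \<alpha>)"

text \<open>Symmetric second difference: the sum of f(x) - f(x - y) and its reflection under y ->
  -y, for which the singular integral converges absolutely.\<close>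

definition sdiff :: "('a::ab_group_add \<Rightarrow> real) \<Rightarrow> 'a \<Rightarrow> 'a \<Rightarrow> real" where
  "sdiff f x y = 2 * f x - f (x - y) - f (x + y)"

text \<open>The operator \<open>K\<^sub>\<delta>\<close> is the Fourier multiplier with symbol \<open>- symbol \<kappa> \<alpha> \<delta> cutoff\<close>.\<close>

definition symbol :: "real \<Rightarrow> real \<Rightarrow> real \<Rightarrow> (real \<Rightarrow> real) \<Rightarrow> real^'n \<Rightarrow> real" where
  "symbol \<kappa> \<alpha> \<delta> cutoff \<xi> =
     \<kappa> / \<delta> powr (2 * (1 - \<alpha>)) * (LINT y|lborel. kern \<alpha> \<delta> cutoff y * (1 - cos (y \<bullet> \<xi>)))"

context
  fixes \<kappa> \<alpha> \<delta> :: real and cutoff :: "real \<Rightarrow> real"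
  assumes \<kappa>: "0 < \<kappa>" and \<alpha>: "0 < \<alpha>" "\<alpha> < 1" and \<delta>: "0 < \<delta>"
    and cutoff_measurable: "cutoff \<in> borel_measurable borel"
    and cutoff: "\<And>r. 0 \<le> cutoff r \<and> cutoff r \<le> 1"
    and cutoff_supp: "\<And>r. 1 < \<bar>r\<bar> \<Longrightarrow> cutoff r = 0"
begin

lemma kern_measurable [measurable]: "kern \<alpha> \<delta> cutoff \<in> borel_measurable borel"
  using cutoff_measurable unfolding kern_def[abs_def] by measurable

lemma kern_nonneg: "0 \<le> kern \<alpha> \<delta> cutoff y"
  using cutoff by (simp add: kern_def)

lemma kern_minus: "kern \<alpha> \<delta> cutoff (- y) = kern \<alpha> \<delta> cutoff y"
  by (simp add: kern_def)

lemma kern_supp: "\<delta> < norm y \<Longrightarrow> kern \<alpha> \<delta> cutoff y = 0"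
  using \<delta> cutoff_supp[of "norm y / \<delta>"] by (simp add: kern_def)

text \<open>Multiplication by |y|^2 leaves at most the power |y|^(2 - 2\<alpha> - d) on the ball of
  radius \<delta>, which is integrable because \<alpha> < 1.\<close>

lemma integrable_kern_square:
  "integrable lborel (\<lambda>y. kern \<alpha> \<delta> cutoff (y :: real^'n) * (norm y)\<^sup>2)"
proof (rule integrableI_bounded)
  have le: "kern \<alpha> \<delta> cutoff (y :: real^'n) * (norm y)\<^sup>2
      \<le> norm y powr (2 - 2 * \<alpha> - DIM(real^'n)) * indicat_real {y. norm y \<le> \<delta>} y" for y
  proof (cases "y = 0 \<or> \<delta> < norm y")
    case False
    then have "kern \<alpha> \<delta> cutoff y * (norm y)\<^sup>2
        = cutoff (norm y / \<delta>) * (norm y powr 2 / norm y powr (real CARD('n) + 2 * \<alpha>))"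
      by (simp add: kern_def powr_numeral)
    also have "norm y powr 2 / norm y powr (real CARD('n) + 2 * \<alpha>) = norm y powr (2 - 2 * \<alpha> - DIM(real^'n))"
      unfolding powr_diff[symmetric] by (simp add: algebra_simps)
    also have "cutoff (norm y / \<delta>) * (norm y powr (2 - 2 * \<alpha> - DIM(real^'n)))
        \<le> norm y powr (2 - 2 * \<alpha> - DIM(real^'n))"
      using cutoff by (intro mult_left_le_one_le) auto
    finally show ?thesis using False by simp
  qed (auto simp: kern_supp indicator_def)
  have "(\<integral>\<^sup>+y. ennreal (norm (kern \<alpha> \<delta> cutoff (y :: real^'n) * (norm y)\<^sup>2)) \<partial>lborel)
      \<le> (\<integral>\<^sup>+y. ennreal (norm (y :: real^'n) powr (2 - 2 * \<alpha> - DIM(real^'n))) * indicator {y. norm y \<le> \<delta>} y \<partial>lborel)"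
  proof (intro nn_integral_mono)
    fix y :: "real^'n"
    show "ennreal (norm (kern \<alpha> \<delta> cutoff y * (norm y)\<^sup>2))
      \<le> ennreal (norm y powr (2 - 2 * \<alpha> - DIM(real^'n))) * indicator {y. norm y \<le> \<delta>} y"
      using le[of y] kern_nonneg[of y] by (auto simp: indicator_def ennreal_leI kern_supp)
  qed
  also have "\<dots> < \<infinity>"
    using nn_integral_norm_powr_finite[of "2 - 2 * \<alpha>" \<delta>, where 'a="real^'n"] \<alpha> \<delta> by simp
  finally show "(\<integral>\<^sup>+y. ennreal (norm (kern \<alpha> \<delta> cutoff (y :: real^'n) * (norm y)\<^sup>2)) \<partial>lborel) < \<infinity>" .
qed measurable

lemma integrable_kern_mult:
  assumes [measurable]: "h \<in> borel_measurable borel" and h: "\<And>y. \<bar>h y\<bar> \<le> C * (norm y)\<^sup>2"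
  shows "integrable lborel (\<lambda>y. kern \<alpha> \<delta> cutoff (y :: real^'n) * h y)"
proof (rule Bochner_Integration.integrable_bound)
  show "integrable lborel (\<lambda>y. C * (kern \<alpha> \<delta> cutoff (y :: real^'n) * (norm y)\<^sup>2))"
    by (intro integrable_mult_right integrable_kern_square)
  \<comment> \<open>A unit vector inserted into the hypothesis shows that C is nonnegative.\<close>
  have "0 \<le> C"
    using h[of "axis undefined 1"] abs_ge_zero[of "h (axis undefined 1)"] by simp
  then show "AE y in lborel. norm (kern \<alpha> \<delta> cutoff y * h y) \<le> norm (C * (kern \<alpha> \<delta> cutoff y * (norm y)\<^sup>2))"
    using mult_left_mono[OF h kern_nonneg]
    by (intro AE_I2) (simp add: abs_mult kern_nonneg mult.left_commute)
qed measurable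

lemma integrable_kern_cos: "integrable lborel (\<lambda>y. kern \<alpha> \<delta> cutoff (y :: real^'n) * (1 - cos (y \<bullet> \<xi>)))"
  and kern_cos_bound: "\<bar>1 - cos (y \<bullet> \<xi>)\<bar> \<le> (norm \<xi>)\<^sup>2 / 2 * (norm y)\<^sup>2" for y \<xi> :: "real^'n"
proof -
  show *: "\<bar>1 - cos (y \<bullet> \<xi>)\<bar> \<le> (norm \<xi>)\<^sup>2 / 2 * (norm y)\<^sup>2" for y \<xi> :: "real^'n"
  proof -
    have "\<bar>sin (y \<bullet> \<xi> / 2)\<bar> \<le> \<bar>y \<bullet> \<xi> / 2\<bar>"
      by (rule abs_sin_x_le_abs_x)
    also have "\<dots> \<le> norm y * norm \<xi> / 2"
      using Cauchy_Schwarz_ineq2[of y \<xi>] by simp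
    finally have "(sin (y \<bullet> \<xi> / 2))\<^sup>2 \<le> (norm y * norm \<xi> / 2)\<^sup>2"
      by (intro abs_le_square_iff[THEN iffD1]) simp
    moreover have "1 - cos (y \<bullet> \<xi>) = 2 * (sin (y \<bullet> \<xi> / 2))\<^sup>2"
      using cos_double_sin[of "y \<bullet> \<xi> / 2"] by simp
    ultimately show ?thesis
      by (simp add: power_mult_distrib power_divide mult.commute)
  qed
  show "integrable lborel (\<lambda>y. kern \<alpha> \<delta> cutoff (y :: real^'n) * (1 - cos (y \<bullet> \<xi>)))" for \<xi>
    by (rule integrable_kern_mult[OF _ *]) simp
qed

lemma symbol_measurable: "symbol \<kappa> \<alpha> \<delta> cutoff \<in> borel_measurable borel"
  unfolding symbol_def[abs_def] by measurable

lemma symbol_nonneg: "0 \<le> symbol \<kappa> \<alpha> \<delta> cutoff \<xi>"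
  using \<kappa> unfolding symbol_def
  by (intro mult_nonneg_nonneg Bochner_Integration.integral_nonneg kern_nonneg) auto

lemma symbol_minus: "symbol \<kappa> \<alpha> \<delta> cutoff (- \<xi>) = symbol \<kappa> \<alpha> \<delta> cutoff \<xi>"
  by (simp add: symbol_def)

text \<open>The quadratic bound on 1 - cos(y.\<xi>) is integrated against the kernel. Polynomial
  growth is enough, since the transforms of the test functions decay faster than any power.\<close>

lemma symbol_bound: "\<exists>C\<ge>0. \<forall>\<xi> :: real^'n. symbol \<kappa> \<alpha> \<delta> cutoff \<xi> \<le> C * (1 + (norm \<xi>)\<^sup>2)"
proof -
  define M where "M = (LINT y|lborel. kern \<alpha> \<delta> cutoff (y :: real^'n) * (norm y)\<^sup>2)"
  define c where "c = \<kappa> / \<delta> powr (2 * (1 - \<alpha>))"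
  have c: "0 \<le> c"
    using \<kappa> by (simp add: c_def)
  have M: "0 \<le> M"
    unfolding M_def by (intro Bochner_Integration.integral_nonneg mult_nonneg_nonneg kern_nonneg) auto
  have "symbol \<kappa> \<alpha> \<delta> cutoff \<xi> \<le> c * M * (1 + (norm \<xi>)\<^sup>2)" for \<xi> :: "real^'n"
  proof -
    have "(LINT y|lborel. kern \<alpha> \<delta> cutoff y * (1 - cos (y \<bullet> \<xi>)))
        \<le> (LINT y|lborel. (norm \<xi>)\<^sup>2 / 2 * (kern \<alpha> \<delta> cutoff (y :: real^'n) * (norm y)\<^sup>2))"
    proof (rule integral_mono[OF integrable_kern_cos])
      fix y :: "real^'n"
      show "kern \<alpha> \<delta> cutoff y * (1 - cos (y \<bullet> \<xi>)) \<le> (norm \<xi>)\<^sup>2 / 2 * (kern \<alpha> \<delta> cutoff y * (norm y)\<^sup>2)"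
        using mult_left_mono[OF order.trans[OF abs_ge_self kern_cos_bound[of y \<xi>]] kern_nonneg[of y]]
        by (simp add: mult.left_commute)
    qed (intro integrable_mult_right integrable_kern_square)
    also have "\<dots> = (norm \<xi>)\<^sup>2 / 2 * M"
      by (simp add: M_def)
    also have "\<dots> \<le> M * (1 + (norm \<xi>)\<^sup>2)"
      using M by (simp add: field_simps)
    finally show ?thesis
      using c unfolding symbol_def c_def[symmetric] by (simp add: mult_left_mono mult.assoc)
  qed
  with c M show ?thesis
    by (intro exI[of _ "c * M"]) auto
qed

section \<open>The operator on a smooth profile of compact support\<close>

context
  fixes f :: "real^'n \<Rightarrow> real" and R :: real
  assumes f: "elem f" and R: "\<And>x. R < norm x \<Longrightarrow> f x = 0"
begin

lemma f_measurable [measurable]: "f \<in> borel_measurable borel"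
  using f by (rule elem_measurable)

lemma integrable_kern_sdiff: "integrable lborel (\<lambda>y. kern \<alpha> \<delta> cutoff y * sdiff f x y)"
proof -
  obtain C where C: "\<And>x y. \<bar>sdiff f x y\<bar> \<le> C * (norm y)\<^sup>2"
    using elem_second_difference[OF f R] unfolding sdiff_def by blast
  show ?thesis
    by (rule integrable_kern_mult[OF _ C]) (simp add: sdiff_def[abs_def])
qed

text \<open>Away from the origin the integral exists by itself. Since the kernel is even, averaging
  with the reflection y -> -y replaces f(x) - f(x - y) by half of the symmetric second
  difference.\<close>

lemma truncated_integral:
  assumes \<epsilon>: "0 < \<epsilon>"
  shows "(LINT y:{y. \<epsilon> < norm y}|lborel. kern \<alpha> \<delta> cutoff y *\<^sub>R (f x *\<^sub>R e - f (x - y) *\<^sub>R e))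
    = (1 / 2 * (LINT y|lborel. indicat_real {y. \<epsilon> < norm y} y * (kern \<alpha> \<delta> cutoff y * sdiff f x y))) *\<^sub>R e"
proof -
  define a where "a y = indicat_real {y. \<epsilon> < norm y} y * (kern \<alpha> \<delta> cutoff y * (f x - f (x - y)))" for y
  obtain B where B: "0 \<le> B" "\<And>x. \<bar>f x\<bar> \<le> B"
    using elem_bounded[OF f R] by blast
  have "integrable lborel (\<lambda>y. kern \<alpha> \<delta> cutoff y * (indicat_real {y. \<epsilon> < norm y} y * (f x - f (x - y))))"
  proof (rule integrable_kern_mult)
    fix y :: "real^'n"
    \<comment> \<open>On |y| > \<epsilon> a bounded function is also of order |y|^2, with a constant
      depending on \<epsilon>; this fits the hypothesis of
      \<open>integrable_kern_mult\<close>.\<close>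
    show "\<bar>indicat_real {y. \<epsilon> < norm y} y * (f x - f (x - y))\<bar> \<le> 2 * B / \<epsilon>\<^sup>2 * (norm y)\<^sup>2"
    proof (cases "\<epsilon> < norm y")
      case True
      then have "\<epsilon>\<^sup>2 \<le> (norm y)\<^sup>2"
        using \<epsilon> by (intro power_mono) auto
      then have "2 * B * 1 \<le> 2 * B * ((norm y)\<^sup>2 / \<epsilon>\<^sup>2)"
        using \<epsilon> B by (intro mult_left_mono) auto
      moreover have "\<bar>f x - f (x - y)\<bar> \<le> 2 * B"
        using B(2)[of x] B(2)[of "x - y"] by linarith
      ultimately show ?thesis
        using True by simp
    qed (use B in simp)
  qed measurable
  then have a: "integrable lborel a"
    by (simp add: a_def[abs_def] mult.left_commute)
  have a': "integrable lborel (\<lambda>y. a (- y))" "(LINT y|lborel. a (- y)) = (LINT y|lborel. a y)"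
    using integral_affine[OF _ a, of "-1" 0] by simp_all
  have "(LINT y|lborel. a y) = 1 / 2 * ((LINT y|lborel. a y) + (LINT y|lborel. a (- y)))"
    by (simp add: a')
  also have "\<dots> = 1 / 2 * (LINT y|lborel. a y + a (- y))"
    using a a' by simp
  also have "(\<lambda>y. a y + a (- y)) = (\<lambda>y. indicat_real {y. \<epsilon> < norm y} y * (kern \<alpha> \<delta> cutoff y * sdiff f x y))"
    by (auto simp: a_def sdiff_def kern_minus fun_eq_iff algebra_simps indicator_def)
  finally have eq: "(LINT y|lborel. a y)
      = 1 / 2 * (LINT y|lborel. indicat_real {y. \<epsilon> < norm y} y * (kern \<alpha> \<delta> cutoff y * sdiff f x y))" .
  have "(LINT y:{y. \<epsilon> < norm y}|lborel. kern \<alpha> \<delta> cutoff y *\<^sub>R (f x *\<^sub>R e - f (x - y) *\<^sub>R e)) = (LINT y|lborel. a y *\<^sub>R e)"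
    unfolding set_lebesgue_integral_def a_def by (simp add: scaleR_diff_left[symmetric])
  also have "\<dots> = (LINT y|lborel. a y) *\<^sub>R e"
    using a by simp
  finally show ?thesis
    by (simp only: eq)
qed

text \<open>After symmetrisation the integrand is absolutely integrable, so the principal value is a
  limit by dominated convergence. At y = 0 the kernel is 0, hence the convergence is pointwise
  everywhere.\<close>

lemma truncated_integral_tendsto:
  "((\<lambda>\<epsilon>. LINT y:{y. \<epsilon> < norm y}|lborel. kern \<alpha> \<delta> cutoff y *\<^sub>R (f x *\<^sub>R e - f (x - y) *\<^sub>R e))
    \<longlongrightarrow> (1 / 2 * (LINT y|lborel. kern \<alpha> \<delta> cutoff y * sdiff f x y)) *\<^sub>R e) (at_right 0)"
proof (rule tendsto_at_right_sequentially[where b=1])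
  fix X :: "nat \<Rightarrow> real"
  assume X: "\<And>n. 0 < X n" "\<And>n. X n < 1" "decseq X" "X \<longlonglongrightarrow> 0"
  have [measurable]: "(\<lambda>y. kern \<alpha> \<delta> cutoff y * sdiff f x y) \<in> borel_measurable borel"
    by (simp add: sdiff_def)
  have "(\<lambda>n. LINT y|lborel. indicat_real {y. X n < norm y} y * (kern \<alpha> \<delta> cutoff y * sdiff f x y))
      \<longlonglongrightarrow> (LINT y|lborel. kern \<alpha> \<delta> cutoff y * sdiff f x y)"
  proof (rule integral_dominated_convergence[OF _ _ integrable_norm[OF integrable_kern_sdiff[of x]]])
    show "AE y in lborel. (\<lambda>n. indicat_real {y. X n < norm y} y * (kern \<alpha> \<delta> cutoff y * sdiff f x y))
        \<longlonglongrightarrow> kern \<alpha> \<delta> cutoff y * sdiff f x y"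
    proof (intro AE_I2)
      fix y :: "real^'n"
      show "(\<lambda>n. indicat_real {y. X n < norm y} y * (kern \<alpha> \<delta> cutoff y * sdiff f x y))
        \<longlonglongrightarrow> kern \<alpha> \<delta> cutoff y * sdiff f x y"
      proof (cases "y = 0")
        case False
        then have "eventually (\<lambda>n. X n < norm y) sequentially"
          using X(4) by (intro order_tendstoD) auto
        then show ?thesis
          by (rule tendsto_eventually[OF eventually_mono]) simp
      qed (simp add: kern_def)
    qed
  qed (auto simp: indicator_def)
  then show "(\<lambda>n. LINT y:{y. X n < norm y}|lborel. kern \<alpha> \<delta> cutoff y *\<^sub>R (f x *\<^sub>R e - f (x - y) *\<^sub>R e))
    \<longlonglongrightarrow> (1 / 2 * (LINT y|lborel. kern \<alpha> \<delta> cutoff y * sdiff f x y)) *\<^sub>R e"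
    unfolding truncated_integral[OF X(1)] by (intro tendsto_intros)
qed simp

lemma peri_op_eq:
  "peri_op \<kappa> \<alpha> \<delta> cutoff (\<lambda>y. f y *\<^sub>R e) x
    = - (\<kappa> / \<delta> powr (2 * (1 - \<alpha>)) * (1 / 2 * (LINT y|lborel. kern \<alpha> \<delta> cutoff y * sdiff f x y))) *\<^sub>R e"
  unfolding peri_op_def kern_def[symmetric]
  by (simp add: tendsto_Lim[OF _ truncated_integral_tendsto])

text \<open>For fixed y, translation turns the second difference into multiplication by 2 - 2
  cos(y.\<xi>); Fubini then integrates over y.\<close>

lemma fint_kern_sdiff:
  "integrable lborel (\<lambda>x. LINT y|lborel. kern \<alpha> \<delta> cutoff y * sdiff f x y)"
  "fint (\<lambda>x. LINT y|lborel. kern \<alpha> \<delta> cutoff y * sdiff f x y) \<xi>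
    = complex_of_real (LINT y|lborel. kern \<alpha> \<delta> cutoff y * (1 - cos (y \<bullet> \<xi>))) * (2 * fint f \<xi>)"
proof -
  obtain C where C: "0 \<le> C" "\<And>x y. \<bar>sdiff f x y\<bar> \<le> C * (norm y)\<^sup>2"
    using elem_second_difference[OF f R] unfolding sdiff_def by blast
  have [measurable]: "(\<lambda>p. sdiff f (fst p) (snd p)) \<in> borel_measurable (lborel \<Otimes>\<^sub>M lborel)"
    unfolding sdiff_def by measurable
  \<comment> \<open>If |y| \<le> \<delta> and |x| > R + \<delta>, then x, x - y and x + y all lie
    where f is 0. The bound is a product of a function of x and a function of y, so it is integrable
    on the product space.\<close>
  have bound: "\<bar>kern \<alpha> \<delta> cutoff y * sdiff f x y\<bar>
      \<le> (C * indicat_real (cball 0 (R + \<delta>)) x) * (kern \<alpha> \<delta> cutoff y * (norm y)\<^sup>2)" for x y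
  proof (cases "norm x \<le> R + \<delta> \<or> \<delta> < norm y")
    case True
    have "\<bar>kern \<alpha> \<delta> cutoff y * sdiff f x y\<bar> \<le> kern \<alpha> \<delta> cutoff y * (C * (norm y)\<^sup>2)"
      using C(2)[of x y] kern_nonneg[of y] by (simp add: abs_mult mult_left_mono)
    with True show ?thesis
      by (auto simp: kern_supp mult_ac)
  next
    case False
    then have "R < norm x" "R < norm (x - y)" "R < norm (x + y)"
      using \<delta> norm_triangle_ineq2[of x y] norm_triangle_ineq2[of x "- y"] by auto
    then show ?thesis
      using kern_nonneg[of y] C(1) by (simp add: sdiff_def R)
  qed
  have int: "integrable (lborel \<Otimes>\<^sub>M lborel) (\<lambda>(x, y). kern \<alpha> \<delta> cutoff y * sdiff f x y)"
    by (rule pair_integrable_mult_bound[OF _ integrable_indicator_cball[of C 0 "R + \<delta>"] integrable_kern_square])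
      (use bound in \<open>auto simp: split_beta\<close>)
  show "integrable lborel (\<lambda>x. LINT y|lborel. kern \<alpha> \<delta> cutoff y * sdiff f x y)"
    using lborel_pair.integrable_fst[OF int] .
  let ?F = "\<lambda>x y. complex_of_real (kern \<alpha> \<delta> cutoff y * sdiff f x y) * cis (x \<bullet> \<xi>)"
  have "integrable (lborel \<Otimes>\<^sub>M lborel) (\<lambda>(x, y). ?F x y)"
    by (rule pair_integrable_mult_bound[OF _ integrable_indicator_cball[of C 0 "R + \<delta>"] integrable_kern_square])
      (use bound in \<open>auto simp: split_beta norm_mult abs_mult\<close>)
  from lborel_pair.Fubini_integral[OF this]
  have "fint (\<lambda>x. LINT y|lborel. kern \<alpha> \<delta> cutoff y * sdiff f x y) \<xi> = (LINT y|lborel. LINT x|lborel. ?F x y)"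
    unfolding fint_def by (simp flip: integral_complex_of_real del: of_real_mult)
  also have "(\<lambda>y. LINT x|lborel. ?F x y)
      = (\<lambda>y. complex_of_real (kern \<alpha> \<delta> cutoff y * (1 - cos (y \<bullet> \<xi>))) * (2 * fint f \<xi>))"
  proof
    fix y
    have intf: "integrable lborel f"
      by (rule elem_integrable[OF f]) (rule R)
    have int1: "integrable lborel (\<lambda>x. complex_of_real (f x) * cis (x \<bullet> \<xi>))"
      by (intro integrable_of_real_cis intf)
    have int2: "integrable lborel (\<lambda>x. complex_of_real (f (x + z)) * cis (x \<bullet> \<xi>))" for z
      by (intro integrable_of_real_cis integral_translate intf)
    have "(LINT x|lborel. ?F x y) = complex_of_real (kern \<alpha> \<delta> cutoff y) *
        (LINT x|lborel. 2 * (complex_of_real (f x) * cis (x \<bullet> \<xi>))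
          - complex_of_real (f (x + - y)) * cis (x \<bullet> \<xi>) - complex_of_real (f (x + y)) * cis (x \<bullet> \<xi>))"
      unfolding integral_mult_right_zero[symmetric]
      by (intro Bochner_Integration.integral_cong) (simp_all add: sdiff_def algebra_simps)
    also have "(LINT x|lborel. 2 * (complex_of_real (f x) * cis (x \<bullet> \<xi>))
          - complex_of_real (f (x + - y)) * cis (x \<bullet> \<xi>) - complex_of_real (f (x + y)) * cis (x \<bullet> \<xi>))
        = 2 * fint f \<xi> - fint (\<lambda>x. f (x + - y)) \<xi> - fint (\<lambda>x. f (x + y)) \<xi>"
      unfolding fint_def using int1 int2[of "- y"] int2[of y] by simp
    also have "\<dots> = (2 - cis (y \<bullet> \<xi>) - cis (- (y \<bullet> \<xi>))) * fint f \<xi>"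
      by (simp add: fint_translate[OF intf, of "- y", simplified] fint_translate[OF intf, of "y"]
          algebra_simps)
    also have "2 - cis (y \<bullet> \<xi>) - cis (- (y \<bullet> \<xi>)) = complex_of_real (1 - cos (y \<bullet> \<xi>)) * 2"
      by (simp add: complex_eq_iff)
    finally show "(LINT x|lborel. ?F x y)
        = complex_of_real (kern \<alpha> \<delta> cutoff y * (1 - cos (y \<bullet> \<xi>))) * (2 * fint f \<xi>)"
      by simp
  qed
  finally show "fint (\<lambda>x. LINT y|lborel. kern \<alpha> \<delta> cutoff y * sdiff f x y) \<xi>
    = complex_of_real (LINT y|lborel. kern \<alpha> \<delta> cutoff y * (1 - cos (y \<bullet> \<xi>))) * (2 * fint f \<xi>)"
    by (simp only: integral_mult_left_zero integral_complex_of_real)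
qed

end

lemma sdiff_mult: "sdiff (\<lambda>x. b * f x) x y = b * sdiff f x y"
  by (simp add: sdiff_def algebra_simps)

text \<open>The scalars a and b stand for the second derivative and the value of the time profile at
  a fixed t. The factor 1/2 from the symmetrisation cancels the 2 in the transform of the second
  difference, and \<open>ft\<close> at \<xi> corresponds to \<open>fint\<close> at -\<xi>.\<close>

lemma ft_wave_operator:
  fixes f :: "real^'n \<Rightarrow> real"
  assumes f: "elem f" and R: "\<And>x. R < norm x \<Longrightarrow> f x = 0"
  shows "ft (\<lambda>x. (a * f x) *\<^sub>R e - peri_op \<kappa> \<alpha> \<delta> cutoff (\<lambda>y. (b * f y) *\<^sub>R e) x) \<xi> $ j
    = complex_of_real ((2 * pi) powr (- real CARD('n) / 2) * (a + symbol \<kappa> \<alpha> \<delta> cutoff \<xi> * b) * e $ j)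
      * fint f (- \<xi>)"
proof -
  define c where "c = \<kappa> / \<delta> powr (2 * (1 - \<alpha>))"
  define S where "S x = (LINT y|lborel. kern \<alpha> \<delta> cutoff y * sdiff f x y)" for x
  have bf: "elem (\<lambda>x. b * f x)"
    using f by (intro elem_mult elem_const)
  have op: "((a * f x) *\<^sub>R e - peri_op \<kappa> \<alpha> \<delta> cutoff (\<lambda>y. (b * f y) *\<^sub>R e) x) $ j
      = (a * e $ j) * f x + (c * b / 2 * e $ j) * S x" for x
  proof -
    have "(LINT y|lborel. kern \<alpha> \<delta> cutoff y * sdiff (\<lambda>x. b * f x) x y) = b * S x"
      unfolding S_def sdiff_mult mult.left_commute[of _ b] by (rule integral_mult_right_zero)
    moreover have "peri_op \<kappa> \<alpha> \<delta> cutoff (\<lambda>y. (b * f y) *\<^sub>R e) x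
        = - (c * (1 / 2 * (LINT y|lborel. kern \<alpha> \<delta> cutoff y * sdiff (\<lambda>x. b * f x) x y))) *\<^sub>R e"
      unfolding c_def by (rule peri_op_eq[OF bf, of R]) (simp add: R)
    ultimately show ?thesis
      by simp
  qed
  have intf: "integrable lborel f"
    by (rule elem_integrable[OF f]) (rule R)
  have S: "integrable lborel S" "fint S (- \<xi>)
    = complex_of_real (LINT y|lborel. kern \<alpha> \<delta> cutoff y * (1 - cos (y \<bullet> \<xi>))) * (2 * fint f (- \<xi>))"
    unfolding S_def using fint_kern_sdiff(1)[OF f, of R] fint_kern_sdiff(2)[OF f, of R "- \<xi>"] R by simp_all
  have "(LINT x|lborel. complex_of_real (((a * f x) *\<^sub>R e
        - peri_op \<kappa> \<alpha> \<delta> cutoff (\<lambda>y. (b * f y) *\<^sub>R e) x) $ j) * cis (- (x \<bullet> \<xi>)))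
      = (LINT x|lborel. complex_of_real (a * e $ j) * (complex_of_real (f x) * cis (x \<bullet> (- \<xi>)))
          + complex_of_real (c * b / 2 * e $ j) * (complex_of_real (S x) * cis (x \<bullet> (- \<xi>))))"
    unfolding op by (intro Bochner_Integration.integral_cong) (simp_all add: algebra_simps)
  also have "\<dots> = complex_of_real (a * e $ j) * fint f (- \<xi>) + complex_of_real (c * b / 2 * e $ j) * fint S (- \<xi>)"
    unfolding fint_def
    unfolding integral_mult_right_zero[symmetric]
    by (intro Bochner_Integration.integral_add integrable_mult_right integrable_of_real_cis intf S(1))
  also have "\<dots> = complex_of_real ((a + symbol \<kappa> \<alpha> \<delta> cutoff \<xi> * b) * e $ j) * fint f (- \<xi>)"
    unfolding S(2) symbol_def c_def[symmetric] by (simp add: algebra_simps)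
  finally show ?thesis
    unfolding ft_def by (simp add: mult.assoc)
qed

end

section \<open>Weak solutions of the harmonic oscillator equation\<close>

lemma ex_pderiv_eq: "\<exists>q :: real poly. pderiv q = p"
proof
  have "pderiv (\<Sum>i\<le>degree p. monom (coeff p i / real (Suc i)) (Suc i))
      = (\<Sum>i\<le>degree p. monom (coeff p i) i)"
    using higher_pderiv_sum[where n=1, of "\<lambda>i. monom (coeff p i / real (Suc i)) (Suc i)" "{..degree p}"]
    by (simp add: pderiv_monom del: of_nat_Suc)
  then show "pderiv (\<Sum>i\<le>degree p. monom (coeff p i / real (Suc i)) (Suc i)) = p"
    by (simp only: poly_as_sum_of_monoms)
qed

lemma weierstrass_poly:
  fixes f :: "real \<Rightarrow> real"
  assumes "continuous_on {a..b} f" "0 < e"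
  shows "\<exists>p. \<forall>x\<in>{a..b}. \<bar>f x - poly p x\<bar> \<le> e"
proof -
  obtain g where g: "polynomial_function g" "\<And>x. x \<in> {a..b} \<Longrightarrow> norm (f x - g x) < e"
    using Stone_Weierstrass_polynomial_function[OF compact_Icc assms] by blast
  then obtain c n where "g = (\<lambda>x. \<Sum>i\<le>n. c i * x ^ i)"
    by (auto simp: real_polynomial_function_eq[symmetric] real_polynomial_function_iff_sum)
  then have "g x = poly (\<Sum>i\<le>n. monom (c i) i) x" for x
    by (simp add: poly_sum poly_monom)
  with g(2) show ?thesis
    by (intro exI[of _ "\<Sum>i\<le>n. monom (c i) i"]) (auto intro: less_imp_le)
qed

lemma derivative_small_imp_small:
  fixes u :: "real \<Rightarrow> real"
  assumes u: "\<And>t. (u has_real_derivative u' t) (at t)" "u a = 0"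
    and le: "\<And>t. t \<in> {a..b} \<Longrightarrow> \<bar>u' t\<bar> \<le> e" and t: "t \<in> {a..b}"
  shows "\<bar>u t\<bar> \<le> e * (b - a)"
proof (cases "t = a")
  case True
  have "0 \<le> e"
    using le[OF t] by linarith
  with True t u(2) show ?thesis by simp
next
  case False
  with t have "a < t" by simp
  then obtain z where z: "a < z" "z < t" "u t - u a = (t - a) * u' z"
    using MVT2[of a t u u'] u(1) by auto
  then have "\<bar>u t\<bar> = (t - a) * \<bar>u' z\<bar>"
    using u(2) \<open>a < t\<close> by (simp add: abs_mult)
  also have "\<dots> \<le> (b - a) * e"
    using le[of z] z t by (intro mult_mono) auto
  finally show ?thesis
    by (simp add: mult.commute)
qed

text \<open>Only the second derivative is approximated by Weierstrass. The polynomial q is a double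
  primitive with the value and slope of \<theta> at a, so the errors of lower order arise by
  integration.\<close>

lemma C2_poly_approx:
  fixes \<theta> :: "real \<Rightarrow> real"
  assumes \<theta>: "\<And>t. (\<theta> has_real_derivative \<theta>' t) (at t)" "\<And>t. (\<theta>' has_real_derivative \<theta>'' t) (at t)"
    and cont: "continuous_on UNIV \<theta>''" and e: "0 < e"
  shows "\<exists>q. \<forall>t\<in>{a..b}. \<bar>\<theta> t - poly q t\<bar> \<le> e \<and> \<bar>\<theta>' t - poly (pderiv q) t\<bar> \<le> e
    \<and> \<bar>\<theta>'' t - poly (pderiv (pderiv q)) t\<bar> \<le> e"
proof -
  \<comment> \<open>Integrating once and twice multiplies the error by b - a and by its square;
    dividing e by M covers all three orders at once.\<close>
  define M where "M = 1 + \<bar>b - a\<bar> + \<bar>b - a\<bar>\<^sup>2"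
  have M: "1 \<le> M" "\<bar>b - a\<bar> \<le> M" "\<bar>b - a\<bar> * \<bar>b - a\<bar> \<le> M"
    by (simp_all add: M_def power2_eq_square)
  define e' where "e' = e / M"
  have le: "e' * X \<le> e" if "X \<le> M" for X
    using mult_left_mono[OF that, of e'] e M(1) by (simp add: e'_def)
  have e': "0 < e'" "e' \<le> e" "e' * \<bar>b - a\<bar> \<le> e" "e' * \<bar>b - a\<bar> * \<bar>b - a\<bar> \<le> e"
    using e M le[of 1] le[of "\<bar>b - a\<bar>"] le[of "\<bar>b - a\<bar> * \<bar>b - a\<bar>"]
    by (simp_all only: mult.assoc) (simp_all add: e'_def)
  obtain p where p: "\<And>t. t \<in> {a..b} \<Longrightarrow> \<bar>\<theta>'' t - poly p t\<bar> \<le> e'"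
    using weierstrass_poly[OF continuous_on_subset[OF cont] e'(1), of a b] by blast
  obtain p1 where p1: "pderiv p1 = p"
    using ex_pderiv_eq by blast
  define q1 where "q1 = p1 + [:\<theta>' a - poly p1 a:]"
  have q1: "pderiv q1 = p" "poly q1 a = \<theta>' a"
    by (simp_all add: q1_def pderiv_add p1 pderiv_pCons)
  obtain p0 where p0: "pderiv p0 = q1"
    using ex_pderiv_eq by blast
  define q where "q = p0 + [:\<theta> a - poly p0 a:]"
  have q: "pderiv q = q1" "poly q a = \<theta> a"
    by (simp_all add: q_def pderiv_add p0 pderiv_pCons)
  have 1: "\<bar>\<theta>' t - poly q1 t\<bar> \<le> e' * (b - a)" if "t \<in> {a..b}" for t
    by (rule derivative_small_imp_small[where u'="\<lambda>t. \<theta>'' t - poly p t"])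
      (use that p q1 in \<open>auto intro!: derivative_eq_intros \<theta>\<close>)
  have 0: "\<bar>\<theta> t - poly q t\<bar> \<le> e' * (b - a) * (b - a)" if "t \<in> {a..b}" for t
    by (rule derivative_small_imp_small[where u'="\<lambda>t. \<theta>' t - poly q1 t"])
      (use that 1 q in \<open>auto intro!: derivative_eq_intros \<theta>\<close>)
  show ?thesis
  proof (intro exI[of _ q] ballI conjI)
    fix t assume t: "t \<in> {a..b}"
    then have ab: "b - a = \<bar>b - a\<bar>" by simp
    show "\<bar>\<theta> t - poly q t\<bar> \<le> e"
      using 0[OF t] e'(4) ab by simp
    show "\<bar>\<theta>' t - poly (pderiv q) t\<bar> \<le> e"
      using 1[OF t] e'(3) ab by (simp add: q)
    show "\<bar>\<theta>'' t - poly (pderiv (pderiv q)) t\<bar> \<le> e"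
      using p[OF t] e'(2) by (simp add: q q1)
  qed
qed

text \<open>Leibniz expansion of (\<rho> \<theta>)'' + m \<rho> \<theta> with the derivatives of
  \<theta> passed as arguments. In this form it is linear in the triple and applies to \<theta> that
  is only C^2.\<close>

definition wave_form :: "real \<Rightarrow> (real \<Rightarrow> real) \<Rightarrow> (real \<Rightarrow> real) \<Rightarrow> (real \<Rightarrow> real) \<Rightarrow> (real \<Rightarrow> real) \<Rightarrow> real \<Rightarrow> real" where
  "wave_form m \<rho> \<theta> \<theta>' \<theta>'' t =
     deriv (deriv \<rho>) t * \<theta> t + 2 * deriv \<rho> t * \<theta>' t + \<rho> t * \<theta>'' t + m * (\<rho> t * \<theta> t)"

lemma deriv2_mult:
  assumes \<rho>: "elem \<rho>"
    and \<theta>: "\<And>t. (\<theta> has_real_derivative \<theta>' t) (at t)" "\<And>t. (\<theta>' has_real_derivative \<theta>'' t) (at t)"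
  shows "deriv (deriv (\<lambda>t. \<rho> t * \<theta> t)) t + m * (\<rho> t * \<theta> t) = wave_form m \<rho> \<theta> \<theta>' \<theta>'' t"
proof -
  have "deriv (\<lambda>t. \<rho> t * \<theta> t) = (\<lambda>t. deriv \<rho> t * \<theta> t + \<theta>' t * \<rho> t)"
    by (intro ext DERIV_imp_deriv DERIV_mult elem_has_real_derivative \<rho> \<theta>)
  moreover have "deriv (\<lambda>t. deriv \<rho> t * \<theta> t + \<theta>' t * \<rho> t) t
      = (deriv (deriv \<rho>) t * \<theta> t + \<theta>' t * deriv \<rho> t) + (\<theta>'' t * \<rho> t + deriv \<rho> t * \<theta>' t)"
    by (intro DERIV_imp_deriv DERIV_mult DERIV_add elem_has_real_derivative elem_deriv \<rho> \<theta>)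
  ultimately show ?thesis
    by (simp add: wave_form_def algebra_simps)
qed

lemma deriv_const_on_open:
  fixes \<rho> :: "real \<Rightarrow> real"
  assumes "open S" "t \<in> S" "\<And>t. t \<in> S \<Longrightarrow> \<rho> t = c"
  shows "deriv \<rho> t = 0"
proof (rule DERIV_imp_deriv)
  show "(\<rho> has_real_derivative 0) (at t)"
    by (rule has_field_derivative_transform_within_open[of "\<lambda>_. c"]) (use assms in auto)
qed

text \<open>The hypothesis concerns countably many test functions, which is what survives at almost
  every frequency. Linearity extends it to polynomials. Since f is integrable on [a, b], which
  carries \<rho>, the functional is continuous in the C^2 norm there, and polynomials are
  dense.\<close>

lemma weak_form_extend:
  fixes f :: "real \<Rightarrow> complex"
  assumes \<rho>: "elem \<rho>" "\<And>t. t \<notin> {a..b} \<Longrightarrow> \<rho> t = 0"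
    and f: "set_integrable lborel {a..b} f"
    and H: "\<And>k. (LINT t|lborel. f t * of_real (deriv (deriv (\<lambda>t. \<rho> t * t ^ k)) t + m * (\<rho> t * t ^ k))) = 0"
    and \<theta>: "\<And>t. (\<theta> has_real_derivative \<theta>' t) (at t)" "\<And>t. (\<theta>' has_real_derivative \<theta>'' t) (at t)"
      "continuous_on UNIV \<theta>''"
  shows "(LINT t|lborel. f t * of_real (wave_form m \<rho> \<theta> \<theta>' \<theta>'' t)) = 0"
proof -
  have f': "integrable lborel (\<lambda>t. indicat_real {a..b} t *\<^sub>R f t)"
    using f by (simp add: set_integrable_def)
  have \<rho>1: "deriv \<rho> t = 0" if "t \<notin> {a..b}" for t
    by (rule deriv_const_on_open[of "- {a..b}"]) (use \<rho>(2) that in auto)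
  have \<rho>2: "deriv (deriv \<rho>) t = 0" if "t \<notin> {a..b}" for t
    by (rule deriv_const_on_open[of "- {a..b}"]) (use \<rho>1 that in auto)
  have cont\<rho>: "continuous_on A \<rho>" "continuous_on A (deriv \<rho>)" "continuous_on A (deriv (deriv \<rho>))" for A
    using \<rho>(1) by (auto intro: elem_continuous elem_deriv)
  have outside: "wave_form m \<rho> v v' v'' t = 0" if "t \<notin> {a..b}" for v v' v'' t
    using that by (simp add: wave_form_def \<rho> \<rho>1 \<rho>2)
  have integrable: "integrable lborel (\<lambda>t. f t * of_real (wave_form m \<rho> v v' v'' t))"
    if "continuous_on UNIV v" "continuous_on UNIV v'" "continuous_on UNIV v''" for v v' v''
  proof -
    have cont: "continuous_on UNIV (wave_form m \<rho> v v' v'')"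
      unfolding wave_form_def[abs_def] by (intro continuous_intros cont\<rho> that)
    then have [measurable]: "wave_form m \<rho> v v' v'' \<in> borel_measurable borel"
      by (rule borel_measurable_continuous_onI)
    have "compact (wave_form m \<rho> v v' v'' ` {a..b})"
      by (intro compact_continuous_image continuous_on_subset[OF cont]) auto
    from compact_imp_bounded[OF this]
    have "\<exists>B. \<forall>t\<in>{a..b}. \<bar>wave_form m \<rho> v v' v'' t\<bar> \<le> B"
      by (simp add: bounded_iff)
    then obtain B where B: "\<And>t. t \<in> {a..b} \<Longrightarrow> \<bar>wave_form m \<rho> v v' v'' t\<bar> \<le> B"
      by blast
    have eq: "(\<lambda>t. f t * of_real (wave_form m \<rho> v v' v'' t))
        = (\<lambda>t. (indicat_real {a..b} t *\<^sub>R f t) * of_real (wave_form m \<rho> v v' v'' t))"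
      using outside by (auto simp: fun_eq_iff indicator_def)
    show ?thesis
      unfolding eq
    proof (rule Bochner_Integration.integrable_bound[OF integrable_scaleR_right[of B, OF f']])
      show "AE t in lborel. norm ((indicat_real {a..b} t *\<^sub>R f t) * of_real (wave_form m \<rho> v v' v'' t))
          \<le> norm (B *\<^sub>R indicat_real {a..b} t *\<^sub>R f t)"
      proof (intro AE_I2)
        fix t
        show "norm ((indicat_real {a..b} t *\<^sub>R f t) * of_real (wave_form m \<rho> v v' v'' t))
          \<le> norm (B *\<^sub>R indicat_real {a..b} t *\<^sub>R f t)"
        proof (cases "t \<in> {a..b}")
          case True
          then have "\<bar>wave_form m \<rho> v v' v'' t\<bar> \<le> \<bar>B\<bar>"
            using B[of t] by linarith
          with True show ?thesis
            by (simp add: norm_mult mult.commute[of "norm (f t)"] mult_right_mono)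
        qed simp
      qed
      show "(\<lambda>t. (indicat_real {a..b} t *\<^sub>R f t) * of_real (wave_form m \<rho> v v' v'' t)) \<in> borel_measurable lborel"
        using borel_measurable_integrable[OF f'] by (intro borel_measurable_times) simp_all
    qed
  qed
  define L where "L q = (LINT t|lborel. f t * of_real (wave_form m \<rho> (poly q) (poly (pderiv q)) (poly (pderiv (pderiv q))) t))"
    for q
  have poly_int: "integrable lborel
      (\<lambda>t. f t * of_real (wave_form m \<rho> (poly q) (poly (pderiv q)) (poly (pderiv (pderiv q))) t))" for q
    by (intro integrable continuous_on_poly continuous_on_id)
  have L_add: "L (p + q) = L p + L q" for p q
  proof -
    have "f t * of_real (wave_form m \<rho> (poly (p + q)) (poly (pderiv (p + q))) (poly (pderiv (pderiv (p + q)))) t)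
      = f t * of_real (wave_form m \<rho> (poly p) (poly (pderiv p)) (poly (pderiv (pderiv p))) t)
        + f t * of_real (wave_form m \<rho> (poly q) (poly (pderiv q)) (poly (pderiv (pderiv q))) t)" for t
      by (simp add: wave_form_def pderiv_add algebra_simps)
    then show ?thesis
      by (simp only: L_def Bochner_Integration.integral_add[OF poly_int poly_int])
  qed
  have L_monom: "L (monom c k) = 0" for c k
  proof -
    have "f t * of_real (wave_form m \<rho> (poly (monom c k)) (poly (pderiv (monom c k))) (poly (pderiv (pderiv (monom c k)))) t)
      = of_real c * (f t * of_real (deriv (deriv (\<lambda>t. \<rho> t * t ^ k)) t + m * (\<rho> t * t ^ k)))" for t
    proof -
      have "deriv (deriv (\<lambda>t. \<rho> t * poly (monom 1 k) t)) t + m * (\<rho> t * poly (monom 1 k) t)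
        = wave_form m \<rho> (poly (monom 1 k)) (poly (pderiv (monom 1 k))) (poly (pderiv (pderiv (monom 1 k)))) t"
        by (intro deriv2_mult \<rho> poly_DERIV)
      moreover have "monom c k = smult c (monom 1 k)"
        by (simp add: smult_monom)
      ultimately show ?thesis
        by (simp add: wave_form_def pderiv_smult poly_monom algebra_simps)
    qed
    then show ?thesis
      by (simp only: L_def integral_mult_right_zero H mult_zero_right)
  qed
  have "L (\<Sum>i\<in>I. monom (c i) i) = 0" if "finite I" for I c
    using that
  proof (induction I)
    case empty
    show ?case using L_monom[of 0 0] by simp
  qed (simp add: L_add L_monom)
  from this[of "{..degree q}" "coeff q" for q] have L: "L q = 0" for q
    by (simp add: poly_as_sum_of_monoms)
  have cont\<theta>: "continuous_on A \<theta>" "continuous_on A \<theta>'" for A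
    by (rule DERIV_continuous_on, rule has_field_derivative_at_within, rule \<theta>)+
  \<comment> \<open>The moduli of the coefficients of \<open>wave_form\<close>: an error e in
    \<theta>, \<theta>' and \<theta>'' changes its value at t by at most e K(t).\<close>
  define K where "K t = \<bar>deriv (deriv \<rho>) t\<bar> + 2 * \<bar>deriv \<rho> t\<bar> + \<bar>\<rho> t\<bar> + \<bar>m * \<rho> t\<bar>" for t
  have "continuous_on {a..b} K"
    unfolding K_def by (intro continuous_intros cont\<rho>)
  then have "compact (K ` {a..b})"
    by (intro compact_continuous_image) auto
  from compact_imp_bounded[OF this]
  have "\<exists>B. \<forall>t\<in>{a..b}. \<bar>K t\<bar> \<le> B"
    by (simp add: bounded_iff)
  then obtain B where B: "\<And>t. t \<in> {a..b} \<Longrightarrow> \<bar>K t\<bar> \<le> B"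
    by blast
  define I where "I = (LINT t|lborel. norm (indicat_real {a..b} t *\<^sub>R f t))"
  have bound: "norm (LINT t|lborel. f t * of_real (wave_form m \<rho> \<theta> \<theta>' \<theta>'' t)) \<le> e * (\<bar>B\<bar> * I)" if e: "0 < e" for e
  proof -
    obtain q where q: "\<And>t. t \<in> {a..b} \<Longrightarrow> \<bar>\<theta> t - poly q t\<bar> \<le> e"
      "\<And>t. t \<in> {a..b} \<Longrightarrow> \<bar>\<theta>' t - poly (pderiv q) t\<bar> \<le> e"
      "\<And>t. t \<in> {a..b} \<Longrightarrow> \<bar>\<theta>'' t - poly (pderiv (pderiv q)) t\<bar> \<le> e"
      using C2_poly_approx[OF \<theta> e, of a b] by blast
    let ?d = "\<lambda>t. wave_form m \<rho> \<theta> \<theta>' \<theta>'' t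
      - wave_form m \<rho> (poly q) (poly (pderiv q)) (poly (pderiv (pderiv q))) t"
    have d: "\<bar>?d t\<bar> \<le> e * \<bar>B\<bar>" if t: "t \<in> {a..b}" for t
    proof -
      have "?d t = deriv (deriv \<rho>) t * (\<theta> t - poly q t) + 2 * deriv \<rho> t * (\<theta>' t - poly (pderiv q) t)
        + \<rho> t * (\<theta>'' t - poly (pderiv (pderiv q)) t) + m * \<rho> t * (\<theta> t - poly q t)"
        by (simp add: wave_form_def algebra_simps)
      also have "\<bar>deriv (deriv \<rho>) t * (\<theta> t - poly q t) + 2 * deriv \<rho> t * (\<theta>' t - poly (pderiv q) t)
        + \<rho> t * (\<theta>'' t - poly (pderiv (pderiv q)) t) + m * \<rho> t * (\<theta> t - poly q t)\<bar>
        \<le> \<bar>deriv (deriv \<rho>) t\<bar> * e + 2 * \<bar>deriv \<rho> t\<bar> * e + \<bar>\<rho> t\<bar> * e + \<bar>m * \<rho> t\<bar> * e"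
        by (intro order.trans[OF abs_triangle_ineq] add_mono)
          (simp_all add: abs_mult mult_left_mono q[OF t])
      also have "\<dots> = e * K t"
        by (simp add: K_def algebra_simps)
      also have "\<dots> \<le> e * \<bar>B\<bar>"
        using B[OF t] e by (intro mult_left_mono) auto
      finally show ?thesis .
    qed
    have "(LINT t|lborel. f t * of_real (wave_form m \<rho> \<theta> \<theta>' \<theta>'' t))
      = (LINT t|lborel. f t * of_real (wave_form m \<rho> \<theta> \<theta>' \<theta>'' t)) - L q"
      by (simp add: L)
    also have "\<dots> = (LINT t|lborel. f t * of_real (?d t))"
      unfolding L_def by (subst Bochner_Integration.integral_diff[symmetric])
        (auto intro!: poly_int integrable cont\<theta> \<theta>(3) simp: right_diff_distrib)
    finally have eq: "(LINT t|lborel. f t * of_real (wave_form m \<rho> \<theta> \<theta>' \<theta>'' t)) = (LINT t|lborel. f t * of_real (?d t))" .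
    have "norm (LINT t|lborel. f t * of_real (?d t)) \<le> (LINT t|lborel. (e * \<bar>B\<bar>) * norm (indicat_real {a..b} t *\<^sub>R f t))"
    proof (rule Bochner_Integration.integral_norm_bound_integral)
      have "integrable lborel (\<lambda>t. f t * of_real (wave_form m \<rho> \<theta> \<theta>' \<theta>'' t)
          - f t * of_real (wave_form m \<rho> (poly q) (poly (pderiv q)) (poly (pderiv (pderiv q))) t))"
        by (intro Bochner_Integration.integrable_diff poly_int integrable cont\<theta> \<theta>(3))
      then show "integrable lborel (\<lambda>t. f t * of_real (?d t))"
        by (simp add: right_diff_distrib)
      show "norm (f t * of_real (?d t)) \<le> (e * \<bar>B\<bar>) * norm (indicat_real {a..b} t *\<^sub>R f t)" for t
      proof (cases "t \<in> {a..b}")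
        case True
        then show ?thesis
          using mult_right_mono[OF d[OF True], of "norm (f t)"]
          by (simp add: norm_mult mult.commute flip: of_real_diff)
      qed (simp add: outside)
    qed (use f' in \<open>auto intro!: integrable_norm simp del: norm_scaleR\<close>)
    also have "\<dots> = e * (\<bar>B\<bar> * I)"
      unfolding I_def by (simp del: norm_scaleR)
    finally show ?thesis
      by (simp only: eq)
  qed
  have "norm (LINT t|lborel. f t * of_real (wave_form m \<rho> \<theta> \<theta>' \<theta>'' t)) \<le> 0"
  proof (rule field_le_epsilon)
    fix e :: real assume e: "0 < e"
    have I: "0 \<le> \<bar>B\<bar> * I"
      unfolding I_def by (intro mult_nonneg_nonneg Bochner_Integration.integral_nonneg) auto
    then have "norm (LINT t|lborel. f t * of_real (wave_form m \<rho> \<theta> \<theta>' \<theta>'' t)) \<le> e / (\<bar>B\<bar> * I + 1) * (\<bar>B\<bar> * I)"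
      using e by (intro bound) (auto intro!: divide_pos_pos)
    also have "\<dots> \<le> e"
      using I e by (simp add: field_simps)
    finally show "norm (LINT t|lborel. f t * of_real (wave_form m \<rho> \<theta> \<theta>' \<theta>'' t)) \<le> 0 + e"
      by simp
  qed
  then show ?thesis by simp
qed

text \<open>A tent that is positive inside (a, b) and 0 outside makes its product with any
  continuous function an admissible \<eta>. So g times the tent is 0 almost everywhere, hence g is
  on (a, b), and countably many such intervals exhaust the half-line.\<close>

lemma AE_eq_0_on_half_line:
  fixes g :: "real \<Rightarrow> complex"
  assumes int: "\<And>a b. c < a \<Longrightarrow> set_integrable lborel {a..b} g"
    and 0: "\<And>a b \<eta>. c < a \<Longrightarrow> continuous_on UNIV \<eta> \<Longrightarrow> (\<And>t. t \<notin> {a..b} \<Longrightarrow> \<eta> t = 0) \<Longrightarrow>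
      (LINT t|lborel. g t * complex_of_real (\<eta> t)) = 0"
  shows "AE t in lborel. c < t \<longrightarrow> g t = 0"
proof -
  have "AE t in lborel. t \<in> {a<..<b} \<longrightarrow> g t = 0" if a: "c < a" for a b
  proof -
    define \<zeta> where "\<zeta> t = max 0 (min (t - a) (b - t))" for t
    have cont: "continuous_on UNIV \<zeta>"
      unfolding \<zeta>_def by (intro continuous_intros)
    then have [measurable]: "\<zeta> \<in> borel_measurable borel"
      by (rule borel_measurable_continuous_onI)
    have int': "integrable lborel (\<lambda>t. indicat_real {a..b} t *\<^sub>R g t)"
      using int[OF a] by (simp add: set_integrable_def)
    have eq: "g t * of_real (\<zeta> t) = (indicat_real {a..b} t *\<^sub>R g t) * of_real (\<zeta> t)" for t
      by (auto simp: \<zeta>_def indicator_def)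
    have "AE t in lborel. g t * of_real (\<zeta> t) = 0"
    proof (rule AE_eq_0_if_continuous_integrals_0)
      show "integrable lborel (\<lambda>t. g t * of_real (\<zeta> t))"
        unfolding eq
      proof (rule Bochner_Integration.integrable_bound[OF integrable_scaleR_right[of "\<bar>b - a\<bar>", OF int']])
        show "AE t in lborel. norm ((indicat_real {a..b} t *\<^sub>R g t) * of_real (\<zeta> t))
            \<le> norm (\<bar>b - a\<bar> *\<^sub>R indicat_real {a..b} t *\<^sub>R g t)"
        proof (intro AE_I2)
          fix t
          have "\<bar>\<zeta> t\<bar> \<le> \<bar>b - a\<bar>" if "t \<in> {a..b}"
            using that by (auto simp: \<zeta>_def)
          then show "norm ((indicat_real {a..b} t *\<^sub>R g t) * of_real (\<zeta> t))
            \<le> norm (\<bar>b - a\<bar> *\<^sub>R indicat_real {a..b} t *\<^sub>R g t)"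
            by (auto simp: norm_mult indicator_def mult.commute mult_right_mono)
        qed
        show "(\<lambda>t. (indicat_real {a..b} t *\<^sub>R g t) * of_real (\<zeta> t)) \<in> borel_measurable lborel"
          using borel_measurable_integrable[OF int'] by (intro borel_measurable_times) simp_all
      qed
      fix h :: "real \<Rightarrow> real" assume h: "continuous_on UNIV h"
      have "(LINT t|lborel. g t * complex_of_real (\<zeta> t * h t)) = 0"
        by (rule 0[OF a, of _ b]) (auto intro!: continuous_intros cont h simp: \<zeta>_def)
      then show "(LINT t|lborel. h t *\<^sub>R (g t * of_real (\<zeta> t))) = 0"
        by (simp add: scaleR_conv_of_real mult_ac)
    qed
    then show ?thesis
      by (rule AE_mp) (auto simp: \<zeta>_def)
  qed
  then have "AE t in lborel. \<forall>n. t \<in> {c + inverse (real (Suc n)) <..< c + real (Suc n)} \<longrightarrow> g t = 0"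
    unfolding AE_all_countable by (intro allI) simp
  then show ?thesis
  proof (rule AE_mp, intro AE_I2 impI)
    fix t assume *: "\<forall>n. t \<in> {c + inverse (real (Suc n)) <..< c + real (Suc n)} \<longrightarrow> g t = 0" and t: "c < t"
    obtain n where n: "inverse (real (Suc n)) < t - c"
      using reals_Archimedean[of "t - c"] t by auto
    obtain k :: nat where k: "t - c < real k"
      using reals_Archimedean2 by blast
    have "inverse (real (Suc (n + k))) \<le> inverse (real (Suc n))"
      by (intro le_imp_inverse_le) auto
    then have "c + inverse (real (Suc (n + k))) < t"
      using n by linarith
    moreover have "t < c + real (Suc (n + k))"
      using k by simp
    ultimately show "g t = 0"
      using * greaterThanLessThan_iff by blast
  qed
qed

text \<open>Where the plateau is locally 1 its derivatives vanish and the cutoff disappears.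
  Elsewhere either t \<le> 0, where f is 0, or \<theta> vanishes with its two derivatives. The
  condition on \<theta> is imposed for t > 0 only, so a plateau reaching across 0 admits \<theta>
  that do not vanish at 0.\<close>

lemma weak_form_plateau:
  fixes f :: "real \<Rightarrow> complex" and p p' q q' :: real
  defines "\<rho> \<equiv> plateau p p' q' q"
  assumes pq: "p < p'" "q' < q"
    and f0: "\<And>t. t \<le> 0 \<Longrightarrow> f t = 0" and f: "set_integrable lborel {p..q} f"
    and H: "\<And>k. (LINT t|lborel. f t * of_real (deriv (deriv (\<lambda>t. \<rho> t * t ^ k)) t + m * (\<rho> t * t ^ k))) = 0"
    and \<theta>: "\<And>t. (\<theta> has_real_derivative \<theta>' t) (at t)" "\<And>t. (\<theta>' has_real_derivative \<theta>'' t) (at t)"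
      "continuous_on UNIV \<theta>''"
    and out: "\<And>t. 0 < t \<Longrightarrow> t \<notin> {p'<..<q'} \<Longrightarrow> \<theta> t = 0 \<and> \<theta>' t = 0 \<and> \<theta>'' t = 0"
  shows "(LINT t|lborel. f t * of_real (\<theta>'' t + m * \<theta> t)) = 0"
proof -
  have "elem \<rho>" "\<And>t. t \<notin> {p..q} \<Longrightarrow> \<rho> t = 0"
    unfolding \<rho>_def using pq by (auto intro: elem_plateau plateau_eq_0)
  from weak_form_extend[OF this f H \<theta>]
  have "(LINT t|lborel. f t * of_real (wave_form m \<rho> \<theta> \<theta>' \<theta>'' t)) = 0" .
  moreover have "f t * of_real (wave_form m \<rho> \<theta> \<theta>' \<theta>'' t) = f t * of_real (\<theta>'' t + m * \<theta> t)" for t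
  proof (cases "0 < t \<and> t \<in> {p'<..<q'}")
    case True
    have 0: "\<rho> r = 1" if "r \<in> {p'<..<q'}" for r
      unfolding \<rho>_def using pq that by (intro plateau_eq_1) auto
    have 1: "deriv \<rho> r = 0" if "r \<in> {p'<..<q'}" for r
      by (rule deriv_const_on_open[of "{p'<..<q'}"]) (use 0 that in auto)
    have 2: "deriv (deriv \<rho>) r = 0" if "r \<in> {p'<..<q'}" for r
      by (rule deriv_const_on_open[of "{p'<..<q'}"]) (use 1 that in auto)
    show ?thesis
      using True 0 1 2 by (simp add: wave_form_def)
  next
    case False
    then show ?thesis
      using f0[of t] out[of t] by (cases "0 < t") (auto simp: wave_form_def)
  qed
  ultimately show ?thesis by simp
qed

text \<open>These are cos(sqrt(m) t) and sin(sqrt(m) t)/sqrt(m), with limits 1 and t for m = 0, so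
  that later arguments treat all m \<ge> 0 alike. The common constant 2 c(1) in both addition
  formulas makes one three-term combination annihilate every homogeneous solution.\<close>

lemma oscillator:
  assumes "0 \<le> m"
  obtains c s :: "real \<Rightarrow> real" where
    "\<And>t. (c has_real_derivative - m * s t) (at t)" "\<And>t. (s has_real_derivative c t) (at t)"
    "\<And>t. c t * c t + m * (s t * s t) = 1"
    "\<And>t. c (t + 1) + c (t - 1) = 2 * c 1 * c t" "\<And>t. s (t + 1) + s (t - 1) = 2 * c 1 * s t"
    "\<bar>c 1\<bar> \<le> 1"
proof (cases "m = 0")
  case True
  show ?thesis
    by (rule that[of "\<lambda>_. 1" "\<lambda>t. t"]) (auto simp: True)
next
  case False
  define w where "w = sqrt m"
  have w: "w \<noteq> 0" "m = w * w"
    using assms False by (auto simp: w_def)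
  show ?thesis
  proof (rule that[of "\<lambda>t. cos (w * t)" "\<lambda>t. sin (w * t) / w"])
    show "((\<lambda>t. cos (w * t)) has_real_derivative - m * (sin (w * t) / w)) (at t)" for t
      using w by (auto intro!: derivative_eq_intros)
    show "((\<lambda>t. sin (w * t) / w) has_real_derivative cos (w * t)) (at t)" for t
      using w by (auto intro!: derivative_eq_intros)
    show "cos (w * t) * cos (w * t) + m * (sin (w * t) / w * (sin (w * t) / w)) = 1" for t
      using w sin_cos_squared_add3[of "w * t"] by (simp add: field_simps)
    show "cos (w * (t + 1)) + cos (w * (t - 1)) = 2 * cos (w * 1) * cos (w * t)" for t
      by (simp add: distrib_left right_diff_distrib cos_add cos_diff)
    show "sin (w * (t + 1)) / w + sin (w * (t - 1)) / w = 2 * cos (w * 1) * (sin (w * t) / w)" for t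
      by (simp add: distrib_left right_diff_distrib sin_add sin_diff add_divide_distrib diff_divide_distrib)
  qed simp
qed

lemma ex_antiderivative:
  fixes g :: "real \<Rightarrow> real"
  assumes "continuous_on UNIV g"
  obtains G where "\<And>t. (G has_real_derivative g t) (at t)" "G t0 = 0"
proof -
  have "\<exists>F. \<forall>x :: real. -\<infinity> < ereal x \<longrightarrow> ereal x < \<infinity> \<longrightarrow> (F has_vector_derivative g x) (at x)"
    using assms by (intro einterval_antiderivative) (auto simp: continuous_on_eq_continuous_at)
  then obtain F where "\<And>x. (F has_real_derivative g x) (at x)"
    by (auto simp: has_real_derivative_iff_has_vector_derivative)
  then have "((\<lambda>t. F t - F t0) has_real_derivative g t) (at t)" for t
    by (auto intro!: derivative_eq_intros)
  then show ?thesis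
    by (rule that) simp
qed

lemma const_if_derivative_0:
  fixes G :: "real \<Rightarrow> real"
  assumes "\<And>t. (G has_real_derivative g t) (at t)" "\<And>t. a \<le> t \<Longrightarrow> t \<le> b \<Longrightarrow> g t = 0" "a \<le> b"
  shows "G b = G a"
proof -
  have "\<bar>G b - G a\<bar> \<le> 0 * (b - a)"
    by (rule derivative_small_imp_small[where u="\<lambda>t. G t - G a" and u'=g])
      (use assms in \<open>auto intro!: derivative_eq_intros\<close>)
  then show ?thesis by simp
qed

text \<open>Variation of constants for \<open>F'' + m F = \<eta>\<close>.\<close>

lemma inhomogeneous_oscillator:
  fixes c s C D \<eta> :: "real \<Rightarrow> real" and m :: real
  defines "F \<equiv> \<lambda>t. s t * C t - c t * D t" and "F' \<equiv> \<lambda>t. c t * C t + m * (s t * D t)"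
  assumes c: "\<And>t. (c has_real_derivative - m * s t) (at t)" and s: "\<And>t. (s has_real_derivative c t) (at t)"
    and 1: "\<And>t. c t * c t + m * (s t * s t) = 1"
    and C: "\<And>t. (C has_real_derivative c t * \<eta> t) (at t)" and D: "\<And>t. (D has_real_derivative s t * \<eta> t) (at t)"
  shows "(F has_real_derivative F' t) (at t)" "(F' has_real_derivative \<eta> t - m * F t) (at t)"
proof -
  show "(F has_real_derivative F' t) (at t)"
    unfolding F_def F'_def by (auto intro!: derivative_eq_intros c s C D simp: algebra_simps)
  have "(F' has_real_derivative (c t * c t + m * (s t * s t)) * \<eta> t - m * F t) (at t)"
    unfolding F_def F'_def by (auto intro!: derivative_eq_intros c s C D simp: algebra_simps)
  then show "(F' has_real_derivative \<eta> t - m * F t) (at t)"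
    by (simp add: 1)
qed

lemma set_integrable_translate:
  fixes f :: "real \<Rightarrow> complex"
  assumes "set_integrable lborel {a + h..b + h} f"
  shows "set_integrable lborel {a..b} (\<lambda>t. f (t + h))"
proof -
  have "integrable lborel (\<lambda>t. indicat_real {a + h..b + h} (t + h) *\<^sub>R f (t + h))"
    using integral_translate(1)[OF assms[unfolded set_integrable_def]] .
  moreover have "indicat_real {a + h..b + h} (t + h) = indicat_real {a..b} t" for t
    by (simp add: indicator_def)
  ultimately show ?thesis
    by (simp add: set_integrable_def)
qed

lemma integrable_mult_continuous_compact:
  fixes f :: "real \<Rightarrow> complex"
  assumes f: "set_integrable lborel {a..b} f" and \<eta>: "continuous_on UNIV \<eta>" "\<And>t. t \<notin> {a..b} \<Longrightarrow> \<eta> t = 0"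
  shows "integrable lborel (\<lambda>t. f t * complex_of_real (\<eta> t))"
proof -
  have f': "integrable lborel (\<lambda>t. indicat_real {a..b} t *\<^sub>R f t)"
    using f by (simp add: set_integrable_def)
  have [measurable]: "\<eta> \<in> borel_measurable borel"
    using \<eta>(1) by (rule borel_measurable_continuous_onI)
  have "compact (\<eta> ` {a..b})"
    by (intro compact_continuous_image continuous_on_subset[OF \<eta>(1)]) auto
  from compact_imp_bounded[OF this] have "\<exists>B. \<forall>t\<in>{a..b}. \<bar>\<eta> t\<bar> \<le> B"
    by (simp add: bounded_iff)
  then obtain B where B: "\<And>t. t \<in> {a..b} \<Longrightarrow> \<bar>\<eta> t\<bar> \<le> B"
    by blast
  have eq: "(\<lambda>t. f t * complex_of_real (\<eta> t)) = (\<lambda>t. (indicat_real {a..b} t *\<^sub>R f t) * complex_of_real (\<eta> t))"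
    using \<eta>(2) by (auto simp: fun_eq_iff indicator_def)
  show ?thesis
    unfolding eq
  proof (rule Bochner_Integration.integrable_bound[OF integrable_scaleR_right[of B, OF f']])
    show "AE t in lborel. norm ((indicat_real {a..b} t *\<^sub>R f t) * complex_of_real (\<eta> t))
        \<le> norm (B *\<^sub>R indicat_real {a..b} t *\<^sub>R f t)"
    proof (intro AE_I2)
      fix t
      show "norm ((indicat_real {a..b} t *\<^sub>R f t) * complex_of_real (\<eta> t))
        \<le> norm (B *\<^sub>R indicat_real {a..b} t *\<^sub>R f t)"
      proof (cases "t \<in> {a..b}")
        case True
        then have "\<bar>\<eta> t\<bar> \<le> \<bar>B\<bar>"
          using B[of t] by linarith
        with True show ?thesis
          by (simp add: norm_mult mult.commute[of "norm (f t)"] mult_right_mono)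
      qed simp
    qed
    show "(\<lambda>t. (indicat_real {a..b} t *\<^sub>R f t) * complex_of_real (\<eta> t)) \<in> borel_measurable lborel"
      using borel_measurable_integrable[OF f'] by (intro borel_measurable_times) simp_all
  qed
qed

text \<open>The test function \<open>F(t+1) + F(t-1) - 2 c(1) F(t)\<close> has compact support although \<open>F\<close> has not.
  The resulting three-term relation bounds \<open>f\<close> near \<open>0\<close> by \<open>f\<close> away from \<open>0\<close>, uniformly in \<open>m\<close>.\<close>

lemma weak_oscillator_translation:
  fixes f :: "real \<Rightarrow> complex"
  defines "\<rho> \<equiv> \<lambda>n. plateau (inverse (real (Suc (Suc n)))) (inverse (real (Suc n))) (real (Suc n)) (real (Suc (Suc n)))"
  assumes f0: "\<And>t. t \<le> 0 \<Longrightarrow> f t = 0" and f: "\<And>a b. 0 < a \<Longrightarrow> set_integrable lborel {a..b} f"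
    and m: "0 \<le> m"
    and H: "\<And>n k. (LINT t|lborel. f t * of_real (deriv (deriv (\<lambda>t. \<rho> n t * t ^ k)) t + m * (\<rho> n t * t ^ k))) = 0"
  shows "AE t in lborel. 1 < t \<longrightarrow> norm (f (t - 1)) \<le> 2 * norm (f t) + norm (f (t + 1))"
proof -
  obtain c s where cs: "\<And>t. (c has_real_derivative - m * s t) (at t)" "\<And>t. (s has_real_derivative c t) (at t)"
    "\<And>t. c t * c t + m * (s t * s t) = 1"
    "\<And>t. c (t + 1) + c (t - 1) = 2 * c 1 * c t" "\<And>t. s (t + 1) + s (t - 1) = 2 * c 1 * s t"
    "\<bar>c 1\<bar> \<le> 1"
    using oscillator[OF m] by metis
  have cont: "continuous_on A c" "continuous_on A s" for A
    by (rule DERIV_continuous_on, rule has_field_derivative_at_within, rule cs)+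
  \<comment> \<open>The three-term relation is proved weakly: g is tested with continuous \<eta>
    supported in [a, b], where a > 1 keeps t - 1 positive.\<close>
  define g where "g t = f (t - 1) + f (t + 1) - 2 * of_real (c 1) * f t" for t
  have "AE t in lborel. 1 < t \<longrightarrow> g t = 0"
  proof (rule AE_eq_0_on_half_line)
    have shifted: "set_integrable lborel {a..b} (\<lambda>t. f (t - 1))" "set_integrable lborel {a..b} (\<lambda>t. f (t + 1))"
      if "1 < a" for a b
      using set_integrable_translate[of a "-1" b f] set_integrable_translate[of a 1 b f] f that by simp_all
    show "set_integrable lborel {a..b} g" if "1 < a" for a b
      unfolding g_def using shifted[OF that] f[of a b] that
      by (intro set_integral_diff set_integral_add set_integrable_mult_right) auto
    fix a b :: real and \<eta> :: "real \<Rightarrow> real"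
    assume a: "1 < a" and \<eta>: "continuous_on UNIV \<eta>" "\<And>t. t \<notin> {a..b} \<Longrightarrow> \<eta> t = 0"
    show "(LINT t|lborel. g t * complex_of_real (\<eta> t)) = 0"
    proof (cases "a \<le> b")
      case False
      then have "\<eta> t = 0" for t
        using \<eta>(2)[of t] by auto
      then show ?thesis by simp
    next
      case True
      obtain C where C: "\<And>t. (C has_real_derivative c t * \<eta> t) (at t)" "C a = 0"
        using ex_antiderivative[of "\<lambda>t. c t * \<eta> t" a] cont \<eta>(1) by (metis continuous_on_mult)
      obtain D where D: "\<And>t. (D has_real_derivative s t * \<eta> t) (at t)" "D a = 0"
        using ex_antiderivative[of "\<lambda>t. s t * \<eta> t" a] cont \<eta>(1) by (metis continuous_on_mult)
      \<comment> \<open>Continuity forces \<eta> to vanish at the end points, so that C and D are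
        constant on the closed half-lines t \<le> a and t \<ge> b.\<close>
      have \<eta>a: "\<eta> a = 0" and \<eta>b: "\<eta> b = 0"
      proof -
        have "\<eta> \<midarrow>a\<rightarrow> \<eta> a" "\<eta> \<midarrow>b\<rightarrow> \<eta> b"
          using \<eta>(1) by (auto simp: continuous_on_eq_continuous_at isCont_def)
        then have "(\<eta> \<longlongrightarrow> \<eta> a) (at_left a)" "(\<eta> \<longlongrightarrow> \<eta> b) (at_right b)"
          by (auto simp: filterlim_at_split)
        moreover have "(\<eta> \<longlongrightarrow> 0) (at_left a)" "(\<eta> \<longlongrightarrow> 0) (at_right b)"
          using \<eta>(2) by (auto intro!: tendsto_eventually simp: eventually_at_filter)
        ultimately show "\<eta> a = 0" "\<eta> b = 0"
          using tendsto_unique trivial_limit_at_left_real trivial_limit_at_right_real by blast+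
      qed
      have left: "C t = 0" "D t = 0" if "t \<le> a" for t
      proof -
        have "\<eta> r = 0" if "t \<le> r" "r \<le> a" for r
          using \<eta>(2)[of r] \<eta>a that by (cases "r = a") auto
        then show "C t = 0" "D t = 0"
          using const_if_derivative_0[OF C(1) _ \<open>t \<le> a\<close>] const_if_derivative_0[OF D(1) _ \<open>t \<le> a\<close>] C(2) D(2)
          by simp_all
      qed
      have right: "C t = C b" "D t = D b" if "b \<le> t" for t
      proof -
        have "\<eta> r = 0" if "b \<le> r" "r \<le> t" for r
          using \<eta>(2)[of r] \<eta>b that by (cases "r = b") auto
        then show "C t = C b" "D t = D b"
          using const_if_derivative_0[OF C(1) _ \<open>b \<le> t\<close>] const_if_derivative_0[OF D(1) _ \<open>b \<le> t\<close>]
          by simp_all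
      qed
      define F where "F t = s t * C t - c t * D t" for t
      define F' where "F' t = c t * C t + m * (s t * D t)" for t
      note F = inhomogeneous_oscillator[OF cs(1-3) C(1) D(1), folded F_def F'_def]
      define \<theta> where "\<theta> t = F (t + 1) + F (t - 1) - 2 * c 1 * F t" for t
      define \<theta>' where "\<theta>' t = F' (t + 1) + F' (t - 1) - 2 * c 1 * F' t" for t
      define \<theta>'' where "\<theta>'' t = (\<eta> (t + 1) - m * F (t + 1)) + (\<eta> (t - 1) - m * F (t - 1)) - 2 * c 1 * (\<eta> t - m * F t)" for t
      have shift: "((\<lambda>t. u (t + h)) has_real_derivative u' (t + h)) (at t)"
        if "\<And>t. (u has_real_derivative u' t) (at t)" for u u' :: "real \<Rightarrow> real" and h t
        using DERIV_shift[of u "u' (t + h)" t h] that by simp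
      have d\<theta>: "(\<theta> has_real_derivative \<theta>' t) (at t)" for t
        unfolding \<theta>_def \<theta>'_def
        by (intro DERIV_diff DERIV_add DERIV_cmult F(1) shift[where h="-1" and u=F and u'=F', simplified]
            shift[where h=1 and u=F and u'=F', simplified])
      have d\<theta>': "(\<theta>' has_real_derivative \<theta>'' t) (at t)" for t
        unfolding \<theta>'_def \<theta>''_def
        by (intro DERIV_diff DERIV_add DERIV_cmult F(2)
            shift[where h="-1" and u=F' and u'="\<lambda>t. \<eta> t - m * F t", simplified]
            shift[where h=1 and u=F' and u'="\<lambda>t. \<eta> t - m * F t", simplified])
      have contF: "continuous_on UNIV F"
        by (rule DERIV_continuous_on, rule has_field_derivative_at_within, rule F(1))
      have cont\<theta>'': "continuous_on UNIV \<theta>''"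
        unfolding \<theta>''_def
        by (intro continuous_intros continuous_on_compose2[OF \<eta>(1)] continuous_on_compose2[OF contF]) auto
      have eq: "\<theta>'' t + m * \<theta> t = \<eta> (t + 1) + \<eta> (t - 1) - 2 * c 1 * \<eta> t" for t
        by (simp add: \<theta>_def \<theta>''_def algebra_simps)
      have low: "\<theta> t = 0" "\<theta>' t = 0" if "t \<le> a - 1" for t
        using that left[of "t + 1"] left[of t] left[of "t - 1"]
        by (simp_all add: \<theta>_def \<theta>'_def F_def F'_def)
      \<comment> \<open>Beyond b the coefficients C and D are constant, so F is a homogeneous
        solution there and the addition formulas for c and s cancel it.\<close>
      have high: "\<theta> t = 0" "\<theta>' t = 0" if "b + 1 \<le> t" for t
      proof -
        have R: "C (t + 1) = C b" "D (t + 1) = D b" "C (t - 1) = C b" "D (t - 1) = D b" "C t = C b" "D t = D b"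
          using that by (auto intro: right)
        have "\<theta> t = (s (t + 1) + s (t - 1) - 2 * c 1 * s t) * C b - (c (t + 1) + c (t - 1) - 2 * c 1 * c t) * D b"
          unfolding \<theta>_def F_def R by (simp add: algebra_simps)
        then show "\<theta> t = 0" by (simp add: cs(4,5))
        have "\<theta>' t = (c (t + 1) + c (t - 1) - 2 * c 1 * c t) * C b + m * ((s (t + 1) + s (t - 1) - 2 * c 1 * s t) * D b)"
          unfolding \<theta>'_def F'_def R by (simp add: algebra_simps)
        then show "\<theta>' t = 0" by (simp add: cs(4,5))
      qed
      \<comment> \<open>The plateau must equal 1 on [a - 1, b + 1], which carries \<theta>; a > 1
        leaves room for this inside t > 0.\<close>
      obtain n0 where n0: "inverse (real (Suc n0)) < a - 1"
        using reals_Archimedean[of "a - 1"] a by auto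
      obtain n1 :: nat where n1: "b + 1 < real n1"
        using reals_Archimedean2 by blast
      define n where "n = n0 + n1"
      have n: "inverse (real (Suc n)) < a - 1" "b + 1 < real (Suc n)"
      proof -
        have "inverse (real (Suc n)) \<le> inverse (real (Suc n0))"
          by (intro le_imp_inverse_le) (auto simp: n_def)
        with n0 show "inverse (real (Suc n)) < a - 1" by linarith
        show "b + 1 < real (Suc n)"
          using n1 by (simp add: n_def)
      qed
      have "(LINT t|lborel. f t * of_real (\<theta>'' t + m * \<theta> t)) = 0"
      proof (rule weak_form_plateau[OF _ _ f0 f H[unfolded \<rho>_def] d\<theta> d\<theta>' cont\<theta>''])
        show "inverse (real (Suc (Suc n))) < inverse (real (Suc n))" "real (Suc n) < real (Suc (Suc n))"
          by (auto intro!: less_imp_inverse_less)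
        show "0 < inverse (real (Suc (Suc n)))" by simp
        fix t assume "t \<notin> {inverse (real (Suc n))<..<real (Suc n)}"
        then have t: "t < a - 1 \<or> b + 1 < t"
          using n by auto
        then have "\<theta> t = 0" "\<theta>' t = 0"
          using low high by auto
        moreover have "\<eta> (t + 1) = 0" "\<eta> (t - 1) = 0" "\<eta> t = 0"
          using t True by (auto intro!: \<eta>(2))
        ultimately show "\<theta> t = 0 \<and> \<theta>' t = 0 \<and> \<theta>'' t = 0"
          using eq[of t] by simp
      qed
      then have zero: "(LINT t|lborel. f t * of_real (\<eta> (t + 1)) + f t * of_real (\<eta> (t - 1))
          - 2 * of_real (c 1) * (f t * of_real (\<eta> t))) = 0"
        unfolding eq by (simp add: algebra_simps)
      have i0: "integrable lborel (\<lambda>t. f t * of_real (\<eta> t))"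
        using f[of a b] a \<eta> by (intro integrable_mult_continuous_compact[of a b]) auto
      have i1: "integrable lborel (\<lambda>t. f (t - 1) * of_real (\<eta> t))"
        using shifted[OF a] \<eta> by (intro integrable_mult_continuous_compact[of a b]) auto
      have i2: "integrable lborel (\<lambda>t. f (t + 1) * of_real (\<eta> t))"
        using shifted[OF a] \<eta> by (intro integrable_mult_continuous_compact[of a b]) auto
      \<comment> \<open>Translation of the integrals moves the shifts from \<eta> to f with the
        opposite sign, which produces g.\<close>
      have j1: "integrable lborel (\<lambda>t. f t * of_real (\<eta> (t + 1)))"
        "(LINT t|lborel. f t * of_real (\<eta> (t + 1))) = (LINT t|lborel. f (t - 1) * of_real (\<eta> t))"
        using integral_translate[OF i1, of 1] by simp_all
      have j2: "integrable lborel (\<lambda>t. f t * of_real (\<eta> (t - 1)))"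
        "(LINT t|lborel. f t * of_real (\<eta> (t - 1))) = (LINT t|lborel. f (t + 1) * of_real (\<eta> t))"
        using integral_translate[OF i2, of "-1"] by simp_all
      have "(LINT t|lborel. g t * of_real (\<eta> t)) = (LINT t|lborel. f (t - 1) * of_real (\<eta> t)
          + f (t + 1) * of_real (\<eta> t) - 2 * of_real (c 1) * (f t * of_real (\<eta> t)))"
        by (simp add: g_def algebra_simps)
      also have "\<dots> = (LINT t|lborel. f t * of_real (\<eta> (t + 1)) + f t * of_real (\<eta> (t - 1))
          - 2 * of_real (c 1) * (f t * of_real (\<eta> t)))"
        using i0 i1 i2 j1 j2 by simp
      finally show ?thesis
        using zero by simp
    qed
  qed
  then show ?thesis
  proof (rule AE_mp, intro AE_I2 impI)
    fix t assume "1 < t \<longrightarrow> g t = 0" "1 < t"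
    then have "f (t - 1) = 2 * of_real (c 1) * f t - f (t + 1)"
      by (simp add: g_def algebra_simps)
    then have "norm (f (t - 1)) \<le> norm (2 * of_real (c 1) * f t) + norm (f (t + 1))"
      using norm_triangle_ineq4 by metis
    \<comment> \<open>Because |c(1)| \<le> 1, the constants in the final bound do not depend on
      m.\<close>
    also have "norm (2 * of_real (c 1) * f t) \<le> 2 * norm (f t)"
      using cs(6) by (simp add: norm_mult mult_left_le_one_le)
    finally show "norm (f (t - 1)) \<le> 2 * norm (f t) + norm (f (t + 1))"
      by simp
  qed
qed

text \<open>Integration of the three-term bound over 1 < t < 2 moves its left side to (0, 1) and its
  right side to (1, 2) and (2, 3); the constant is 2 + 1.\<close>

lemma weak_oscillator_integrable_near_0:
  fixes f :: "real \<Rightarrow> complex"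
  assumes [measurable]: "f \<in> borel_measurable borel"
    and le: "AE t in lborel. 1 < t \<longrightarrow> norm (f (t - 1)) \<le> 2 * norm (f t) + norm (f (t + 1))"
  shows "(\<integral>\<^sup>+t. ennreal (norm (f t)) * indicator {0<..<1} t \<partial>lborel)
    \<le> 3 * (\<integral>\<^sup>+t. ennreal (norm (f t)) * indicator {1..3} t \<partial>lborel)"
proof -
  have "(\<integral>\<^sup>+t. ennreal (norm (f t)) * indicator {0<..<1} t \<partial>lborel)
      = (\<integral>\<^sup>+t. ennreal (norm (f (t - 1))) * indicator {1<..<2} t \<partial>lborel)"
    by (subst nn_integral_real_affine[where c=1 and t="-1"]) (auto intro!: nn_integral_cong simp: indicator_def)
  also have "\<dots> \<le> (\<integral>\<^sup>+t. 2 * (ennreal (norm (f t)) * indicator {1<..<2} t)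
      + ennreal (norm (f (t + 1))) * indicator {1<..<2} t \<partial>lborel)"
  proof (rule nn_integral_mono_AE, rule AE_mp[OF le], intro AE_I2 impI)
    fix t assume *: "1 < t \<longrightarrow> norm (f (t - 1)) \<le> 2 * norm (f t) + norm (f (t + 1))"
    show "ennreal (norm (f (t - 1))) * indicator {1<..<2} t \<le> 2 * (ennreal (norm (f t)) * indicator {1<..<2} t)
      + ennreal (norm (f (t + 1))) * indicator {1<..<2} t"
    proof (cases "t \<in> {1<..<2}")
      case True
      then have "ennreal (norm (f (t - 1))) \<le> ennreal (2 * norm (f t) + norm (f (t + 1)))"
        using * by (intro ennreal_leI) auto
      also have "\<dots> = 2 * ennreal (norm (f t)) + ennreal (norm (f (t + 1)))"
        by (simp add: ennreal_mult')
      finally show ?thesis using True by simp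
    qed simp
  qed
  also have "\<dots> = 2 * (\<integral>\<^sup>+t. ennreal (norm (f t)) * indicator {1<..<2} t \<partial>lborel)
      + (\<integral>\<^sup>+t. ennreal (norm (f (t + 1))) * indicator {1<..<2} t \<partial>lborel)"
    by (simp add: nn_integral_add nn_integral_cmult)
  also have "(\<integral>\<^sup>+t. ennreal (norm (f (t + 1))) * indicator {1<..<2} t \<partial>lborel)
      = (\<integral>\<^sup>+t. ennreal (norm (f t)) * indicator {2<..<3} t \<partial>lborel)"
    by (subst (2) nn_integral_real_affine[where c=1 and t="1"])
      (auto intro!: nn_integral_cong simp: indicator_def add.commute)
  also have "2 * (\<integral>\<^sup>+t. ennreal (norm (f t)) * indicator {1<..<2} t \<partial>lborel)
      + (\<integral>\<^sup>+t. ennreal (norm (f t)) * indicator {2<..<3} t \<partial>lborel)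
    \<le> 2 * (\<integral>\<^sup>+t. ennreal (norm (f t)) * indicator {1..3} t \<partial>lborel)
      + (\<integral>\<^sup>+t. ennreal (norm (f t)) * indicator {1..3} t \<partial>lborel)"
    by (intro add_mono mult_left_mono nn_integral_mono) (auto simp: indicator_def)
  also have "\<dots> = 3 * (\<integral>\<^sup>+t. ennreal (norm (f t)) * indicator {1..3} t \<partial>lborel)"
    using distrib_right[of 2 1 "\<integral>\<^sup>+t. ennreal (norm (f t)) * indicator {1..3} t \<partial>lborel"] by simp
  finally show ?thesis .
qed

text \<open>For given \<eta> the equation F'' + m F = \<eta> is solved with zero data at a time
  beyond the support of \<eta>. Nothing is asked of F at t = 0: the plateaus are 1 on [-1, n + 1],
  so the hypothesis H encodes the zero initial data, and testing with F leaves the integral of f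
  \<eta>.\<close>

lemma weak_oscillator_zero_data:
  fixes f :: "real \<Rightarrow> complex"
  defines "\<rho> \<equiv> \<lambda>n. plateau (- 2) (- 1) (real (Suc n)) (real (Suc (Suc n)))"
  assumes f0: "\<And>t. t \<le> 0 \<Longrightarrow> f t = 0" and f: "\<And>a b. set_integrable lborel {a..b} f"
    and m: "0 \<le> m"
    and H: "\<And>n k. (LINT t|lborel. f t * of_real (deriv (deriv (\<lambda>t. \<rho> n t * t ^ k)) t + m * (\<rho> n t * t ^ k))) = 0"
  shows "AE t in lborel. 0 < t \<longrightarrow> f t = 0"
proof -
  obtain c s where cs: "\<And>t. (c has_real_derivative - m * s t) (at t)" "\<And>t. (s has_real_derivative c t) (at t)"
    "\<And>t. c t * c t + m * (s t * s t) = 1"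
    using oscillator[OF m] by metis
  have cont: "continuous_on A c" "continuous_on A s" for A
    by (rule DERIV_continuous_on, rule has_field_derivative_at_within, rule cs)+
  show ?thesis
  proof (rule AE_eq_0_on_half_line)
    show "set_integrable lborel {a..b} f" for a b
      by (rule f)
    fix a b :: real and \<eta> :: "real \<Rightarrow> real"
    assume a: "0 < a" and \<eta>: "continuous_on UNIV \<eta>" "\<And>t. t \<notin> {a..b} \<Longrightarrow> \<eta> t = 0"
    \<comment> \<open>One unit beyond b, so that \<eta> vanishes at b' itself as well as after it,
      and C and D stay 0 there.\<close>
    define b' where "b' = b + 1"
    obtain C where C: "\<And>t. (C has_real_derivative c t * \<eta> t) (at t)" "C b' = 0"
      using ex_antiderivative[of "\<lambda>t. c t * \<eta> t" b'] cont \<eta>(1) by (metis continuous_on_mult)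
    obtain D where D: "\<And>t. (D has_real_derivative s t * \<eta> t) (at t)" "D b' = 0"
      using ex_antiderivative[of "\<lambda>t. s t * \<eta> t" b'] cont \<eta>(1) by (metis continuous_on_mult)
    have right: "C t = 0" "D t = 0" if "b' \<le> t" for t
    proof -
      have "\<eta> r = 0" if "b' \<le> r" for r
        using \<eta>(2)[of r] that by (auto simp: b'_def)
      then show "C t = 0" "D t = 0"
        using const_if_derivative_0[OF C(1) _ \<open>b' \<le> t\<close>] const_if_derivative_0[OF D(1) _ \<open>b' \<le> t\<close>] C(2) D(2)
        by simp_all
    qed
    define F where "F t = s t * C t - c t * D t" for t
    define F' where "F' t = c t * C t + m * (s t * D t)" for t
    note F = inhomogeneous_oscillator[OF cs C(1) D(1), folded F_def F'_def]
    have contF: "continuous_on UNIV F"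
      by (rule DERIV_continuous_on, rule has_field_derivative_at_within, rule F(1))
    obtain n :: nat where n: "b' < real n"
      using reals_Archimedean2 by blast
    have "(LINT t|lborel. f t * of_real ((\<eta> t - m * F t) + m * F t)) = 0"
    proof (rule weak_form_plateau[OF _ _ f0 f H[unfolded \<rho>_def] F])
      show "continuous_on UNIV (\<lambda>t. \<eta> t - m * F t)"
        by (intro continuous_intros \<eta>(1) contF)
      fix t :: real assume "0 < t" "t \<notin> {- 1<..<real (Suc n)}"
      then have "b' \<le> t"
        using n by auto
      moreover from this have "\<eta> t = 0"
        by (intro \<eta>(2)) (auto simp: b'_def)
      ultimately show "F t = 0 \<and> F' t = 0 \<and> \<eta> t - m * F t = 0"
        using right[of t] by (simp add: F_def F'_def)
    qed auto
    then show "(LINT t|lborel. f t * complex_of_real (\<eta> t)) = 0"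
      by simp
  qed
qed

section \<open>The wave equation frequency by frequency\<close>

lemma not_AE_notin_ball: "0 < r \<Longrightarrow> \<not> (AE x in lborel. x \<notin> ball (c :: 'a::euclidean_space) r)"
proof
  assume r: "0 < r" and "AE x in lborel. x \<notin> ball c r"
  then have "ball c r \<in> null_sets lborel"
    by (subst AE_iff_null_sets) auto
  then have "unit_ball_vol (real DIM('a)) * r ^ DIM('a) = 0"
    using r by (simp add: null_sets_def emeasure_ball)
  with r show False
    using unit_ball_vol_pos[of "real DIM('a)"] by simp
qed

lemma bump_support: "0 < r \<Longrightarrow> r < norm x \<Longrightarrow> bump r x = 0"
  using bump_pos[of r x] bump_nonneg[of r x] by simp

text \<open>On the support |x.\<xi>| \<le> r |\<xi>| \<le> 1 < pi/2, so the cosine is positive and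
  the real part of the transform integrates a nonnegative function that is positive on a
  ball.\<close>

lemma fint_bump_nonzero:
  fixes \<xi> :: "'a::euclidean_space"
  assumes r: "0 < r" "r * norm \<xi> \<le> 1"
  shows "fint (bump r) \<xi> \<noteq> 0"
proof
  have int: "integrable lborel (bump r :: 'a \<Rightarrow> real)"
    by (rule elem_integrable[OF elem_bump]) (rule bump_support[OF r(1)])
  have cos_pos: "0 < cos (x \<bullet> \<xi>)" if "norm x < r" for x
  proof -
    have "\<bar>x \<bullet> \<xi>\<bar> \<le> norm x * norm \<xi>"
      by (rule Cauchy_Schwarz_ineq2)
    also have "\<dots> \<le> r * norm \<xi>"
      using that by (intro mult_right_mono) auto
    finally have "\<bar>x \<bullet> \<xi>\<bar> \<le> 1"
      using r(2) by linarith
    then show ?thesis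
      using pi_gt3 by (intro cos_gt_zero_pi) linarith+
  qed
  assume "fint (bump r) \<xi> = 0"
  moreover have "Re (fint (bump r) \<xi>) = (LINT x|lborel. bump r x * cos (x \<bullet> \<xi>))"
    unfolding fint_def using integrable_of_real_cis[OF int] by (subst integral_Re[symmetric]) simp_all
  ultimately have zero: "(LINT x|lborel. bump r x * cos (x \<bullet> \<xi>)) = 0"
    by simp
  have cos_int: "integrable lborel (\<lambda>x. bump r x * cos (x \<bullet> \<xi>))"
    using integrable_Re[OF integrable_of_real_cis[OF int, of \<xi>]] by simp
  have "0 \<le> bump r x * cos (x \<bullet> \<xi>)" for x
    using cos_pos[of x] bump_pos[OF r(1), of x] bump_nonneg[of r x]
    by (cases "norm x < r") (auto intro!: mult_nonneg_nonneg)
  then have "AE x in lborel. bump r x * cos (x \<bullet> \<xi>) = 0"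
    using integral_nonneg_eq_0_iff_AE[OF cos_int] zero by simp
  then have "AE x in lborel. x \<notin> ball (0::'a) r"
  proof (rule AE_mp, intro AE_I2 impI)
    fix x :: 'a assume "bump r x * cos (x \<bullet> \<xi>) = 0"
    then show "x \<notin> ball 0 r"
      using bump_pos[OF r(1), of x] cos_pos[of x] by auto
  qed
  with not_AE_notin_ball[OF r(1)] show False
    by blast
qed

lemma fint_square_integrable:
  fixes \<psi> :: "'a::euclidean_space \<Rightarrow> real"
  assumes "elem \<psi>" "\<And>x. R < norm x \<Longrightarrow> \<psi> x = 0"
  shows "integrable lborel (\<lambda>\<xi>. (norm (fint \<psi> \<xi>))\<^sup>2)"
proof (rule integrableI_bounded)
  have "\<exists>C\<ge>0. \<forall>\<xi>. (1 + (norm \<xi>)\<^sup>2) ^ DIM('a) * norm (fint \<psi> \<xi>) \<le> C"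
    by (rule fint_decay[OF assms(1), of R]) (rule assms(2))
  then obtain C where C: "0 \<le> C" "\<And>\<xi>. (1 + (norm \<xi>)\<^sup>2) ^ DIM('a) * norm (fint \<psi> \<xi>) \<le> C"
    by blast
  have [measurable]: "fint \<psi> \<in> borel_measurable borel"
    by (intro borel_measurable_fint elem_measurable assms)
  show "(\<lambda>\<xi>. (norm (fint \<psi> \<xi>))\<^sup>2) \<in> borel_measurable lborel"
    by simp
  have "(\<integral>\<^sup>+\<xi>. ennreal (norm ((norm (fint \<psi> \<xi>))\<^sup>2)) \<partial>lborel)
      \<le> (\<integral>\<^sup>+\<xi>. ennreal (C\<^sup>2) * ennreal (inverse ((1 + (norm (\<xi> :: 'a))\<^sup>2) ^ DIM('a))) \<partial>lborel)"
  proof (intro nn_integral_mono)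
    fix \<xi> :: 'a
    define w where "w = (1 + (norm \<xi>)\<^sup>2) ^ DIM('a)"
    have w: "1 \<le> w"
      by (simp add: w_def)
    have "norm (fint \<psi> \<xi>) \<le> C * inverse w"
      using C(2)[of \<xi>] w by (simp add: w_def[symmetric] field_simps)
    then have "(norm (fint \<psi> \<xi>))\<^sup>2 \<le> (C * inverse w)\<^sup>2"
      by (intro power_mono) auto
    also have "\<dots> = C\<^sup>2 * inverse w * inverse w"
      by (simp add: power2_eq_square)
    also have "\<dots> \<le> C\<^sup>2 * inverse w * 1"
      using w by (intro mult_left_mono) (auto simp: inverse_le_1_iff)
    finally show "ennreal (norm ((norm (fint \<psi> \<xi>))\<^sup>2)) \<le> ennreal (C\<^sup>2) * ennreal (inverse ((1 + (norm \<xi>)\<^sup>2) ^ DIM('a)))"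
      using w by (simp add: w_def[symmetric] ennreal_mult'[symmetric] ennreal_leI)
  qed
  also have "\<dots> = ennreal (C\<^sup>2) * (\<integral>\<^sup>+\<xi>. ennreal (inverse ((1 + (norm (\<xi> :: 'a))\<^sup>2) ^ DIM('a))) \<partial>lborel)"
    by (rule nn_integral_cmult) measurable
  also have "\<dots> < \<infinity>"
    using nn_integral_weight_finite[where 'a='a] by (simp add: ennreal_mult_less_top)
  finally show "(\<integral>\<^sup>+\<xi>. ennreal (norm ((norm (fint \<psi> \<xi>))\<^sup>2)) \<partial>lborel) < \<infinity>" .
qed

text \<open>The unit bump serves as auxiliary function: its transform is square integrable by decay
  and has no zero in the unit ball, so the square has nonzero mass.\<close>

lemma fourier_zero_imp_zero:
  fixes W :: "'a::euclidean_space \<Rightarrow> complex"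
  assumes W: "integrable lborel W" and 0: "\<And>x. (LINT \<xi>|lborel. W \<xi> * cis (x \<bullet> \<xi>)) = 0"
  shows "AE \<xi> in lborel. W \<xi> = 0"
proof (rule fourier_unique[OF W _ 0])
  show "integrable lborel (bump 1 :: 'a \<Rightarrow> real)"
    by (rule elem_integrable[OF elem_bump]) (rule bump_support, auto)
  show int: "integrable lborel (\<lambda>\<xi>::'a. (norm (fint (bump 1) \<xi>))\<^sup>2)"
    by (rule fint_square_integrable[OF elem_bump]) (rule bump_support, auto)
  show "(LINT \<xi>|lborel. (norm (fint (bump 1) (\<xi>::'a)))\<^sup>2) \<noteq> 0"
  proof
    assume "(LINT \<xi>|lborel. (norm (fint (bump 1) (\<xi>::'a)))\<^sup>2) = 0"
    then have "AE \<xi> in lborel. (norm (fint (bump 1) (\<xi>::'a)))\<^sup>2 = 0"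
      using int by (subst (asm) integral_nonneg_eq_0_iff_AE) auto
    then have "AE \<xi> in lborel. \<xi> \<notin> ball (0::'a) 1"
      by (rule AE_mp) (use fint_bump_nonzero[of 1 "_ :: 'a"] in \<open>auto intro!: AE_I2\<close>)
    with not_AE_notin_ball[of 1 "0::'a"] show False
      by simp
  qed
qed

text \<open>By Fubini the tested identities say that \<open>fint \<psi> \<xi>\<close> times the time
  integral at \<xi> has a vanishing Fourier transform at every x; uniqueness makes this product 0
  almost everywhere. The null set depends on \<theta> and \<psi>.\<close>

lemma weak_form_frequencywise:
  fixes u :: "real \<Rightarrow> 'a::euclidean_space \<Rightarrow> complex"
  assumes u [measurable]: "(\<lambda>p. u (snd p) (fst p)) \<in> borel_measurable (borel \<Otimes>\<^sub>M borel)"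
    and m [measurable]: "m \<in> borel_measurable borel" and m_nonneg: "\<And>\<xi>. 0 \<le> m \<xi>"
    and \<psi> [measurable]: "\<psi> \<in> borel_measurable borel"
    and \<theta>: "elem \<theta>" "\<And>t. t \<notin> {a..b} \<Longrightarrow> \<theta> t = 0"
    and fin: "(\<integral>\<^sup>+\<xi>. (\<integral>\<^sup>+t. ennreal (norm (u t \<xi>)) * indicator {a..b} t \<partial>lborel)
      * ennreal ((1 + m \<xi>) * norm (fint \<psi> \<xi>)) \<partial>lborel) < \<infinity>"
    and 0: "\<And>x. (LINT t|lborel. LINT \<xi>|lborel.
      u t \<xi> * of_real (deriv (deriv \<theta>) t + m \<xi> * \<theta> t) * (fint \<psi> \<xi> * cis (x \<bullet> \<xi>))) = 0"
  shows "AE \<xi> in lborel. fint \<psi> \<xi> \<noteq> 0 \<longrightarrow>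
    (LINT t|lborel. u t \<xi> * of_real (deriv (deriv \<theta>) t + m \<xi> * \<theta> t)) = 0"
proof -
  have [measurable]: "fint \<psi> \<in> borel_measurable borel"
    by (rule borel_measurable_fint[OF \<psi>])
  have [measurable]: "(\<lambda>t. u t \<xi>) \<in> borel_measurable borel" for \<xi>
    using measurable_compose[OF measurable_Pair1'[of \<xi> borel borel] u] by simp
  have d1: "deriv \<theta> t = 0" if "t \<notin> {a..b}" for t
    by (rule deriv_const_on_open[of "- {a..b}"]) (use \<theta>(2) that in auto)
  have d2: "deriv (deriv \<theta>) t = 0" if "t \<notin> {a..b}" for t
    by (rule deriv_const_on_open[of "- {a..b}"]) (use d1 that in auto)
  have [measurable]: "\<theta> \<in> borel_measurable borel" "deriv (deriv \<theta>) \<in> borel_measurable borel"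
    using \<theta>(1) by (auto intro: elem_measurable elem_deriv)
  have supp: "\<bar>a\<bar> + \<bar>b\<bar> < norm t \<Longrightarrow> t \<notin> {a..b}" for t
    by auto
  have "\<exists>B\<ge>0. \<forall>t. \<bar>\<theta> t\<bar> \<le> B" "\<exists>B\<ge>0. \<forall>t. \<bar>deriv (deriv \<theta>) t\<bar> \<le> B"
    using \<theta>(2) d2 supp by (auto intro!: elem_bounded[where R="\<bar>a\<bar> + \<bar>b\<bar>"] elem_deriv \<theta>(1))
  then obtain B0 B2 where B: "0 \<le> B0" "\<And>t. \<bar>\<theta> t\<bar> \<le> B0" "0 \<le> B2" "\<And>t. \<bar>deriv (deriv \<theta>) t\<bar> \<le> B2"
    by metis
  \<comment> \<open>The profile and its second derivative are bounded, so the multiplier costs at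
    most K (1 + m(\<xi>)), which is the weight in the finiteness hypothesis.\<close>
  define K where "K = B0 + B2"
  have K: "\<bar>deriv (deriv \<theta>) t + m \<xi> * \<theta> t\<bar> \<le> indicat_real {a..b} t * (K * (1 + m \<xi>))" for t \<xi>
  proof (cases "t \<in> {a..b}")
    case True
    have "\<bar>deriv (deriv \<theta>) t + m \<xi> * \<theta> t\<bar> \<le> \<bar>deriv (deriv \<theta>) t\<bar> + m \<xi> * \<bar>\<theta> t\<bar>"
      using m_nonneg[of \<xi>] by (intro order.trans[OF abs_triangle_ineq]) (simp add: abs_mult)
    also have "\<dots> \<le> B2 + m \<xi> * B0"
      using B m_nonneg by (intro add_mono mult_left_mono) auto
    also have "\<dots> \<le> K * (1 + m \<xi>)"
      using B m_nonneg[of \<xi>] by (simp add: K_def algebra_simps)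
    finally show ?thesis using True by simp
  qed (simp add: \<theta>(2) d2)
  have K_nonneg: "0 \<le> K"
    using B by (simp add: K_def)
  let ?h = "\<lambda>x \<xi> t. u t \<xi> * of_real (deriv (deriv \<theta>) t + m \<xi> * \<theta> t) * (fint \<psi> \<xi> * cis (x \<bullet> \<xi>))"
  have int: "integrable (lborel \<Otimes>\<^sub>M lborel) (\<lambda>(\<xi>, t). ?h x \<xi> t)" for x
  proof (rule pair_integrableI)
    show "(\<lambda>(\<xi>, t). ?h x \<xi> t) \<in> borel_measurable (lborel \<Otimes>\<^sub>M lborel)"
      by (simp add: split_beta')
    have "(\<integral>\<^sup>+\<xi>. \<integral>\<^sup>+t. ennreal (norm (case (\<xi>, t) of (\<xi>, t) \<Rightarrow> ?h x \<xi> t)) \<partial>lborel \<partial>lborel)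
      \<le> (\<integral>\<^sup>+\<xi>. \<integral>\<^sup>+t. ennreal K * ((ennreal (norm (u t \<xi>)) * indicator {a..b} t)
          * ennreal ((1 + m \<xi>) * norm (fint \<psi> \<xi>))) \<partial>lborel \<partial>lborel)"
    proof (intro nn_integral_mono)
      fix \<xi> t
      have "norm (?h x \<xi> t) \<le> norm (u t \<xi>) * (indicat_real {a..b} t * (K * (1 + m \<xi>))) * norm (fint \<psi> \<xi>)"
        unfolding norm_mult norm_cis mult_1_right norm_of_real
        by (intro mult_right_mono mult_left_mono K) auto
      also have "\<dots> = K * ((norm (u t \<xi>) * indicat_real {a..b} t) * ((1 + m \<xi>) * norm (fint \<psi> \<xi>)))"
        by (simp add: mult_ac)
      finally show "ennreal (norm (case (\<xi>, t) of (\<xi>, t) \<Rightarrow> ?h x \<xi> t))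
        \<le> ennreal K * ((ennreal (norm (u t \<xi>)) * indicator {a..b} t) * ennreal ((1 + m \<xi>) * norm (fint \<psi> \<xi>)))"
        using K_nonneg m_nonneg[of \<xi>]
        by (simp add: ennreal_mult[symmetric] ennreal_indicator[symmetric] ennreal_leI)
    qed
    also have "\<dots> = ennreal K * (\<integral>\<^sup>+\<xi>. (\<integral>\<^sup>+t. ennreal (norm (u t \<xi>)) * indicator {a..b} t \<partial>lborel)
      * ennreal ((1 + m \<xi>) * norm (fint \<psi> \<xi>)) \<partial>lborel)"
      by (simp add: nn_integral_cmult nn_integral_multc)
    also have "\<dots> < \<infinity>"
      using fin by (simp add: ennreal_mult_less_top)
    finally show "(\<integral>\<^sup>+\<xi>. \<integral>\<^sup>+t. ennreal (norm (case (\<xi>, t) of (\<xi>, t) \<Rightarrow> ?h x \<xi> t)) \<partial>lborel \<partial>lborel) < \<infinity>" .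
  qed
  define W where "W \<xi> = (LINT t|lborel. ?h 0 \<xi> t)" for \<xi>
  have W: "integrable lborel W"
    unfolding W_def using lborel_pair.integrable_fst[OF int[of 0]] .
  have "AE \<xi> in lborel. W \<xi> = 0"
  proof (rule fourier_zero_imp_zero[OF W])
    fix x
    have "W \<xi> * cis (x \<bullet> \<xi>) = (LINT t|lborel. ?h x \<xi> t)" for \<xi>
      unfolding W_def integral_mult_left_zero[symmetric] by (simp add: mult.assoc)
    then have "(LINT \<xi>|lborel. W \<xi> * cis (x \<bullet> \<xi>)) = (LINT \<xi>|lborel. LINT t|lborel. ?h x \<xi> t)"
      by presburger
    also have "\<dots> = (LINT t|lborel. LINT \<xi>|lborel. ?h x \<xi> t)"
      using lborel_pair.Fubini_integral[OF int[of x]] ..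
    finally show "(LINT \<xi>|lborel. W \<xi> * cis (x \<bullet> \<xi>)) = 0"
      using 0 by simp
  qed
  then show ?thesis
  proof (rule AE_mp, intro AE_I2 impI)
    fix \<xi> assume "W \<xi> = 0" "fint \<psi> \<xi> \<noteq> 0"
    moreover have "W \<xi> = (LINT t|lborel. u t \<xi> * of_real (deriv (deriv \<theta>) t + m \<xi> * \<theta> t)) * fint \<psi> \<xi>"
      unfolding W_def integral_mult_left_zero[symmetric] by simp
    ultimately show "(LINT t|lborel. u t \<xi> * of_real (deriv (deriv \<theta>) t + m \<xi> * \<theta> t)) = 0"
      by simp
  qed
qed

text \<open>The finiteness hypothesis stops short of t = 0, which forces two passes. The profiles
  \<rho> supported in t > 0 yield the three-term bound and with it finiteness up to t = 0; that
  finiteness in turn justifies Fubini for the profiles \<sigma> that equal 1 around t = 0.\<close>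

lemma wave_multiplier_unique:
  fixes u :: "real \<Rightarrow> 'a::euclidean_space \<Rightarrow> complex"
  defines "\<psi> \<equiv> \<lambda>n::nat. bump (inverse (real (Suc n))) :: 'a \<Rightarrow> real"
  assumes u [measurable]: "(\<lambda>p. u (snd p) (fst p)) \<in> borel_measurable (borel \<Otimes>\<^sub>M borel)"
    and u0: "\<And>t \<xi>. t \<le> 0 \<Longrightarrow> u t \<xi> = 0"
    and m [measurable]: "m \<in> borel_measurable borel" and m_nonneg: "\<And>\<xi>. 0 \<le> m \<xi>"
    and fin: "\<And>n a b. 0 < a \<Longrightarrow> (\<integral>\<^sup>+\<xi>. (\<integral>\<^sup>+t. ennreal (norm (u t \<xi>)) * indicator {a..b} t \<partial>lborel)
      * ennreal ((1 + m \<xi>) * norm (fint (\<psi> n) \<xi>)) \<partial>lborel) < \<infinity>"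
    and 0: "\<And>n \<theta> x a b. elem \<theta> \<Longrightarrow> (\<And>t. t \<notin> {a..b} \<Longrightarrow> \<theta> t = 0) \<Longrightarrow>
      (LINT t|lborel. LINT \<xi>|lborel.
        u t \<xi> * of_real (deriv (deriv \<theta>) t + m \<xi> * \<theta> t) * (fint (\<psi> n) \<xi> * cis (x \<bullet> \<xi>))) = 0"
  shows "AE \<xi> in lborel. AE t in lborel. u t \<xi> = 0"
proof -
  define J where "J a b \<xi> = (\<integral>\<^sup>+t. ennreal (norm (u t \<xi>)) * indicator {a..b} t \<partial>lborel)" for a b \<xi>
  define G where "G n \<xi> = ennreal ((1 + m \<xi>) * norm (fint (\<psi> n) \<xi>))" for n \<xi>
  have [measurable]: "\<psi> n \<in> borel_measurable borel" for n
    unfolding \<psi>_def by (intro elem_measurable elem_bump)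
  have [measurable]: "fint (\<psi> n) \<in> borel_measurable borel" for n
    by (intro borel_measurable_fint) simp
  have [measurable]: "J a b \<in> borel_measurable borel" "G n \<in> borel_measurable borel" for a b n
    unfolding J_def[abs_def] G_def[abs_def] by measurable
  have [measurable]: "(\<lambda>t. u t \<xi>) \<in> borel_measurable borel" for \<xi>
    using measurable_compose[OF measurable_Pair1'[of \<xi> borel borel] u] by simp
  \<comment> \<open>Each \<xi> is served by a bump of small enough radius, chosen according to
    |\<xi>|.\<close>
  have \<psi>_nz: "\<exists>n. fint (\<psi> n) \<xi> \<noteq> 0" for \<xi>
  proof -
    obtain n :: nat where "norm \<xi> < real n"
      using reals_Archimedean2 by blast
    then have "inverse (real (Suc n)) * norm \<xi> \<le> 1"
      by (simp add: field_simps)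
    then show ?thesis
      unfolding \<psi>_def by (intro exI[of _ n] fint_bump_nonzero) auto
  qed
  have G_nz: "G n \<xi> \<noteq> 0" if "fint (\<psi> n) \<xi> \<noteq> 0" for n \<xi>
    using that m_nonneg[of \<xi>] by (simp add: G_def ennreal_eq_0_iff not_le)
  \<comment> \<open>A finite integral against the weight forces J to be finite at almost every point
    where the weight is nonzero.\<close>
  have finite_J: "AE \<xi> in lborel. \<forall>n. fint (\<psi> n) \<xi> \<noteq> 0 \<longrightarrow> J a b \<xi> < \<infinity>"
    if "\<And>n. (\<integral>\<^sup>+\<xi>. J a b \<xi> * G n \<xi> \<partial>lborel) < \<infinity>" for a b
    unfolding AE_all_countable
  proof
    fix n
    have "AE \<xi> in lborel. J a b \<xi> * G n \<xi> \<noteq> \<infinity>"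
      using that[of n] by (intro nn_integral_PInf_AE) (auto simp: less_top)
    then show "AE \<xi> in lborel. fint (\<psi> n) \<xi> \<noteq> 0 \<longrightarrow> J a b \<xi> < \<infinity>"
      by (rule AE_mp) (auto intro!: AE_I2 simp: less_top[symmetric] ennreal_mult_eq_top_iff dest: G_nz)
  qed
  have set_int: "set_integrable lborel {a..b} (\<lambda>t. u t \<xi>)" if "J a b \<xi> < \<infinity>" for a b \<xi>
    unfolding set_integrable_def
  proof (rule integrableI_bounded)
    have "(\<integral>\<^sup>+t. ennreal (norm (indicat_real {a..b} t *\<^sub>R u t \<xi>)) \<partial>lborel) = J a b \<xi>"
      unfolding J_def by (intro nn_integral_cong) (simp add: indicator_def)
    with that show "(\<integral>\<^sup>+t. ennreal (norm (indicat_real {a..b} t *\<^sub>R u t \<xi>)) \<partial>lborel) < \<infinity>"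
      by simp
  qed measurable
  have testable: "elem (\<lambda>t. plateau a b c d t * t ^ k)" for a b c d :: real and k
    by (intro elem_mult elem_power elem_plateau elem_linear[OF bounded_linear_ident])
  define \<rho> where "\<rho> n = plateau (inverse (real (Suc (Suc n)))) (inverse (real (Suc n))) (real (Suc n)) (real (Suc (Suc n)))" for n
  define \<sigma> where "\<sigma> n = plateau (- 2) (- 1) (real (Suc n)) (real (Suc (Suc n)))" for n
  have \<rho>_supp: "\<rho> n t = 0" if "t \<notin> {inverse (real (Suc (Suc n)))..real (Suc (Suc n))}" for n t
    unfolding \<rho>_def using that by (intro plateau_eq_0) (auto intro!: less_imp_inverse_less)
  have \<sigma>_supp: "\<sigma> n t = 0" if "t \<notin> {-2..real (Suc (Suc n))}" for n t
    unfolding \<sigma>_def using that by (intro plateau_eq_0) auto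
  have AE1: "AE \<xi> in lborel. \<forall>n N k. fint (\<psi> n) \<xi> \<noteq> 0 \<longrightarrow>
      (LINT t|lborel. u t \<xi> * of_real (deriv (deriv (\<lambda>t. \<rho> N t * t ^ k)) t + m \<xi> * (\<rho> N t * t ^ k))) = 0"
    unfolding AE_all_countable
  proof (intro allI)
    fix n N k
    show "AE \<xi> in lborel. fint (\<psi> n) \<xi> \<noteq> 0 \<longrightarrow>
      (LINT t|lborel. u t \<xi> * of_real (deriv (deriv (\<lambda>t. \<rho> N t * t ^ k)) t + m \<xi> * (\<rho> N t * t ^ k))) = 0"
    proof (rule weak_form_frequencywise[OF u m m_nonneg _ _ _ fin])
      show el: "elem (\<lambda>t. \<rho> N t * t ^ k)"
        unfolding \<rho>_def by (rule testable)
      show supp: "\<rho> N t * t ^ k = 0" if "t \<notin> {inverse (real (Suc (Suc N)))..real (Suc (Suc N))}" for t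
        using \<rho>_supp[OF that] by simp
      show "(LINT t|lborel. LINT \<xi>|lborel. u t \<xi> * of_real (deriv (deriv (\<lambda>t. \<rho> N t * t ^ k)) t
          + m \<xi> * (\<rho> N t * t ^ k)) * (fint (\<psi> n) \<xi> * cis (x \<bullet> \<xi>))) = 0" for x
        by (rule 0[OF el supp])
    qed auto
  qed
  have AE2: "AE \<xi> in lborel. \<forall>N n. fint (\<psi> n) \<xi> \<noteq> 0 \<longrightarrow> J (inverse (real (Suc N))) (real (Suc N)) \<xi> < \<infinity>"
    unfolding AE_all_countable[where P="\<lambda>x N. \<forall>n. P x N n" for P]
  proof
    fix N
    have "0 < inverse (real (Suc N))"
      by simp
    from finite_J[OF fin[OF this, folded J_def G_def]]
    show "AE \<xi> in lborel. \<forall>n. fint (\<psi> n) \<xi> \<noteq> 0 \<longrightarrow> J (inverse (real (Suc N))) (real (Suc N)) \<xi> < \<infinity>" .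
  qed
  \<comment> \<open>The constant 3 is the same for all \<xi>, so this bound can be integrated
    against any of the weights G n.\<close>
  have near0: "AE \<xi> in lborel. (\<integral>\<^sup>+t. ennreal (norm (u t \<xi>)) * indicator {0<..<1} t \<partial>lborel) \<le> 3 * J 1 3 \<xi>"
    using AE1 AE2
  proof eventually_elim
    case (elim \<xi>)
    obtain n where n: "fint (\<psi> n) \<xi> \<noteq> 0"
      using \<psi>_nz by blast
    have int: "set_integrable lborel {a..b} (\<lambda>t. u t \<xi>)" if a: "0 < a" for a b
    proof -
      obtain N1 where N1: "inverse (real (Suc N1)) < a"
        using reals_Archimedean[OF a] by blast
      obtain N2 :: nat where N2: "b < real N2"
        using reals_Archimedean2 by blast
      have "inverse (real (Suc (N1 + N2))) \<le> inverse (real (Suc N1))"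
        by (intro le_imp_inverse_le) auto
      with N1 N2 have "inverse (real (Suc (N1 + N2))) \<le> a" "b \<le> real (Suc (N1 + N2))"
        by linarith+
      then have "{a..b} \<subseteq> {inverse (real (Suc (N1 + N2)))..real (Suc (N1 + N2))}"
        by (intro subsetI) (simp only: atLeastAtMost_iff, linarith)
      moreover have "set_integrable lborel {inverse (real (Suc (N1 + N2)))..real (Suc (N1 + N2))} (\<lambda>t. u t \<xi>)"
        using elim(2) n by (intro set_int) blast
      ultimately show ?thesis
        by (rule set_integrable_subset[rotated 2]) simp
    qed
    have "AE t in lborel. 1 < t \<longrightarrow> norm (u (t - 1) \<xi>) \<le> 2 * norm (u t \<xi>) + norm (u (t + 1) \<xi>)"
      by (rule weak_oscillator_translation[OF u0 int m_nonneg])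
        (use elim(1) n in \<open>auto simp only: \<rho>_def\<close>)
    from weak_oscillator_integrable_near_0[OF _ this] show ?case
      unfolding J_def by simp
  qed
  \<comment> \<open>On t \<le> 0 the function is 0, on (0, 1) the bound by [1, 3] applies, and the
    rest is [1, b]; only times t \<ge> 1 remain.\<close>
  have fin0: "(\<integral>\<^sup>+\<xi>. J a b \<xi> * G n \<xi> \<partial>lborel) < \<infinity>" for a b n
  proof -
    have "(\<integral>\<^sup>+\<xi>. J a b \<xi> * G n \<xi> \<partial>lborel) \<le> (\<integral>\<^sup>+\<xi>. 3 * (J 1 3 \<xi> * G n \<xi>) + J 1 b \<xi> * G n \<xi> \<partial>lborel)"
    proof (rule nn_integral_mono_AE, rule AE_mp[OF near0], intro AE_I2 impI)
      fix \<xi> assume near: "(\<integral>\<^sup>+t. ennreal (norm (u t \<xi>)) * indicator {0<..<1} t \<partial>lborel) \<le> 3 * J 1 3 \<xi>"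
      have "J a b \<xi> \<le> (\<integral>\<^sup>+t. ennreal (norm (u t \<xi>)) * indicator {0<..<1} t
          + ennreal (norm (u t \<xi>)) * indicator {1..b} t \<partial>lborel)"
        unfolding J_def by (intro nn_integral_mono) (auto simp: indicator_def u0 not_le not_less)
      also have "\<dots> = (\<integral>\<^sup>+t. ennreal (norm (u t \<xi>)) * indicator {0<..<1} t \<partial>lborel) + J 1 b \<xi>"
        unfolding J_def by (rule nn_integral_add) measurable
      also have "\<dots> \<le> 3 * J 1 3 \<xi> + J 1 b \<xi>"
        using near by (rule add_right_mono)
      finally have "J a b \<xi> * G n \<xi> \<le> (3 * J 1 3 \<xi> + J 1 b \<xi>) * G n \<xi>"
        by (rule mult_right_mono) simp
      then show "J a b \<xi> * G n \<xi> \<le> 3 * (J 1 3 \<xi> * G n \<xi>) + J 1 b \<xi> * G n \<xi>"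
        by (simp add: distrib_right mult.assoc)
    qed
    also have "\<dots> = 3 * (\<integral>\<^sup>+\<xi>. J 1 3 \<xi> * G n \<xi> \<partial>lborel) + (\<integral>\<^sup>+\<xi>. J 1 b \<xi> * G n \<xi> \<partial>lborel)"
      by (simp add: nn_integral_add nn_integral_cmult)
    also have "\<dots> < \<infinity>"
      using fin[of 1 3 n] fin[of 1 b n] by (simp add: J_def[symmetric] G_def[symmetric] ennreal_mult_less_top)
    finally show ?thesis .
  qed
  \<comment> \<open>The second pass: \<open>fin0\<close> supplies finiteness on intervals that
    contain 0.\<close>
  have AE3: "AE \<xi> in lborel. \<forall>n N k. fint (\<psi> n) \<xi> \<noteq> 0 \<longrightarrow>
      (LINT t|lborel. u t \<xi> * of_real (deriv (deriv (\<lambda>t. \<sigma> N t * t ^ k)) t + m \<xi> * (\<sigma> N t * t ^ k))) = 0"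
    unfolding AE_all_countable
  proof (intro allI)
    fix n N k
    show "AE \<xi> in lborel. fint (\<psi> n) \<xi> \<noteq> 0 \<longrightarrow>
      (LINT t|lborel. u t \<xi> * of_real (deriv (deriv (\<lambda>t. \<sigma> N t * t ^ k)) t + m \<xi> * (\<sigma> N t * t ^ k))) = 0"
    proof (rule weak_form_frequencywise[OF u m m_nonneg _ _ _ fin0[unfolded J_def G_def]])
      show el: "elem (\<lambda>t. \<sigma> N t * t ^ k)"
        unfolding \<sigma>_def by (rule testable)
      show supp: "\<sigma> N t * t ^ k = 0" if "t \<notin> {-2..real (Suc (Suc N))}" for t
        using \<sigma>_supp[OF that] by simp
      show "(LINT t|lborel. LINT \<xi>|lborel. u t \<xi> * of_real (deriv (deriv (\<lambda>t. \<sigma> N t * t ^ k)) t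
          + m \<xi> * (\<sigma> N t * t ^ k)) * (fint (\<psi> n) \<xi> * cis (x \<bullet> \<xi>))) = 0" for x
        by (rule 0[OF el supp])
    qed auto
  qed
  have AE4: "AE \<xi> in lborel. \<forall>N n. fint (\<psi> n) \<xi> \<noteq> 0 \<longrightarrow> J (- real N) (real N) \<xi> < \<infinity>"
    unfolding AE_all_countable[where P="\<lambda>x N. \<forall>n. P x N n" for P]
    by (intro allI finite_J fin0)
  show ?thesis
    using AE3 AE4
  proof eventually_elim
    case (elim \<xi>)
    obtain n where n: "fint (\<psi> n) \<xi> \<noteq> 0"
      using \<psi>_nz by blast
    have int: "set_integrable lborel {a..b} (\<lambda>t. u t \<xi>)" for a b
    proof -
      obtain N :: nat where N: "\<bar>a\<bar> + \<bar>b\<bar> < real N"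
        using reals_Archimedean2 by blast
      then have "{a..b} \<subseteq> {- real N..real N}"
        by auto
      moreover have "set_integrable lborel {- real N..real N} (\<lambda>t. u t \<xi>)"
        using elim(2) n by (intro set_int) blast
      ultimately show ?thesis
        by (rule set_integrable_subset[rotated 2]) simp
    qed
    have "AE t in lborel. 0 < t \<longrightarrow> u t \<xi> = 0"
      by (rule weak_oscillator_zero_data[OF u0 int m_nonneg])
        (use elim(1) n in \<open>auto simp only: \<sigma>_def\<close>)
    then show ?case
      by (rule AE_mp) (use u0 in \<open>auto intro!: AE_I2 simp: not_less\<close>)
  qed
qed

section \<open>The distributional formulation on the Fourier side\<close>

text \<open>This is the squared norm of order -s of the spatial factor with the multiplier 1 + m
  included. It is finite for every real s because the transform decays faster than any
  power.\<close>

lemma dual_weight_finite: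
  fixes \<psi> m :: "'a::euclidean_space \<Rightarrow> real"
  assumes \<psi>: "elem \<psi>" "\<And>x. R < norm x \<Longrightarrow> \<psi> x = 0"
    and m: "\<And>\<xi>. 0 \<le> m \<xi>" "\<And>\<xi>. m \<xi> \<le> C * (1 + (norm \<xi>)\<^sup>2)"
  shows "(\<integral>\<^sup>+\<xi>. ennreal ((1 + (norm \<xi>)\<^sup>2) powr (- s) * ((1 + m \<xi>) * norm (fint \<psi> \<xi>))\<^sup>2) \<partial>lborel) < \<infinity>"
proof -
  obtain k :: nat where k: "\<bar>s\<bar> \<le> real k"
    using real_arch_simple by blast
  \<comment> \<open>Here k controls the power -s, the 2 covers the square of 1 + m, which is of
    order 1 + |\<xi>|^2, and \<open>DIM('a)\<close> is left over for integrability.\<close>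
  define M where "M = k + DIM('a) + 2"
  have "\<exists>D\<ge>0. \<forall>\<xi>. (1 + (norm \<xi>)\<^sup>2) ^ M * norm (fint \<psi> \<xi>) \<le> D"
    by (rule fint_decay[OF \<psi>(1), of R]) (rule \<psi>(2))
  then obtain D where D: "0 \<le> D" "\<And>\<xi>. (1 + (norm \<xi>)\<^sup>2) ^ M * norm (fint \<psi> \<xi>) \<le> D"
    by blast
  define K where "K = ((1 + \<bar>C\<bar>) * D)\<^sup>2"
  have bound: "(1 + (norm \<xi>)\<^sup>2) powr (- s) * ((1 + m \<xi>) * norm (fint \<psi> \<xi>))\<^sup>2
      \<le> K * inverse ((1 + (norm \<xi>)\<^sup>2) ^ DIM('a))" for \<xi> :: 'a
  proof -
    define r where "r = 1 + (norm \<xi>)\<^sup>2"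
    have r: "1 \<le> r"
      by (simp add: r_def)
    have "C * r \<le> \<bar>C\<bar> * r"
      using r by (intro mult_right_mono) auto
    with m(2)[of \<xi>] have "m \<xi> \<le> \<bar>C\<bar> * r"
      by (simp add: r_def)
    with r have "1 + m \<xi> \<le> (1 + \<bar>C\<bar>) * r"
      by (simp add: distrib_right)
    moreover have "norm (fint \<psi> \<xi>) \<le> D * inverse (r ^ M)"
      using D(2)[of \<xi>] r by (simp add: r_def[symmetric] field_simps)
    ultimately have "(1 + m \<xi>) * norm (fint \<psi> \<xi>) \<le> ((1 + \<bar>C\<bar>) * r) * (D * inverse (r ^ M))"
      using r m(1)[of \<xi>] by (intro mult_mono) auto
    then have "((1 + m \<xi>) * norm (fint \<psi> \<xi>))\<^sup>2 \<le> (((1 + \<bar>C\<bar>) * r) * (D * inverse (r ^ M)))\<^sup>2"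
      using m(1)[of \<xi>] by (intro power_mono) auto
    also have "\<dots> = K * (r\<^sup>2 * inverse (r ^ M) * inverse (r ^ M))"
      by (simp add: K_def power2_eq_square mult_ac)
    finally have 1: "((1 + m \<xi>) * norm (fint \<psi> \<xi>))\<^sup>2 \<le> K * (r\<^sup>2 * inverse (r ^ M) * inverse (r ^ M))" .
    have "r powr (- s) \<le> r powr real k"
      using k r by (intro powr_mono) auto
    then have 2: "r powr (- s) \<le> r ^ k"
      using r by (simp add: powr_realpow)
    have "r powr (- s) * ((1 + m \<xi>) * norm (fint \<psi> \<xi>))\<^sup>2
        \<le> r ^ k * (K * (r\<^sup>2 * inverse (r ^ M) * inverse (r ^ M)))"
      using 1 2 r by (intro mult_mono) auto
    also have "\<dots> = K * inverse (r ^ DIM('a)) * inverse (r ^ M)"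
      using r by (simp add: M_def power_add field_simps power2_eq_square)
    also have "\<dots> \<le> K * inverse (r ^ DIM('a)) * 1"
      using r by (intro mult_left_mono) (auto simp: K_def inverse_le_1_iff)
    finally show ?thesis
      by (simp add: r_def)
  qed
  have "(\<integral>\<^sup>+\<xi>. ennreal ((1 + (norm \<xi>)\<^sup>2) powr (- s) * ((1 + m \<xi>) * norm (fint \<psi> \<xi>))\<^sup>2) \<partial>lborel)
      \<le> (\<integral>\<^sup>+\<xi>. ennreal K * ennreal (inverse ((1 + (norm (\<xi> :: 'a))\<^sup>2) ^ DIM('a))) \<partial>lborel)"
    using bound by (intro nn_integral_mono) (simp add: K_def ennreal_mult[symmetric] ennreal_leI)
  also have "\<dots> = ennreal K * (\<integral>\<^sup>+\<xi>. ennreal (inverse ((1 + (norm (\<xi> :: 'a))\<^sup>2) ^ DIM('a))) \<partial>lborel)"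
    by (rule nn_integral_cmult) measurable
  also have "\<dots> < \<infinity>"
    using nn_integral_weight_finite[where 'a='a] by (simp add: ennreal_mult_less_top)
  finally show ?thesis .
qed

lemma ennreal_le_sqrt_of_square_le:
  assumes "X\<^sup>2 \<le> ennreal h" "0 \<le> h"
  shows "X \<le> ennreal (sqrt h)"
proof (cases X)
  case (real x)
  then have "x\<^sup>2 \<le> h"
    using assms by (simp add: ennreal_power)
  then have "x \<le> sqrt h"
    by (rule real_le_rsqrt)
  with real show ?thesis
    by (simp add: ennreal_leI)
next
  case top
  with assms show ?thesis
    by (simp add: power2_eq_square ennreal_top_mult top_unique)
qed

text \<open>Cauchy-Schwarz with the weight split into the powers s/2 and -s/2. The summand 1 keeps
  the constant positive: if the H^s norm is infinite the right side has to be infinite, whereas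
  infinity times 0 is 0 in \<open>ennreal\<close>.\<close>

lemma hs_duality:
  fixes g :: "real^'n \<Rightarrow> complex^'n" and G :: "real^'n \<Rightarrow> real"
  assumes [measurable]: "g \<in> borel_measurable borel" "G \<in> borel_measurable borel"
    and G: "\<And>\<xi>. 0 \<le> G \<xi>"
    and N: "(\<integral>\<^sup>+\<xi>. ennreal ((1 + (norm \<xi>)\<^sup>2) powr (- s) * (G \<xi>)\<^sup>2) \<partial>lborel) = ennreal N" "0 \<le> N"
  shows "(\<integral>\<^sup>+\<xi>. ennreal (norm (g \<xi> $ j)) * ennreal (G \<xi>) \<partial>lborel) \<le> hs_norm s g * ennreal (sqrt N + 1)"
proof (cases "hs_sq s g = \<infinity>")
  case True
  then show ?thesis
    using N(2) by (simp add: hs_norm_def ennreal_top_mult add_nonneg_pos ennreal_eq_0_iff not_le)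
next
  case False
  then obtain h where h: "hs_sq s g = ennreal h" "0 \<le> h"
    by (cases "hs_sq s g") auto
  have [measurable]: "(\<lambda>\<xi>. g \<xi> $ j) \<in> borel_measurable borel"
    by (rule measurable_compose[OF assms(1)]) (intro borel_measurable_continuous_onI continuous_intros)
  let ?w = "\<lambda>\<xi> :: real^'n. 1 + (norm \<xi>)\<^sup>2"
  have w: "0 < ?w \<xi>" for \<xi>
    by (simp add: add_pos_nonneg)
  define A B where "A \<xi> = ennreal (?w \<xi> powr (s / 2) * norm (g \<xi> $ j))"
    and "B \<xi> = ennreal (?w \<xi> powr (- s / 2) * G \<xi>)" for \<xi>
  have [measurable]: "A \<in> borel_measurable borel" "B \<in> borel_measurable borel"
    unfolding A_def[abs_def] B_def[abs_def] by measurable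
  have "ennreal (norm (g \<xi> $ j)) * ennreal (G \<xi>) = A \<xi> * B \<xi>" for \<xi>
  proof -
    have "?w \<xi> powr (s / 2) * ?w \<xi> powr (- s / 2) = 1"
      using w[of \<xi>] by (simp add: powr_add[symmetric])
    then have "(?w \<xi> powr (s / 2) * norm (g \<xi> $ j)) * (?w \<xi> powr (- s / 2) * G \<xi>) = norm (g \<xi> $ j) * G \<xi>"
      by (metis (no_types, lifting) mult.assoc mult.left_commute mult_1)
    then show ?thesis
      by (simp add: A_def B_def ennreal_mult[symmetric] G)
  qed
  then have "(\<integral>\<^sup>+\<xi>. ennreal (norm (g \<xi> $ j)) * ennreal (G \<xi>) \<partial>lborel)\<^sup>2 = (\<integral>\<^sup>+\<xi>. A \<xi> * B \<xi> \<partial>lborel)\<^sup>2"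
    by simp
  also have "\<dots> \<le> (\<integral>\<^sup>+\<xi>. (A \<xi>)\<^sup>2 \<partial>lborel) * (\<integral>\<^sup>+\<xi>. (B \<xi>)\<^sup>2 \<partial>lborel)"
    by (rule Cauchy_Schwarz_nn_integral) simp_all
  also have "(\<integral>\<^sup>+\<xi>. (B \<xi>)\<^sup>2 \<partial>lborel) = ennreal N"
  proof -
    have "(B \<xi>)\<^sup>2 = ennreal (?w \<xi> powr (- s) * (G \<xi>)\<^sup>2)" for \<xi>
    proof -
      have "(?w \<xi> powr (- s / 2))\<^sup>2 = ?w \<xi> powr (- s)"
        by (simp add: power2_eq_square powr_add[symmetric])
      then show ?thesis
        by (simp add: B_def ennreal_power G power_mult_distrib)
    qed
    then show ?thesis
      using N by simp
  qed
  also have "(\<integral>\<^sup>+\<xi>. (A \<xi>)\<^sup>2 \<partial>lborel) \<le> hs_sq s g"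
    unfolding hs_sq_def
  proof (intro nn_integral_mono)
    fix \<xi>
    have "(?w \<xi> powr (s / 2))\<^sup>2 = ?w \<xi> powr s"
      by (simp add: power2_eq_square powr_add[symmetric])
    moreover have "(norm (g \<xi> $ j))\<^sup>2 \<le> (norm (g \<xi>))\<^sup>2"
      by (intro power_mono Finite_Cartesian_Product.norm_nth_le) auto
    ultimately show "(A \<xi>)\<^sup>2 \<le> ennreal (?w \<xi> powr s * (norm (g \<xi>))\<^sup>2)"
      by (simp add: A_def ennreal_power power_mult_distrib ennreal_leI mult_left_mono)
  qed
  finally have "(\<integral>\<^sup>+\<xi>. ennreal (norm (g \<xi> $ j)) * ennreal (G \<xi>) \<partial>lborel)\<^sup>2 \<le> ennreal (h * N)"
    using h N(2) by (simp add: mult_right_mono ennreal_mult)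
  then have "(\<integral>\<^sup>+\<xi>. ennreal (norm (g \<xi> $ j)) * ennreal (G \<xi>) \<partial>lborel) \<le> ennreal (sqrt (h * N))"
    using h N(2) by (intro ennreal_le_sqrt_of_square_le) auto
  also have "\<dots> \<le> ennreal (sqrt h * (sqrt N + 1))"
    using h by (intro ennreal_leI) (simp add: real_sqrt_mult distrib_left)
  also have "\<dots> = hs_norm s g * ennreal (sqrt N + 1)"
    using h N(2) by (simp add: hs_norm_def ennreal_mult)
  finally show ?thesis .
qed

lemma test_fun_product:
  fixes \<psi> :: "'a::euclidean_space \<Rightarrow> real" and \<theta> :: "real \<Rightarrow> real"
  assumes "elem \<theta>" "\<And>t. t \<notin> {a..b} \<Longrightarrow> \<theta> t = 0" and "elem \<psi>" "\<And>x. R < norm x \<Longrightarrow> \<psi> x = 0"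
  shows "test_fun (\<lambda>p. (\<theta> (fst p) * \<psi> (snd p)) *\<^sub>R (e :: 'b::real_normed_vector))"
  unfolding test_fun_def
proof
  have "elem (\<lambda>p :: real \<times> 'a. \<theta> (fst p) * \<psi> (snd p))"
    using elem_affine[OF assms(1) bounded_linear_fst, of 0] elem_affine[OF assms(3) bounded_linear_snd, of 0]
    by (intro elem_mult) auto
  then show "smooth (\<lambda>p. (\<theta> (fst p) * \<psi> (snd p)) *\<^sub>R e)"
    by (rule elem_smooth_scaleR)
  have "{p :: real \<times> 'a. (\<theta> (fst p) * \<psi> (snd p)) *\<^sub>R e \<noteq> 0} \<subseteq> {a..b} \<times> cball 0 R"
    using assms(2,4) by (fastforce simp: not_le[symmetric])
  moreover have "bounded ({a..b} \<times> cball (0::'a) R)"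
    by (intro bounded_Times bounded_cball bounded_closed_interval)
  ultimately show "compact (closure {p. (\<theta> (fst p) * \<psi> (snd p)) *\<^sub>R e \<noteq> 0})"
    using bounded_subset by (simp add: compact_closure)
qed

text \<open>Translating the spatial factor by x multiplies its transform by
  \<open>cis (x \<bullet> \<xi>)\<close>, so the free parameter x becomes the variable dual to
  \<xi>. The axis vector isolates one component of U, and the indicator carries the restriction to t
  > 0.\<close>

lemma dist_solution_tested:
  fixes U :: "real \<Rightarrow> real^'n \<Rightarrow> complex^'n"
  assumes par: "0 < \<kappa>" "0 < \<alpha>" "\<alpha> < 1" "0 < \<delta>" "cutoff \<in> borel_measurable borel"
      "\<And>r. 0 \<le> cutoff r \<and> cutoff r \<le> 1" "\<And>r. 1 < \<bar>r\<bar> \<Longrightarrow> cutoff r = 0"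
    and sol: "dist_solution_zero_data \<kappa> \<alpha> \<delta> cutoff U"
    and \<theta>: "elem \<theta>" "\<And>t. t \<notin> {a..b} \<Longrightarrow> \<theta> t = 0"
    and \<psi>: "elem \<psi>" "\<And>x. R < norm x \<Longrightarrow> \<psi> x = 0"
  shows "(LINT t|lborel. LINT \<xi>|lborel. (indicat_real {0<..} t *\<^sub>R U t \<xi> $ j)
    * of_real (deriv (deriv \<theta>) t + symbol \<kappa> \<alpha> \<delta> cutoff \<xi> * \<theta> t) * (fint \<psi> \<xi> * cis (x \<bullet> \<xi>))) = 0"
proof -
  define f where "f y = \<psi> (y - x)" for y
  have f: "elem f"
    unfolding f_def by (rule elem_translate[OF \<psi>(1)])
  have f_supp: "f y = 0" if "R + norm x < norm y" for y
    unfolding f_def using that norm_triangle_ineq2[of y x] by (intro \<psi>(2)) linarith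
  have int\<psi>: "integrable lborel \<psi>"
    by (rule elem_integrable[OF \<psi>(1)]) (rule \<psi>(2))
  have ff: "fint f \<xi> = fint \<psi> \<xi> * cis (x \<bullet> \<xi>)" for \<xi>
    using fint_translate[OF int\<psi>, of "- x" \<xi>] by (simp add: f_def[abs_def] mult.commute)
  let ?e = "axis j 1 :: real^'n"
  define \<phi> where "\<phi> p = (\<theta> (fst p) * f (snd p)) *\<^sub>R ?e" for p
  define k where "k = (2 * pi) powr (- real CARD('n) / 2)"
  have "k \<noteq> 0"
    by (simp add: k_def)
  have test: "test_fun \<phi>"
    unfolding \<phi>_def by (rule test_fun_product[OF \<theta> f f_supp])
  have pair: "hs_pair (U t) (ft (\<lambda>x. dtt \<phi> t x - peri_op \<kappa> \<alpha> \<delta> cutoff (\<lambda>y. \<phi> (t, y)) x))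
    = complex_of_real k * (LINT \<xi>|lborel. U t \<xi> $ j
      * of_real (deriv (deriv \<theta>) t + symbol \<kappa> \<alpha> \<delta> cutoff \<xi> * \<theta> t) * (fint \<psi> \<xi> * cis (x \<bullet> \<xi>)))" for t
  proof -
    have "dtt \<phi> t x = (deriv (deriv \<theta>) t * f x) *\<^sub>R ?e" for x
      unfolding \<phi>_def by (rule dtt_product[OF \<theta>(1) f])
    then have "ft (\<lambda>x. dtt \<phi> t x - peri_op \<kappa> \<alpha> \<delta> cutoff (\<lambda>y. \<phi> (t, y)) x) (- \<xi>) $ i
        = complex_of_real (k * (deriv (deriv \<theta>) t + symbol \<kappa> \<alpha> \<delta> cutoff \<xi> * \<theta> t) * ?e $ i) * fint f \<xi>" for \<xi> i
      \<comment> \<open>\<open>hs_pair\<close> evaluates the transform at -\<xi>, which undoes the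
        sign in \<open>ft\<close>; the symbol is even.\<close>
      using ft_wave_operator[OF par f, where R="R + norm x" and a="deriv (deriv \<theta>) t" and b="\<theta> t"
          and e="?e" and \<xi>="- \<xi>" and j=i] f_supp
      by (simp add: \<phi>_def k_def symbol_minus[OF par])
    then have "(\<Sum>i\<in>UNIV. U t \<xi> $ i * ft (\<lambda>x. dtt \<phi> t x - peri_op \<kappa> \<alpha> \<delta> cutoff (\<lambda>y. \<phi> (t, y)) x) (- \<xi>) $ i)
        = (\<Sum>i\<in>UNIV. if i = j then U t \<xi> $ i
          * (complex_of_real (k * (deriv (deriv \<theta>) t + symbol \<kappa> \<alpha> \<delta> cutoff \<xi> * \<theta> t)) * fint f \<xi>) else 0)" for \<xi>
      by (intro sum.cong) (auto simp: axis_def)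
    then have "(\<Sum>i\<in>UNIV. U t \<xi> $ i * ft (\<lambda>x. dtt \<phi> t x - peri_op \<kappa> \<alpha> \<delta> cutoff (\<lambda>y. \<phi> (t, y)) x) (- \<xi>) $ i)
        = complex_of_real k * (U t \<xi> $ j * of_real (deriv (deriv \<theta>) t + symbol \<kappa> \<alpha> \<delta> cutoff \<xi> * \<theta> t)
          * (fint \<psi> \<xi> * cis (x \<bullet> \<xi>)))" for \<xi>
      by (simp add: ff mult_ac)
    then show ?thesis
      unfolding hs_pair_def by (simp only: integral_mult_right_zero)
  qed
  have "(LINT t:{0<..}|lborel. hs_pair (U t) (ft (\<lambda>x. dtt \<phi> t x - peri_op \<kappa> \<alpha> \<delta> cutoff (\<lambda>y. \<phi> (t, y)) x))) = 0"
    using sol test unfolding dist_solution_zero_data_def Let_def by blast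
  then have "complex_of_real k * (LINT t|lborel. indicat_real {0<..} t *\<^sub>R (LINT \<xi>|lborel. U t \<xi> $ j
      * of_real (deriv (deriv \<theta>) t + symbol \<kappa> \<alpha> \<delta> cutoff \<xi> * \<theta> t) * (fint \<psi> \<xi> * cis (x \<bullet> \<xi>)))) = 0"
    unfolding pair set_lebesgue_integral_def mult_scaleR_right[symmetric] integral_mult_right_zero .
  with \<open>k \<noteq> 0\<close> show ?thesis
    by (simp flip: integral_scaleR_right)
qed

theorem theorem1p2:
  fixes s \<kappa> \<alpha> \<delta> :: real
    and cutoff :: "real \<Rightarrow> real"
    and U :: "real \<Rightarrow> real^'n \<Rightarrow> complex^'n"
  assumes "0 < \<kappa>" and "0 < \<alpha>" and "\<alpha> < 1" and "0 < \<delta>"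
    and "cutoff \<in> borel_measurable borel"
    and "\<And>r. 0 \<le> cutoff r \<and> cutoff r \<le> 1"
    and "\<And>r. 1 < \<bar>r\<bar> \<Longrightarrow> cutoff r = 0"
    and "\<And>r. \<bar>r\<bar> \<le> 1/2 \<Longrightarrow> cutoff r = 1"
    and "L1loc_Hs s U"
    and "dist_solution_zero_data \<kappa> \<alpha> \<delta> cutoff U"
  shows "AE t in lborel. 0 < t \<longrightarrow> (AE \<xi> in lborel. U t \<xi> = 0)"
proof -
  note par = assms(1-7)
  define m where "m = (symbol \<kappa> \<alpha> \<delta> cutoff :: real^'n \<Rightarrow> real)"
  have [measurable]: "m \<in> borel_measurable borel"
    unfolding m_def by (rule symbol_measurable[OF par])
  have m_nonneg: "0 \<le> m \<xi>" for \<xi>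
    unfolding m_def by (rule symbol_nonneg[OF par])
  obtain C where C: "\<And>\<xi>. m \<xi> \<le> C * (1 + (norm \<xi>)\<^sup>2)"
    unfolding m_def using symbol_bound[OF par, where 'n='n] by blast
  have U [measurable]: "(\<lambda>p. U (fst p) (snd p)) \<in> borel_measurable (borel \<Otimes>\<^sub>M borel)"
    using assms(9) by (simp add: L1loc_Hs_def borel_prod)
  have Ut [measurable]: "U t \<in> borel_measurable borel" for t
    using measurable_compose[OF measurable_Pair1'[of t borel borel] U] by simp
  have comp: "(\<lambda>z :: complex^'n. z $ j) \<in> borel_measurable borel" for j
    by (intro borel_measurable_continuous_onI continuous_intros)
  \<comment> \<open>The scalar result is applied to each component, extended by 0 to t \<le>
    0.\<close>
  have comp_zero: "AE \<xi> in lborel. AE t in lborel. indicat_real {0<..} t *\<^sub>R U t \<xi> $ j = 0" for j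
  proof (rule wave_multiplier_unique)
    define u where "u t \<xi> = indicat_real {0<..} t *\<^sub>R U t \<xi> $ j" for t \<xi>
    have u [measurable]: "(\<lambda>p. u (snd p) (fst p)) \<in> borel_measurable (borel \<Otimes>\<^sub>M borel)"
    proof -
      have "(\<lambda>p. U (snd p) (fst p)) \<in> borel_measurable (borel \<Otimes>\<^sub>M borel)"
        using measurable_compose[OF measurable_pair_swap' U] by (simp add: split_beta)
      from measurable_compose[OF this comp] show ?thesis
        unfolding u_def by measurable
    qed
    then show "(\<lambda>p. indicat_real {0<..} (snd p) *\<^sub>R U (snd p) (fst p) $ j) \<in> borel_measurable (borel \<Otimes>\<^sub>M borel)"
      by (simp add: u_def)
    show "indicat_real {0<..} t *\<^sub>R U t \<xi> $ j = 0" if "t \<le> 0" for t \<xi>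
      using that by simp
    show "m \<in> borel_measurable borel" "0 \<le> m \<xi>" for \<xi>
      by (simp_all add: m_nonneg)
    fix n :: nat
    define \<psi> where "\<psi> = (bump (inverse (real (Suc n))) :: real^'n \<Rightarrow> real)"
    have \<psi>: "elem \<psi>" "\<And>x. inverse (real (Suc n)) < norm x \<Longrightarrow> \<psi> x = 0"
      unfolding \<psi>_def by (auto intro: elem_bump bump_support)
    have [measurable]: "fint \<psi> \<in> borel_measurable borel"
      by (intro borel_measurable_fint elem_measurable \<psi>)
    show "(LINT t|lborel. LINT \<xi>|lborel. (indicat_real {0<..} t *\<^sub>R U t \<xi> $ j)
        * of_real (deriv (deriv \<theta>) t + m \<xi> * \<theta> t)
        * (fint (bump (inverse (real (Suc n)))) \<xi> * cis (x \<bullet> \<xi>))) = 0"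
      if "elem \<theta>" "\<And>t. t \<notin> {a..b} \<Longrightarrow> \<theta> t = 0" for \<theta> x a b
      using dist_solution_tested[OF par assms(10) that \<psi>] unfolding m_def \<psi>_def .
    define G where "G \<xi> = (1 + m \<xi>) * norm (fint \<psi> \<xi>)" for \<xi>
    have [measurable]: "G \<in> borel_measurable borel"
      unfolding G_def[abs_def] by measurable
    have G: "0 \<le> G \<xi>" for \<xi>
      by (simp add: G_def m_nonneg)
    have "(\<integral>\<^sup>+\<xi>. ennreal ((1 + (norm \<xi>)\<^sup>2) powr (- s) * (G \<xi>)\<^sup>2) \<partial>lborel) < \<infinity>"
      unfolding G_def by (rule dual_weight_finite[OF \<psi>(1) _ m_nonneg C]) (rule \<psi>(2))
    then obtain N where N: "(\<integral>\<^sup>+\<xi>. ennreal ((1 + (norm \<xi>)\<^sup>2) powr (- s) * (G \<xi>)\<^sup>2) \<partial>lborel) = ennreal N" "0 \<le> N"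
      by (cases "\<integral>\<^sup>+\<xi>. ennreal ((1 + (norm \<xi>)\<^sup>2) powr (- s) * (G \<xi>)\<^sup>2) \<partial>lborel") auto
    fix a b :: real assume a: "0 < a"
    have "(\<integral>\<^sup>+\<xi>. (\<integral>\<^sup>+t. ennreal (norm (u t \<xi>)) * indicator {a..b} t \<partial>lborel) * ennreal (G \<xi>) \<partial>lborel)
        = (\<integral>\<^sup>+\<xi>. \<integral>\<^sup>+t. ennreal (norm (u t \<xi>)) * indicator {a..b} t * ennreal (G \<xi>) \<partial>lborel \<partial>lborel)"
    proof -
      have [measurable]: "(\<lambda>t. u t \<xi>) \<in> borel_measurable borel" for \<xi>
        using measurable_compose[OF measurable_Pair1'[of \<xi> borel borel] u] by simp
      show ?thesis
        by (simp add: nn_integral_multc)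
    qed
    \<comment> \<open>With time outside, the duality estimate bounds the frequency integral at each
      t by the H^s norm, whose local integrability gives finiteness.\<close>
    also have "\<dots> = (\<integral>\<^sup>+t. \<integral>\<^sup>+\<xi>. ennreal (norm (u t \<xi>)) * indicator {a..b} t * ennreal (G \<xi>) \<partial>lborel \<partial>lborel)"
      by (rule lborel_pair.Fubini'[symmetric]) (simp add: split_beta')
    also have "\<dots> \<le> (\<integral>\<^sup>+t. (hs_norm s (U t) * indicator {a..b} t) * ennreal (sqrt N + 1) \<partial>lborel)"
    proof (intro nn_integral_mono)
      fix t
      show "(\<integral>\<^sup>+\<xi>. ennreal (norm (u t \<xi>)) * indicator {a..b} t * ennreal (G \<xi>) \<partial>lborel)
        \<le> (hs_norm s (U t) * indicator {a..b} t) * ennreal (sqrt N + 1)"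
        using hs_duality[OF Ut _ G N, of t j] a by (cases "t \<in> {a..b}") (auto simp: u_def)
    qed
    also have "\<dots> = (\<integral>\<^sup>+t. hs_norm s (U t) * indicator {a..b} t \<partial>lborel) * ennreal (sqrt N + 1)"
    proof (rule nn_integral_multc)
      have [measurable]: "(\<lambda>t. hs_sq s (U t)) \<in> borel_measurable borel"
        unfolding hs_sq_def by measurable
      show "(\<lambda>t. hs_norm s (U t) * indicator {a..b} t) \<in> borel_measurable lborel"
        unfolding hs_norm_def by measurable
    qed
    also have "\<dots> < \<infinity>"
    proof (cases "a \<le> b")
      case True
      then have "(\<integral>\<^sup>+t. hs_norm s (U t) * indicator {a..b} t \<partial>lborel) < \<infinity>"
        using assms(9) a unfolding L1loc_Hs_def by blast
      then show ?thesis
        by (simp add: ennreal_mult_less_top)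
    qed simp
    finally show "(\<integral>\<^sup>+\<xi>. (\<integral>\<^sup>+t. ennreal (norm (indicat_real {0<..} t *\<^sub>R U t \<xi> $ j)) * indicator {a..b} t \<partial>lborel)
      * ennreal ((1 + m \<xi>) * norm (fint (bump (inverse (real (Suc n)))) \<xi>)) \<partial>lborel) < \<infinity>"
      unfolding u_def G_def \<psi>_def .
  qed
  have "AE \<xi> in lborel. AE t in lborel. 0 < t \<longrightarrow> U t \<xi> = 0"
  proof -
    have "AE \<xi> in lborel. \<forall>j\<in>UNIV. AE t in lborel. indicat_real {0<..} t *\<^sub>R U t \<xi> $ j = 0"
      by (intro AE_finite_allI comp_zero) simp
    then show ?thesis
    proof eventually_elim
      case (elim \<xi>)
      then have "AE t in lborel. \<forall>j\<in>UNIV. indicat_real {0<..} t *\<^sub>R U t \<xi> $ j = 0"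
        by (intro AE_finite_allI) auto
      then show ?case
        by (rule AE_mp) (auto intro!: AE_I2 simp: vec_eq_iff)
    qed
  qed
  \<comment> \<open>Exchanging the two almost-everywhere quantifiers is Fubini for null sets; it
    rests on joint measurability of the exceptional set, inherited from U.\<close>
  then have "AE t in lborel. AE \<xi> in lborel. 0 < t \<longrightarrow> U t \<xi> = 0"
  proof (subst lborel_pair.AE_commute)
    have "fst -` {..0} \<inter> space (borel \<Otimes>\<^sub>M borel) \<in> sets (borel \<Otimes>\<^sub>M borel :: (real \<times> (real^'n)) measure)"
      by (rule measurable_sets[OF measurable_fst]) simp
    moreover have "(\<lambda>p. U (fst p) (snd p)) -` {0} \<inter> space (borel \<Otimes>\<^sub>M borel) \<in> sets (borel \<Otimes>\<^sub>M borel)"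
      by (rule measurable_sets[OF U]) simp
    ultimately have "fst -` {..0} \<inter> space (borel \<Otimes>\<^sub>M borel)
        \<union> (\<lambda>p. U (fst p) (snd p)) -` {0} \<inter> space (borel \<Otimes>\<^sub>M borel)
      \<in> sets (borel \<Otimes>\<^sub>M borel :: (real \<times> (real^'n)) measure)"
      by (rule sets.Un)
    also have "fst -` {..0} \<inter> space (borel \<Otimes>\<^sub>M borel)
        \<union> (\<lambda>p. U (fst p) (snd p)) -` {0} \<inter> space (borel \<Otimes>\<^sub>M borel)
      = {p \<in> space (lborel \<Otimes>\<^sub>M lborel). 0 < fst p \<longrightarrow> U (fst p) (snd p) = 0}"
      by (auto simp: space_pair_measure not_less)
    finally show "{p \<in> space (lborel \<Otimes>\<^sub>M lborel). 0 < fst p \<longrightarrow> U (fst p) (snd p) = 0} \<in> sets (lborel \<Otimes>\<^sub>M lborel)"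
      by simp
  qed
  then show ?thesis
    by (rule AE_mp) (auto intro!: AE_I2)
qed

end
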